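(* Let $S\in\mathcal G$ be a geometric action, let $b$ be a drift of $S$ with flow $\psi$, let $M$ be an admissible manifold of $b$, and let $x\in\psi(M,\mathbb R)\cap\tilde D$. Then $x$ has strong local minimizers.
   Context: $D\subseteq\mathbb R^n$ is open and connected; $\tilde D\subseteq D$ is connected and closed in $D$. $\bar B_r(x)$ is the closed Euclidean ball. Curves. An unparameterized oriented curve in $D$ is an equivalence class of functions $\varphi\in C([0,T],D)$, $T>0$, that are identical up to continuous non-decreasing changes of parameterization (their Fréchet distance vanishes); the representatives are its parameterizations. $\gamma\subset G$ means that the image of $\gamma$ lies in $G$. $\Gamma$ is the set of rectifiable curves. $\tilde C(0,1)$ is the set of $\varphi\in C([0,1],D)$ that are absolutely continuous in neighborhoods of all but at most finitely many $\alpha_i\in[0,1]$, and $\tilde\Gamma\supset\Gamma$ is the set of curves that can be parameterized by some $\varphi\in\tilde C(0,1)$. For $x_1,x_2\in\tilde D$, $\Gamma_{x_1}^{x_2}$ is the set of $\gamma\in\Gamma$ with $\gamma\subset\tilde D$ that start at $x_1$ and end at $x_2$. Standing assumption on $\tilde D$: $\forall x\in\tilde D\ \forall\nu>0\ \exists r>0\ \forall w\in\bar B_r(x)\cap\tilde D\ \exists\gamma\in\Gamma_x^w$ with $\operatorname{length}(\gamma)\le\nu$. Geometric actions. $\mathcal G$ is the set of functionals $S\colon\tilde\Gamma\to[0,\infty]$, $S(\gamma)=\int_0^1\ell(\varphi,\varphi')\,d\alpha$ with $\varphi\in\tilde C(0,1)$ an arbitrary parameterization of $\gamma$, where the local action $\ell\in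 C(D\times\mathbb R^n,[0,\infty))$ satisfies $\ell(x,cy)=c\,\ell(x,y)$ for all $x,y$ and $c\ge0$, and $\ell(x,\cdot)$ is convex for every $x\in D$. Drift. $b\in C^1(D,\mathbb R^n)$ is a drift of $S$ if for every compact $K\subset D$ there is $c>0$ such that $\ell(x,y)\ge c\,(|b(x)||y|-\langle b(x),y\rangle)$ for all $x\in K$, $y\in\mathbb R^n$. Its flow $\psi\in C^1(D\times\mathbb R,D)$ solves $\partial_t\psi(x,t)=b(\psi(x,t))$, $\psi(x,0)=x$; it is assumed throughout that $\psi$ is defined for all $t\in\mathbb R$. $\psi(M,\mathbb R):=\{\psi(w,t)\mid w\in M,t\in\mathbb R\}$. Admissible manifold. A set $M\subset D$ is an admissible manifold of $b$ if there exists $f_M\in C(D,\mathbb R)$ such that (i) $M=f_M^{-1}(\{0\})$; (ii) $M$ is compact; (iii) $f_M$ is $C^1$ in a neighborhood of $M$; (iv) $\langle\nabla f_M(x),b(x)\rangle>0$ for all $x\in M$. $P(x_1,x_2)$ denotes the problem $\inf_{\gamma\in\Gamma_{x_1}^{x_2}}S(\gamma)$; a strong minimizer is $\gamma^\star\in\Gamma_{x_1}^{x_2}$ attaining this infimum. A point $x\in\tilde D$ has strong local minimizers if there exist $r,\eta>0$ and a compact $K\subset\tilde D$ such that for all $x_1,x_2\in\bar B_r(x)\cap\tilde D$ the problem $P(x_1,x_2)$ has a strong minimizer $\gamma^\star\in\Gamma_{x_1}^{x_2}$ with $\gamma^\star\subset K$ and $\operatorname{length}(\gamma^\star)\le\eta$.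 *)

theory Defs
  imports "HOL-Analysis.Analysis"
begin

section \<open>Unparameterized oriented curves\<close>

text \<open>
  A pair \<open>(T, \<phi>)\<close> stands for the restriction of \<open>\<phi>\<close> to \<open>[0,T]\<close>; values of \<open>\<phi>\<close> elsewhere are
  irrelevant in all definitions below.
\<close>

type_synonym 'a curve = "(real \<times> (real \<Rightarrow> 'a)) set"

definition parameterizations :: "'a::metric_space set \<Rightarrow> (real \<times> (real \<Rightarrow> 'a)) set" where
  "parameterizations D = {(T, \<phi>). 0 < T \<and> continuous_on {0..T} \<phi> \<and> \<phi> ` {0..T} \<subseteq> D}"

definition time_change :: "real \<Rightarrow> (real \<Rightarrow> real) \<Rightarrow> bool" where
  "time_change T \<alpha> \<longleftrightarrow> continuous_on {0..1} \<alpha> \<and> mono_on {0..1} \<alpha> \<and> \<alpha> ` {0..1} = {0..T}"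

definition frechet_dist ::
    "real \<Rightarrow> (real \<Rightarrow> 'a::metric_space) \<Rightarrow> real \<Rightarrow> (real \<Rightarrow> 'a) \<Rightarrow> real" where
  "frechet_dist T \<phi> U \<theta> =
     Inf {(SUP s\<in>{0..1}. dist (\<phi> (\<alpha> s)) (\<theta> (\<beta> s))) | \<alpha> \<beta>. time_change T \<alpha> \<and> time_change U \<beta>}"

definition same_curve ::
    "'a::metric_space set \<Rightarrow> ((real \<times> (real \<Rightarrow> 'a)) \<times> (real \<times> (real \<Rightarrow> 'a))) set" where
  "same_curve D =
     {((T, \<phi>), (U, \<theta>)). (T, \<phi>) \<in> parameterizations D \<and> (U, \<theta>) \<in> parameterizations D \<and>
        frechet_dist T \<phi> U \<theta> = 0}"

definition curves :: "'a::metric_space set \<Rightarrow> 'a curve set" where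
  "curves D = parameterizations D // same_curve D"

definition curve_image :: "'a curve \<Rightarrow> 'a set" where
  "curve_image \<gamma> = (\<Union>(T, \<phi>)\<in>\<gamma>. \<phi> ` {0..T})"

definition starts_at :: "'a curve \<Rightarrow> 'a \<Rightarrow> bool" where
  "starts_at \<gamma> x \<longleftrightarrow> (\<forall>(T, \<phi>)\<in>\<gamma>. \<phi> 0 = x)"

definition ends_at :: "'a curve \<Rightarrow> 'a \<Rightarrow> bool" where
  "ends_at \<gamma> x \<longleftrightarrow> (\<forall>(T, \<phi>)\<in>\<gamma>. \<phi> T = x)"

definition path_length :: "real \<Rightarrow> (real \<Rightarrow> 'a::metric_space) \<Rightarrow> ennreal" where
  "path_length T \<phi> =
     (SUP (N, t)\<in>{(N, t). mono_on {..N} t \<and> t ` {..N} \<subseteq> {0..T}}.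
        \<Sum>i<N. ennreal (dist (\<phi> (t i)) (\<phi> (t (Suc i)))))"

text \<open>
  Image, endpoints and length are the same for all representatives of a curve, so the union in
  \<^const>\<open>curve_image\<close> and the supremum below merely avoid choosing a representative.
\<close>

definition curve_length :: "'a::metric_space curve \<Rightarrow> ennreal" where
  "curve_length \<gamma> = (SUP (T, \<phi>)\<in>\<gamma>. path_length T \<phi>)"

definition rectifiable_curves :: "'a::metric_space set \<Rightarrow> 'a curve set" where
  "rectifiable_curves D = {\<gamma> \<in> curves D. curve_length \<gamma> < \<infinity>}"

text \<open>The curves \<open>\<Gamma>\<close> from \<open>x\<^sub>1\<close> to \<open>x\<^sub>2\<close>; here \<open>E\<close> is the set written \<open>D\<close> with a tilde.\<close>

definition curves_between ::
    "'a::metric_space set \<Rightarrow> 'a set \<Rightarrow> 'a \<Rightarrow> 'a \<Rightarrow> 'a curve set" where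
  "curves_between D E x\<^sub>1 x\<^sub>2 =
     {\<gamma> \<in> rectifiable_curves D. curve_image \<gamma> \<subseteq> E \<and> starts_at \<gamma> x\<^sub>1 \<and> ends_at \<gamma> x\<^sub>2}"

definition locally_short_connected :: "'a::metric_space set \<Rightarrow> 'a set \<Rightarrow> bool" where
  "locally_short_connected D E \<longleftrightarrow>
     (\<forall>x\<in>E. \<forall>\<nu>>0. \<exists>r>0. \<forall>w\<in>cball x r \<inter> E. \<exists>\<gamma>\<in>curves_between D E x w. curve_length \<gamma> \<le> ennreal \<nu>)"


section \<open>Piecewise locally absolutely continuous parameterizations\<close>

definition abs_continuous_on :: "real set \<Rightarrow> (real \<Rightarrow> 'a::metric_space) \<Rightarrow> bool" where
  "abs_continuous_on I \<phi> \<longleftrightarrow>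
     (\<forall>\<epsilon>>0. \<exists>\<delta>>0. \<forall>(N::nat) u v.
        (\<forall>i<N. u i \<le> v i \<and> {u i..v i} \<subseteq> I) \<and>
        disjoint_family_on (\<lambda>i. {u i<..<v i}) {..<N} \<and>
        (\<Sum>i<N. v i - u i) < \<delta>
        \<longrightarrow> (\<Sum>i<N. dist (\<phi> (u i)) (\<phi> (v i))) < \<epsilon>)"

definition pw_abs_continuous :: "'a::metric_space set \<Rightarrow> (real \<Rightarrow> 'a) set" where
  "pw_abs_continuous D =
     {\<phi>. continuous_on {0..1} \<phi> \<and> \<phi> ` {0..1} \<subseteq> D \<and>
         (\<exists>F. finite F \<and> (\<forall>\<alpha>\<in>{0..1} - F. \<exists>\<delta>>0. abs_continuous_on ({0..1} \<inter> ball \<alpha> \<delta>) \<phi>))}"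

definition pw_abs_continuous_curves :: "'a::metric_space set \<Rightarrow> 'a curve set" where
  "pw_abs_continuous_curves D = {\<gamma> \<in> curves D. \<exists>\<phi>\<in>pw_abs_continuous D. (1, \<phi>) \<in> \<gamma>}"


section \<open>Geometric actions\<close>

definition local_action ::
    "'a::euclidean_space set \<Rightarrow> ('a \<Rightarrow> 'a \<Rightarrow> real) \<Rightarrow> bool" where
  "local_action D l \<longleftrightarrow>
     continuous_on (D \<times> UNIV) (\<lambda>(x, y). l x y) \<and>
     (\<forall>x\<in>D. \<forall>y. 0 \<le> l x y) \<and>
     (\<forall>x\<in>D. \<forall>y. \<forall>c\<ge>0. l x (c *\<^sub>R y) = c * l x y) \<and>
     (\<forall>x\<in>D. convex_on UNIV (l x))"

text \<open>
  The parameterization is arbitrary: \<open>S \<gamma>\<close> is the value of the integral for every admissible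
  parameterization of \<open>\<gamma>\<close>. Off the curves in \<^const>\<open>pw_abs_continuous_curves\<close>, the functional
  \<open>S\<close> is unconstrained. The derivative exists almost everywhere.
\<close>

definition has_local_action ::
    "'a::euclidean_space set \<Rightarrow> ('a \<Rightarrow> 'a \<Rightarrow> real) \<Rightarrow> ('a curve \<Rightarrow> ennreal) \<Rightarrow> bool" where
  "has_local_action D l S \<longleftrightarrow>
     local_action D l \<and>
     (\<forall>\<gamma>\<in>pw_abs_continuous_curves D. \<forall>\<phi>\<in>pw_abs_continuous D. (1, \<phi>) \<in> \<gamma> \<longrightarrow>
        S \<gamma> = (\<integral>\<^sup>+ \<alpha>. ennreal (l (\<phi> \<alpha>) (vector_derivative \<phi> (at \<alpha>))) \<partial>lebesgue_on {0..1}))"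

definition geometric_actions :: "'a::euclidean_space set \<Rightarrow> ('a curve \<Rightarrow> ennreal) set" where
  "geometric_actions D = {S. \<exists>l. has_local_action D l S}"


section \<open>Drifts, flows and admissible manifolds\<close>

definition C1_on :: "'a::real_normed_vector set \<Rightarrow> ('a \<Rightarrow> 'b::real_normed_vector) \<Rightarrow> bool" where
  "C1_on U f \<longleftrightarrow>
     (\<exists>f'. (\<forall>x\<in>U. (f has_derivative blinfun_apply (f' x)) (at x)) \<and> continuous_on U f')"

text \<open>
  On \<open>D \<times> UNIV\<close> the local action is uniquely determined by \<open>S\<close> (consider short straight
  segments), so the existential quantifier refers to the local action of \<open>S\<close>.
\<close>

definition is_drift ::
    "'a::euclidean_space set \<Rightarrow> ('a curve \<Rightarrow> ennreal) \<Rightarrow> ('a \<Rightarrow> 'a) \<Rightarrow> bool" where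
  "is_drift D S b \<longleftrightarrow>
     C1_on D b \<and>
     (\<exists>l. has_local_action D l S \<and>
        (\<forall>K. compact K \<and> K \<subseteq> D \<longrightarrow>
           (\<exists>c>0. \<forall>x\<in>K. \<forall>y. l x y \<ge> c * (norm (b x) * norm y - b x \<bullet> y))))"

definition is_flow ::
    "'a::euclidean_space set \<Rightarrow> ('a \<Rightarrow> 'a) \<Rightarrow> ('a \<times> real \<Rightarrow> 'a) \<Rightarrow> bool" where
  "is_flow D b \<psi> \<longleftrightarrow>
     C1_on (D \<times> UNIV) \<psi> \<and> \<psi> ` (D \<times> UNIV) \<subseteq> D \<and>
     (\<forall>x\<in>D. \<psi> (x, 0) = x \<and>
        (\<forall>t. ((\<lambda>t. \<psi> (x, t)) has_vector_derivative b (\<psi> (x, t))) (at t)))"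

definition admissible_manifold ::
    "'a::euclidean_space set \<Rightarrow> ('a \<Rightarrow> 'a) \<Rightarrow> 'a set \<Rightarrow> bool" where
  "admissible_manifold D b M \<longleftrightarrow>
     (\<exists>f :: 'a \<Rightarrow> real.
        continuous_on D f \<and>
        M = {x \<in> D. f x = 0} \<and>
        compact M \<and>
        (\<exists>U. open U \<and> M \<subseteq> U \<and> U \<subseteq> D \<and> C1_on U f) \<and>
        (\<forall>x\<in>M. \<exists>g. GDERIV f x :> g \<and> g \<bullet> b x > 0))"


section \<open>Minimizers\<close>

definition strong_minimizer ::
    "'a::euclidean_space set \<Rightarrow> 'a set \<Rightarrow> ('a curve \<Rightarrow> ennreal) \<Rightarrow> 'a \<Rightarrow> 'a \<Rightarrow> 'a curve \<Rightarrow> bool" where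
  "strong_minimizer D E S x\<^sub>1 x\<^sub>2 \<gamma> \<longleftrightarrow>
     \<gamma> \<in> curves_between D E x\<^sub>1 x\<^sub>2 \<and> S \<gamma> = (INF \<gamma>'\<in>curves_between D E x\<^sub>1 x\<^sub>2. S \<gamma>')"

definition has_strong_local_minimizers ::
    "'a::euclidean_space set \<Rightarrow> 'a set \<Rightarrow> ('a curve \<Rightarrow> ennreal) \<Rightarrow> 'a \<Rightarrow> bool" where
  "has_strong_local_minimizers D E S x \<longleftrightarrow>
     (\<exists>r>0. \<exists>\<eta>>0. \<exists>K. compact K \<and> K \<subseteq> E \<and>
        (\<forall>x\<^sub>1\<in>cball x r \<inter> E. \<forall>x\<^sub>2\<in>cball x r \<inter> E.
           \<exists>\<gamma>. strong_minimizer D E S x\<^sub>1 x\<^sub>2 \<gamma> \<and> curve_image \<gamma> \<subseteq> K \<and> curve_length \<gamma> \<le> ennreal \<eta>))"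

end

theory Submission
  imports Defs "HOL-Complex_Analysis.Great_Picard"
begin

text \<open>
  \<^bold>\<open>Why minimizers exist near a point of an admissible manifold.\<close>
  Let \<open>f\<close> be continuous on \<open>D\<close> with zero set \<open>M\<close>, increasing in the direction of the drift at
  every point of \<open>M\<close>. Pulling \<open>f\<close> back by the flow gives such a function for every set
  \<open>\<psi>(M, t)\<close>, so \<open>x\<close> may be assumed to lie on \<open>M\<close> itself (\<open>admissible_manifold_through\<close>).

  On a compact neighbourhood \<open>V\<close> of \<open>M\<close> there are constants \<open>A, B > 0\<close> with
  \<open>|y| \<le> A \<ell>(p, y) + B \<langle>\<nabla>f(p), y\<rangle>\<close> (\<open>drift_controls_length\<close>): the drift estimate bounds all
  directions except the one of \<open>b(p)\<close>, and in that direction \<open>f\<close> increases. Along a curve in \<open>V\<close>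
  this gives \<open>length \<le> A S + B (f(end) - f(start))\<close>. In particular, a decrease of \<open>f\<close> costs
  an amount of action proportional to the decrease (\<open>decrease_costs_action\<close>). Since \<open>M\<close> is the
  whole zero set, \<open>f\<close>, truncated at a small level \<open>\<tau>\<close>, extends from \<open>V\<close> to a continuous function
  \<open>k\<close> on \<open>D\<close> with values \<open>\<plusminus>\<tau>\<close> outside \<open>V\<close>. A curve that starts and ends near \<open>x\<close>, where \<open>k\<close> is
  small, but leaves \<open>V\<close>, makes \<open>k\<close> decrease by a fixed amount, either after \<open>k\<close> has reached \<open>\<tau>\<close> or
  before it reaches \<open>-\<tau>\<close>. So curves of small action stay in \<open>V\<close>, where their length is bounded.
  By the local connectedness assumption, any two points close to \<open>x\<close> are joined by a curve of
  small action.

  It remains to apply the direct method (\<open>strong_minimizer_exists\<close>). Curves of length at most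
  \<open>\<Lambda>\<close> have parameterizations on \<open>[0,1]\<close> with a Lipschitz constant slightly above \<open>\<Lambda>\<close>
  (\<open>lipschitz_reparameterization\<close>), a minimizing sequence of these converges uniformly along a
  subsequence, and the action is lower semicontinuous (\<open>action_lower_semicontinuous\<close>).

  All estimates of the action are made on the finite sums \<open>action_sum\<close>, which converge to the
  action of a Lipschitz curve (\<open>action_sum_tendsto\<close>). This is the only place where derivatives of
  curves enter; it rests on the almost everywhere differentiability of Lipschitz functions.
\<close>

section \<open>Lipschitz functions of one real variable are differentiable almost everywhere\<close>

lemma Vitali_covering_by_intervals:
  fixes S W :: "real set"
  assumes "open W" "S \<subseteq> W"
    and cover: "\<And>x d. x \<in> S \<Longrightarrow> 0 < d \<Longrightarrow> \<exists>u v. u \<le> x \<and> x \<le> v \<and> u < v \<and> v - u < d \<and> Q u v"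
  obtains C where "countable C" "\<And>u v. (u, v) \<in> C \<Longrightarrow> u < v \<and> Q u v \<and> {u..v} \<subseteq> W"
    "disjoint_family_on (\<lambda>(u, v). {u..v}) C" "negligible (S - (\<Union>(u, v)\<in>C. {u..v}))"
proof -
  define K where "K = {(u, v). u < v \<and> Q u v \<and> {u..v} \<subseteq> W}"
  let ?a = "\<lambda>(u, v). (u + v) / 2 :: real" and ?r = "\<lambda>(u, v). (v - u) / 2 :: real"
  have ball: "cball (?a i) (?r i) = (case i of (u, v) \<Rightarrow> {u..v})" for i
    by (cases i) (simp add: cball_eq_atLeastAtMost field_simps)
  have 1: "0 < ?r i" if "i \<in> K" for i
    using that by (auto simp: K_def)
  have 2: "\<exists>i. i \<in> K \<and> x \<in> cball (?a i) (?r i) \<and> ?r i < d" if x: "x \<in> S" and d: "0 < d" for x d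
  proof -
    obtain e where e: "e > 0" "ball x e \<subseteq> W"
      using assms x by (meson openE subsetD)
    obtain u v where uv: "u \<le> x" "x \<le> v" "u < v" "v - u < min d e" "Q u v"
      using cover[OF x, of "min d e"] d e by auto
    have "{u..v} \<subseteq> ball x e"
      using uv by (auto simp: dist_real_def)
    then have "(u, v) \<in> K"
      using uv e by (auto simp: K_def)
    then show ?thesis
      using uv d unfolding ball by (intro exI[of _ "(u, v)"]) auto
  qed
  obtain C where C: "countable C" "C \<subseteq> K"
     "pairwise (\<lambda>i j. disjnt (cball (?a i) (?r i)) (cball (?a j) (?r j))) C"
     "negligible (S - (\<Union>i \<in> C. cball (?a i) (?r i)))"
    by (rule Vitali_covering_theorem_cballs[of K ?r S ?a, OF 1 2])
  show ?thesis
  proof (rule that[of C])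
    show "disjoint_family_on (\<lambda>(u, v). {u..v}) C"
      using C(3) unfolding ball by (auto simp: disjoint_family_on_def pairwise_def disjnt_def)
    show "negligible (S - (\<Union>(u, v)\<in>C. {u..v}))"
      using C(4) unfolding ball .
  qed (use C in \<open>auto simp: K_def\<close>)
qed

text \<open>The points \<open>x\<close> such that, at arbitrarily small scales, there are intervals containing \<open>x\<close> with
  a slope of \<open>g\<close> below \<open>p\<close> and others with a slope above \<open>q\<close>. The point \<open>x\<close> may be an endpoint, so
  one-sided difference quotients are covered.\<close>

definition oscillating_slopes :: "(real \<Rightarrow> real) \<Rightarrow> real \<Rightarrow> real \<Rightarrow> real set" where
  "oscillating_slopes g p q = {x. \<forall>d>0.
     (\<exists>u v. u \<le> x \<and> x \<le> v \<and> u < v \<and> v - u < d \<and> g v - g u < p * (v - u)) \<and>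
     (\<exists>u v. u \<le> x \<and> x \<le> v \<and> u < v \<and> v - u < d \<and> q * (v - u) < g v - g u)}"

text \<open>Two applications of Vitali's covering theorem: the set is covered first by disjoint intervals
  on which \<open>g\<close> grows slowly, then, within these, by disjoint intervals on which \<open>g\<close> grows fast.
  Comparing the Stieltjes measures of the two families gives a covering that is smaller by the
  factor \<open>p / q\<close>.\<close>

lemma oscillating_slopes_contraction:
  fixes g :: "real \<Rightarrow> real"
  assumes "mono g" and cont: "continuous_on UNIV g" and "0 < p" "p < q"
    and "open W" "S \<subseteq> W" "S \<subseteq> oscillating_slopes g p q"
  obtains T where "T \<in> sets borel" "negligible (S - T)"
    "ennreal q * emeasure lborel T \<le> ennreal p * emeasure lborel W"
proof -
  define \<nu> where "\<nu> = interval_measure g"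
  have sets_\<nu>: "sets \<nu> = sets borel"
    by (simp add: \<nu>_def)
  have \<nu>: "emeasure \<nu> {u..v} = ennreal (g v - g u)" if "u < v" for u v
    unfolding \<nu>_def
    by (rule emeasure_interval_measure_Icc)
       (use that \<open>mono g\<close> cont in \<open>auto simp: monoD\<close>)
  have fam: "emeasure N (\<Union>(u, v)\<in>C. {u..v}) = (\<integral>\<^sup>+(u, v). emeasure N {u..v} \<partial>count_space C)"
    if "countable C" "disjoint_family_on (\<lambda>(u, v). {u..v}) C" "sets N = sets borel"
    for N :: "real measure" and C
    using emeasure_UN_countable[of C "\<lambda>(u, v). {u..v}" N] that
    by (auto simp: case_prod_unfold)
  have scaled: "(\<integral>\<^sup>+(u, v). ennreal (r * (v - u)) \<partial>count_space C) =
      ennreal r * emeasure lborel (\<Union>(u, v)\<in>C. {u..v})"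
    if C: "countable C" "disjoint_family_on (\<lambda>(u, v). {u..v}) C" "\<And>u v. (u, v) \<in> C \<Longrightarrow> u < v"
      and "0 \<le> r" for C :: "(real \<times> real) set" and r
  proof -
    have "(\<integral>\<^sup>+(u, v). ennreal (r * (v - u)) \<partial>count_space C) =
        (\<integral>\<^sup>+i. ennreal r * (case i of (u, v) \<Rightarrow> emeasure lborel {u..v}) \<partial>count_space C)"
    proof (rule nn_integral_cong)
      fix i assume "i \<in> space (count_space C)"
      then show "(case i of (u, v) \<Rightarrow> ennreal (r * (v - u))) =
          ennreal r * (case i of (u, v) \<Rightarrow> emeasure lborel {u..v})"
        using C(3)[of "fst i" "snd i"] \<open>0 \<le> r\<close> by (cases i) (simp add: ennreal_mult)
    qed
    then show ?thesis
      by (simp add: nn_integral_cmult fam[OF C(1,2)])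
  qed
  obtain C where C: "countable C" "\<And>u v. (u, v) \<in> C \<Longrightarrow> u < v \<and> g v - g u < p * (v - u) \<and> {u..v} \<subseteq> W"
    "disjoint_family_on (\<lambda>(u, v). {u..v}) C" "negligible (S - (\<Union>(u, v)\<in>C. {u..v}))"
    by (rule Vitali_covering_by_intervals[OF assms(5,6), of "\<lambda>u v. g v - g u < p * (v - u)"])
       (use assms(7) in \<open>auto simp: oscillating_slopes_def\<close>)
  \<comment> \<open>Only the endpoints, a countable set, are lost by passing to open intervals.\<close>
  define W' where "W' = (\<Union>(u, v)\<in>C. {u<..<v})"
  have "open W'"
    by (auto simp: W'_def)
  obtain C' where C': "countable C'"
    "\<And>u v. (u, v) \<in> C' \<Longrightarrow> u < v \<and> q * (v - u) < g v - g u \<and> {u..v} \<subseteq> W'"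
    "disjoint_family_on (\<lambda>(u, v). {u..v}) C'" "negligible (S \<inter> W' - (\<Union>(u, v)\<in>C'. {u..v}))"
    by (rule Vitali_covering_by_intervals[OF \<open>open W'\<close>, of "S \<inter> W'" "\<lambda>u v. q * (v - u) < g v - g u"])
       (use assms(7) in \<open>auto simp: oscillating_slopes_def\<close>)
  let ?U = "\<Union>(u, v)\<in>C. {u..v}"
  let ?T = "\<Union>(u, v)\<in>C'. {u..v}"
  have borel: "?U \<in> sets borel" "?T \<in> sets borel"
    using C(1) C'(1) by (auto intro!: sets.countable_UN' simp: case_prod_unfold)
  show ?thesis
  proof
    show "?T \<in> sets borel" by fact
    have "S - ?T \<subseteq> (S - ?U) \<union> (S \<inter> W' - ?T) \<union> (fst ` C \<union> snd ` C)"
    proof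
      fix x assume x: "x \<in> S - ?T"
      show "x \<in> (S - ?U) \<union> (S \<inter> W' - ?T) \<union> (fst ` C \<union> snd ` C)"
      proof (cases "x \<in> ?U")
        case True
        then obtain u v where uv: "(u, v) \<in> C" "u \<le> x" "x \<le> v" by auto
        have "x = u \<or> x = v \<or> x \<in> W'"
          using uv by (force simp: W'_def)
        then show ?thesis
          using x uv by force
      qed (use x in auto)
    qed
    moreover have "negligible (fst ` C \<union> snd ` C)"
      using C(1) countable_imp_null_set_lborel negligible_iff_null_sets null_sets_completionI by blast
    ultimately show "negligible (S - ?T)"
      using C(4) C'(4) by (meson negligible_Un negligible_subset)
    have "ennreal q * emeasure lborel ?T = (\<integral>\<^sup>+(u, v). ennreal (q * (v - u)) \<partial>count_space C')"
      using scaled[OF C'(1,3), of q] C'(2) assms(3,4) by simp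
    also have "\<dots> \<le> (\<integral>\<^sup>+(u, v). emeasure \<nu> {u..v} \<partial>count_space C')"
    proof (rule nn_integral_mono)
      fix i assume "i \<in> space (count_space C')"
      then show "(case i of (u, v) \<Rightarrow> ennreal (q * (v - u))) \<le> (case i of (u, v) \<Rightarrow> emeasure \<nu> {u..v})"
        using C'(2)[of "fst i" "snd i"] by (cases i) (simp add: \<nu> ennreal_leI)
    qed
    also have "\<dots> = emeasure \<nu> ?T"
      using fam[OF C'(1,3) sets_\<nu>] by simp
    also have "\<dots> \<le> emeasure \<nu> ?U"
    proof (rule emeasure_mono)
      have "?T \<subseteq> W'"
        using C'(2) by auto
      also have "W' \<subseteq> ?U"
        unfolding W'_def by (intro UN_mono) auto
      finally show "?T \<subseteq> ?U" .
    qed (use borel sets_\<nu> in auto)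
    also have "\<dots> = (\<integral>\<^sup>+(u, v). emeasure \<nu> {u..v} \<partial>count_space C)"
      using fam[OF C(1,3) sets_\<nu>] by simp
    also have "\<dots> \<le> (\<integral>\<^sup>+(u, v). ennreal (p * (v - u)) \<partial>count_space C)"
    proof (rule nn_integral_mono)
      fix i assume "i \<in> space (count_space C)"
      then show "(case i of (u, v) \<Rightarrow> emeasure \<nu> {u..v}) \<le> (case i of (u, v) \<Rightarrow> ennreal (p * (v - u)))"
        using C(2)[of "fst i" "snd i"] by (cases i) (simp add: \<nu> ennreal_leI)
    qed
    also have "\<dots> = ennreal p * emeasure lborel ?U"
      using scaled[OF C(1,3), of p] C(2) assms(3) by simp
    also have "\<dots> \<le> ennreal p * emeasure lborel W"
    proof (intro mult_left_mono emeasure_mono)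
      show "?U \<subseteq> W"
        using C(2) by auto
    qed (use \<open>open W\<close> in auto)
    finally show "ennreal q * emeasure lborel ?T \<le> ennreal p * emeasure lborel W" .
  qed
qed

lemma negligible_oscillating_slopes:
  fixes g :: "real \<Rightarrow> real"
  assumes "mono g" and "continuous_on UNIV g" and "0 < p" "p < q"
  shows "negligible (oscillating_slopes g p q)"
proof -
  have "negligible (oscillating_slopes g p q \<inter> {a<..<b})" for a b
  proof -
    define S where "S = oscillating_slopes g p q \<inter> {a<..<b}"
    \<comment> \<open>The outer measure \<open>m\<close> of \<open>S\<close> is finite and satisfies \<open>q m \<le> p m\<close>, so it vanishes.\<close>
    define m where "m = (INF W\<in>{W \<in> sets lebesgue. S \<subseteq> W}. emeasure lebesgue W)"
    have "m \<le> emeasure lebesgue {a<..<b}"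
      unfolding m_def by (rule INF_lower) (auto simp: S_def)
    also have "\<dots> < \<infinity>"
      by (cases "a \<le> b") auto
    finally have m_fin: "m < \<infinity>" .
    have m_le: "ennreal q * m \<le> ennreal p * (m + ennreal e)" if e: "e > 0" for e
    proof -
      have "\<exists>W\<in>{W \<in> sets lebesgue. S \<subseteq> W}. emeasure lebesgue W < m + ennreal (e / 2)"
      proof -
        have "m < m + ennreal (e / 2)"
          using m_fin e ennreal_add_left_cancel_less[of m 0 "ennreal (e/2)"] by auto
        then show ?thesis
          unfolding m_def INF_less_iff by blast
      qed
      then obtain W where W: "W \<in> sets lebesgue" "S \<subseteq> W" "emeasure lebesgue W < m + ennreal (e / 2)"
        by auto
      obtain W' where W': "open W'" "W \<subseteq> W'" "W' - W \<in> lmeasurable" "emeasure lebesgue (W' - W) < ennreal (e / 2)"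
        by (rule sets_lebesgue_outer_open[OF W(1), of "e/2"]) (use e in auto)
      have "emeasure lborel W' = emeasure lebesgue W'"
        using W'(1) by simp
      also have "\<dots> = emeasure lebesgue (W \<union> (W' - W))"
        using W' by (metis Diff_partition)
      also have "\<dots> \<le> emeasure lebesgue W + emeasure lebesgue (W' - W)"
        using W W' by (intro emeasure_subadditive) auto
      also have "\<dots> \<le> (m + ennreal (e / 2)) + ennreal (e / 2)"
        using W W' by (intro add_mono) auto
      also have "\<dots> = m + ennreal e"
        using e by (simp add: add.assoc flip: ennreal_plus)
      finally have W'_le: "emeasure lborel W' \<le> m + ennreal e" .
      obtain T where T: "T \<in> sets borel" "negligible (S - T)"
          "ennreal q * emeasure lborel T \<le> ennreal p * emeasure lborel W'"
        using oscillating_slopes_contraction[OF assms W'(1), of S] W W' by (auto simp: S_def)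
      have "T \<union> (S - T) \<in> sets lebesgue"
        by (intro sets.Un) (use T negligible_imp_sets in auto)
      then have "m \<le> emeasure lebesgue (T \<union> (S - T))"
        unfolding m_def by (intro INF_lower) auto
      also have "\<dots> \<le> emeasure lebesgue T + emeasure lebesgue (S - T)"
        using T negligible_imp_sets by (intro emeasure_subadditive) auto
      also have "\<dots> = emeasure lborel T"
        using T negligible_iff_emeasure0[OF negligible_imp_sets[OF T(2)]] by simp
      finally have "m \<le> emeasure lborel T" .
      then have "ennreal q * m \<le> ennreal q * emeasure lborel T"
        by (intro mult_left_mono) auto
      also note T(3)
      also have "ennreal p * emeasure lborel W' \<le> ennreal p * (m + ennreal e)"
        by (intro mult_left_mono W'_le) auto
      finally show ?thesis .
    qed
    obtain r where r: "m = ennreal r" "r \<ge> 0"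
      using m_fin by (cases m) auto
    have "q * r \<le> p * r + e" if "e > 0" for e
    proof -
      have "ennreal (q * r) \<le> ennreal (p * (r + e / p))"
        using m_le[of "e / p"] r that assms(3,4) by (simp add: ennreal_mult ennreal_plus)
      moreover have "0 \<le> p * (r + e / p)"
        using that r assms(3) by simp
      ultimately have "q * r \<le> p * (r + e / p)"
        by (simp only: ennreal_le_iff)
      then show ?thesis
        using assms(3) by (simp add: algebra_simps)
    qed
    then have "q * r \<le> p * r"
      by (rule field_le_epsilon)
    then have "r = 0"
      using assms(4) r(2) by (metis mult_less_cancel_right_pos not_le order_le_less)
    then have "m = 0" using r by simp
    have "negligible S"
      unfolding negligible_outer
    proof (intro allI impI)
      fix e :: real assume "e > 0"
      then have "m < ennreal e" by (simp add: \<open>m = 0\<close>)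
      then obtain W where W: "W \<in> sets lebesgue" "S \<subseteq> W" "emeasure lebesgue W < ennreal e"
        unfolding m_def INF_less_iff by auto
      then have "W \<in> lmeasurable"
        by (intro fmeasurableI) (auto intro: less_trans)
      moreover have "measure lebesgue W < e"
        using W(3) \<open>W \<in> lmeasurable\<close> \<open>e > 0\<close> by (simp add: emeasure_eq_measure2 ennreal_less_iff)
      ultimately show "\<exists>T. S \<subseteq> T \<and> T \<in> lmeasurable \<and> measure lebesgue T < e"
        using W by auto
    qed
    then show ?thesis by (simp add: S_def)
  qed
  then have "negligible (\<Union>n::nat. oscillating_slopes g p q \<inter> {- real n<..<real n})"
    by (intro negligible_countable_Union) auto
  moreover have "oscillating_slopes g p q \<subseteq> (\<Union>n::nat. oscillating_slopes g p q \<inter> {- real n<..<real n})"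
  proof
    fix x assume "x \<in> oscillating_slopes g p q"
    moreover obtain n :: nat where "\<bar>x\<bar> < real n"
      using reals_Archimedean2 by blast
    ultimately show "x \<in> (\<Union>n::nat. oscillating_slopes g p q \<inter> {- real n<..<real n})"
      by (intro UN_I[of n]) auto
  qed
  ultimately show ?thesis
    by (rule negligible_subset)
qed

lemma lipschitz_real_differentiable_AE:
  fixes f :: "real \<Rightarrow> real"
  assumes f: "L-lipschitz_on UNIV f"
  shows "negligible {x. \<not> f differentiable (at x)}"
proof -
  \<comment> \<open>Adding a linear function makes all slopes at least \<open>1\<close>, in particular positive.\<close>
  define g where "g x = f x + (L + 1) * x" for x
  have L: "0 \<le> L"
    using f by (rule lipschitz_on_nonneg)
  have lip: "\<bar>f v - f u\<bar> \<le> L * (v - u)" if "u \<le> v" for u v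
    using lipschitz_onD[OF f, of v u] that by (simp add: dist_real_def)
  have slope_ge: "v - u \<le> g v - g u" if "u \<le> v" for u v
    using lip[OF that] by (simp add: g_def algebra_simps)
  have slope_le: "g v - g u \<le> (2 * L + 1) * (v - u)" if "u \<le> v" for u v
    using lip[OF that] by (simp add: g_def algebra_simps)
  have "mono g"
    using slope_ge by (force intro: monoI)
  have cont: "continuous_on UNIV g"
    unfolding g_def by (intro continuous_intros lipschitz_on_continuous_on[OF f])
  define N where "N = (\<Union>(p, q)\<in>{(p, q). p \<in> \<rat> \<and> q \<in> \<rat> \<and> 0 < p \<and> p < q}. oscillating_slopes g p q)"
  have "countable {(p, q). p \<in> \<rat> \<and> q \<in> \<rat> \<and> 0 < p \<and> (p::real) < q}"
    by (rule countable_subset[of _ "\<rat> \<times> \<rat>"]) (auto intro: countable_rat countable_SIGMA)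
  then have "negligible N"
    unfolding N_def
    by (intro negligible_countable_Union countable_image)
       (auto intro: negligible_oscillating_slopes[OF \<open>mono g\<close> cont])
  moreover have "f differentiable (at x)" if "x \<notin> N" for x
  proof -
    define s where "s h = (g (x + h) - g x) / h" for h
    have slope: "\<exists>u v. u \<le> x \<and> x \<le> v \<and> u < v \<and> v - u < d \<and> P ((g v - g u) / (v - u))"
      if freq: "\<exists>\<^sub>F h in at 0. P (s h)" and "d > 0" for P d
    proof -
      have "\<forall>\<^sub>F h in at 0. \<bar>h\<bar> < d \<and> h \<noteq> (0::real)"
        unfolding eventually_at using \<open>d > 0\<close> by (auto intro!: exI[of _ d])
      then obtain h where h: "P (s h)" "\<bar>h\<bar> < d" "h \<noteq> 0"
        using frequently_ex[OF frequently_eventually_conj[OF freq]] by blast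
      show ?thesis
      proof (cases "h > 0")
        case True
        then show ?thesis
          using h by (intro exI[of _ x] exI[of _ "x + h"]) (auto simp: s_def)
      next
        case False
        have "s h = (g x - g (x + h)) / (x - (x + h))"
          using h by (simp add: s_def field_simps)
        then show ?thesis
          using h False by (intro exI[of _ "x + h"] exI[of _ x]) auto
      qed
    qed
    have s_ge: "1 \<le> s h" if "h \<noteq> 0" for h
      using slope_ge[of x "x + h"] slope_ge[of "x + h" x] that
      by (cases "h > 0") (auto simp: s_def field_simps)
    have s_le: "s h \<le> 2 * L + 1" if "h \<noteq> 0" for h
      using slope_le[of x "x + h"] slope_le[of "x + h" x] that
      by (cases "h > 0") (auto simp: s_def field_simps)
    have nonzero: "\<forall>\<^sub>F h in at 0. h \<noteq> (0::real)"
      by (simp add: eventually_at_filter)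
    \<comment> \<open>The infimum \<open>c\<close> of \<open>A\<close> is the lower limit of the difference quotients. It is their limit,
        as otherwise rational \<open>p < q\<close> above \<open>c\<close> would separate small from large slopes at \<open>x\<close>.\<close>
    define A where "A = {t. \<exists>\<^sub>F h in at 0. s h < t}"
    have "2 * L + 2 \<in> A"
    proof -
      have "\<forall>\<^sub>F h in at 0. s h < 2 * L + 2"
        using nonzero by eventually_elim (use s_le in force)
      then show ?thesis
        unfolding A_def by (auto intro: eventually_frequently)
    qed
    then have "A \<noteq> {}" by auto
    have A_ge: "1 \<le> t" if "t \<in> A" for t
    proof -
      have "\<exists>\<^sub>F h in at 0. h \<noteq> 0 \<and> s h < t"
        using frequently_eventually_conj[OF _ nonzero] that unfolding A_def by blast
      then obtain h where "s h < t" "h \<noteq> 0"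
        using frequently_ex by blast
      then show ?thesis
        using s_ge[of h] by simp
    qed
    then have bdd: "bdd_below A"
      by (auto simp: bdd_below_def)
    define c where "c = Inf A"
    have "1 \<le> c"
      unfolding c_def using \<open>A \<noteq> {}\<close> A_ge by (rule cInf_greatest)
    have "(s \<longlongrightarrow> c) (at 0)"
    proof (rule order_tendstoI)
      fix a assume "a < c"
      then obtain a' where a': "a < a'" "a' < c"
        using dense by blast
      have "a' \<notin> A"
        using a'(2) bdd cInf_lower unfolding c_def by fastforce
      then have "\<forall>\<^sub>F h in at 0. \<not> s h < a'"
        by (simp add: A_def not_frequently)
      then show "\<forall>\<^sub>F h in at 0. a < s h"
        by eventually_elim (use a' in auto)
    next
      fix a assume "c < a"
      show "\<forall>\<^sub>F h in at 0. s h < a"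
      proof (rule ccontr)
        assume "\<not> ?thesis"
        then have freq: "\<exists>\<^sub>F h in at 0. a \<le> s h"
          by (simp add: frequently_def not_le)
        obtain q where q: "q \<in> \<rat>" "c < q" "q < a"
          using Rats_dense_in_real[OF \<open>c < a\<close>] by auto
        obtain p where p: "p \<in> \<rat>" "c < p" "p < q"
          using Rats_dense_in_real[OF \<open>c < q\<close>] by auto
        obtain t where t: "t \<in> A" "t < p"
          using p(2) \<open>A \<noteq> {}\<close> bdd unfolding c_def by (metis cInf_less_iff)
        have freq': "\<exists>\<^sub>F h in at 0. s h < p"
          using t unfolding A_def by (auto elim!: frequently_elim1)
        have "x \<in> oscillating_slopes g p q"
          unfolding oscillating_slopes_def
        proof (clarify, intro conjI)
          fix d :: real assume "d > 0"
          obtain u v where "u \<le> x" "x \<le> v" "u < v" "v - u < d" "(g v - g u) / (v - u) < p"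
            using slope[OF freq' \<open>d > 0\<close>] by auto
          then show "\<exists>u v. u \<le> x \<and> x \<le> v \<and> u < v \<and> v - u < d \<and> g v - g u < p * (v - u)"
            by (intro exI[of _ u] exI[of _ v]) (auto simp: field_simps)
          obtain u v where "u \<le> x" "x \<le> v" "u < v" "v - u < d" "a \<le> (g v - g u) / (v - u)"
            using slope[OF freq \<open>d > 0\<close>] by auto
          moreover from this have "a * (v - u) \<le> g v - g u"
            by (simp add: pos_le_divide_eq)
          moreover have "q * (v - u) < a * (v - u)"
            using q \<open>u < v\<close> by (intro mult_strict_right_mono) auto
          ultimately have "q * (v - u) < g v - g u"
            by (metis order_less_le_trans)
          with \<open>u \<le> x\<close> \<open>x \<le> v\<close> \<open>u < v\<close> \<open>v - u < d\<close>
          show "\<exists>u v. u \<le> x \<and> x \<le> v \<and> u < v \<and> v - u < d \<and> q * (v - u) < g v - g u"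
            by blast
        qed
        then have "x \<in> N"
          using p q \<open>1 \<le> c\<close> unfolding N_def by (intro UN_I[of "(p, q)"]) auto
        then show False
          using \<open>x \<notin> N\<close> by simp
      qed
    qed
    then have "(g has_field_derivative c) (at x)"
      unfolding DERIV_def s_def .
    then have "((\<lambda>x. g x - (L + 1) * x) has_field_derivative (c - (L + 1))) (at x)"
      by (auto intro!: derivative_eq_intros)
    then have "(f has_field_derivative (c - (L + 1))) (at x)"
      by (simp add: g_def)
    then show ?thesis
      using field_differentiable_imp_differentiable field_differentiable_def by blast
  qed
  then have "{x. \<not> f differentiable (at x)} \<subseteq> N"
    by blast
  ultimately show ?thesis
    by (rule negligible_subset)
qed

lemma lipschitz_differentiable_AE:
  fixes f :: "real \<Rightarrow> 'a::euclidean_space"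
  assumes f: "L-lipschitz_on UNIV f"
  shows "negligible {x. \<not> f differentiable (at x)}"
proof -
  have "negligible {x. \<not> (\<lambda>x. f x \<bullet> i) differentiable (at x)}" if "i \<in> Basis" for i
  proof (rule lipschitz_real_differentiable_AE)
    show "L-lipschitz_on UNIV (\<lambda>x. f x \<bullet> i)"
    proof (rule lipschitz_onI)
      fix x y
      have "dist (f x \<bullet> i) (f y \<bullet> i) \<le> dist (f x) (f y)"
        using Basis_le_norm[OF that, of "f x - f y"] by (simp add: dist_norm inner_diff_left)
      then show "dist (f x \<bullet> i) (f y \<bullet> i) \<le> L * dist x y"
        using lipschitz_onD[OF f, of x y] by simp
    qed (rule lipschitz_on_nonneg[OF f])
  qed
  then have "negligible (\<Union>i\<in>Basis. {x. \<not> (\<lambda>x. f x \<bullet> i) differentiable (at x)})"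
    by (intro negligible_Union) auto
  moreover have "{x. \<not> f differentiable (at x)} \<subseteq> (\<Union>i\<in>Basis. {x. \<not> (\<lambda>x. f x \<bullet> i) differentiable (at x)})"
    using differentiable_componentwise_within[of f _ UNIV] by auto
  ultimately show ?thesis
    by (rule negligible_subset)
qed

lemma has_vector_derivative_straddle:
  fixes f :: "real \<Rightarrow> 'a::real_normed_vector"
  assumes f: "(f has_vector_derivative y) (at x)"
    and uv: "\<forall>\<^sub>F n in F. u n \<le> x \<and> x \<le> v n \<and> u n < v n" and lim: "((\<lambda>n. v n - u n) \<longlongrightarrow> 0) F"
  shows "((\<lambda>n. (f (v n) - f (u n)) /\<^sub>R (v n - u n)) \<longlongrightarrow> y) F"
proof (rule tendstoI)
  fix e :: real assume "e > 0"
  then have "e / 2 > 0" by simp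
  then have "\<exists>d>0. \<forall>z. norm (z - x) < d \<longrightarrow> norm (f z - f x - (z - x) *\<^sub>R y) \<le> e / 2 * norm (z - x)"
    using f unfolding has_vector_derivative_def has_derivative_at_alt by blast
  then obtain d where d: "d > 0"
      "\<And>z. \<bar>z - x\<bar> < d \<Longrightarrow> norm (f z - f x - (z - x) *\<^sub>R y) \<le> e / 2 * \<bar>z - x\<bar>"
    by auto
  have "\<forall>\<^sub>F n in F. v n - u n < d"
    using lim d(1) by (rule order_tendstoD)
  with uv show "\<forall>\<^sub>F n in F. dist ((f (v n) - f (u n)) /\<^sub>R (v n - u n)) y < e"
  proof eventually_elim
    case (elim n)
    define w where "w = v n - u n"
    have w: "w > 0" using elim by (simp add: w_def)
    have "norm (f (v n) - f (u n) - w *\<^sub>R y) =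
        norm ((f (v n) - f x - (v n - x) *\<^sub>R y) - (f (u n) - f x - (u n - x) *\<^sub>R y))"
      by (simp add: w_def algebra_simps)
    also have "\<dots> \<le> norm (f (v n) - f x - (v n - x) *\<^sub>R y) + norm (f (u n) - f x - (u n - x) *\<^sub>R y)"
      by (rule norm_triangle_ineq4)
    also have "\<dots> \<le> e / 2 * \<bar>v n - x\<bar> + e / 2 * \<bar>u n - x\<bar>"
      using elim by (intro add_mono d(2)) auto
    also have "\<dots> = e / 2 * w"
      using elim by (simp add: w_def field_simps)
    finally have *: "norm (f (v n) - f (u n) - w *\<^sub>R y) \<le> e / 2 * w" .
    have "dist ((f (v n) - f (u n)) /\<^sub>R w) y = norm (inverse w *\<^sub>R (f (v n) - f (u n) - w *\<^sub>R y))"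
      using w by (simp add: dist_norm scaleR_diff_right)
    also have "\<dots> = norm (f (v n) - f (u n) - w *\<^sub>R y) / w"
      using w by (simp add: divide_inverse mult.commute)
    also have "\<dots> \<le> e / 2"
      using * w by (simp add: divide_le_eq)
    finally show ?case
      using \<open>e > 0\<close> by (simp add: w_def)
  qed
qed

section \<open>Representatives and reparameterizations of curves\<close>

lemma time_change_scale: "0 < T \<Longrightarrow> time_change T (\<lambda>s. T * s)"
proof -
  assume "0 < T"
  have "(\<lambda>s. T * s) ` {0..1} = {0..T}"
    using \<open>0 < T\<close> image_mult_atLeastAtMost[of T 0 1] by simp
  then show ?thesis
    using \<open>0 < T\<close> by (auto simp: time_change_def mono_on_def intro!: continuous_intros)
qed

lemma time_change_endpoints:
  assumes "time_change T \<alpha>" "0 < T"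
  shows "\<alpha> 0 = 0" "\<alpha> 1 = T"
proof -
  have im: "\<alpha> ` {0..1} = {0..T}" and mono: "mono_on {0..1} \<alpha>"
    using assms(1) by (auto simp: time_change_def)
  have in': "\<alpha> 0 \<in> {0..T}" "\<alpha> 1 \<in> {0..T}"
    unfolding im[symmetric] by auto
  obtain s s' where s: "s \<in> {0..1}" "\<alpha> s = 0" "s' \<in> {0..1}" "\<alpha> s' = T"
  proof -
    have "0 \<in> \<alpha> ` {0..1}" "T \<in> \<alpha> ` {0..1}"
      unfolding im using assms(2) by auto
    then show thesis
      using that by (metis imageE)
  qed
  have "\<alpha> 0 \<le> \<alpha> s" "\<alpha> s' \<le> \<alpha> 1"
    using s mono_onD[OF mono, of 0 s] mono_onD[OF mono, of s' 1] by auto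
  then show "\<alpha> 0 = 0" "\<alpha> 1 = T"
    using s in' by auto
qed

lemma time_change_comp:
  assumes "time_change T \<alpha>" "time_change 1 \<beta>"
  shows "time_change T (\<alpha> \<circ> \<beta>)"
proof -
  have \<beta>: "\<beta> ` {0..1} = {0..1}" "continuous_on {0..1} \<beta>" "mono_on {0..1} \<beta>"
    and \<alpha>: "\<alpha> ` {0..1} = {0..T}" "continuous_on {0..1} \<alpha>" "mono_on {0..1} \<alpha>"
    using assms by (auto simp: time_change_def)
  have "(\<alpha> \<circ> \<beta>) ` {0..1} = {0..T}"
    using \<alpha>(1) \<beta>(1) by (metis image_comp)
  moreover have "continuous_on {0..1} (\<alpha> \<circ> \<beta>)"
    using \<alpha>(2) \<beta> by (intro continuous_on_compose) auto
  moreover have "mono_on {0..1} (\<alpha> \<circ> \<beta>)"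
  proof (rule mono_onI)
    fix r s :: real assume "r \<in> {0..1}" "s \<in> {0..1}" "r \<le> s"
    moreover from this have "\<beta> r \<in> {0..1}" "\<beta> s \<in> {0..1}"
      using \<beta>(1) by blast+
    ultimately show "(\<alpha> \<circ> \<beta>) r \<le> (\<alpha> \<circ> \<beta>) s"
      using mono_onD[OF \<alpha>(3)] mono_onD[OF \<beta>(3)] by simp
  qed
  ultimately show ?thesis
    by (simp add: time_change_def)
qed

lemma frechet_bdd_above:
  assumes "(T, \<phi>) \<in> parameterizations D" "(U, \<theta>) \<in> parameterizations D"
    and "time_change T \<alpha>" "time_change U \<beta>"
  shows "bdd_above ((\<lambda>s. dist (\<phi> (\<alpha> s)) (\<theta> (\<beta> s))) ` {0..1})"
proof -
  have "continuous_on {0..1} (\<lambda>s. \<phi> (\<alpha> s))"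
    using assms(1,3) unfolding parameterizations_def time_change_def
    by (rule_tac continuous_on_compose2[of "{0..T}" \<phi>]) auto
  moreover have "continuous_on {0..1} (\<lambda>s. \<theta> (\<beta> s))"
    using assms(2,4) unfolding parameterizations_def time_change_def
    by (rule_tac continuous_on_compose2[of "{0..U}" \<theta>]) auto
  ultimately
  have "compact ((\<lambda>s. dist (\<phi> (\<alpha> s)) (\<theta> (\<beta> s))) ` {0..1})"
    by (intro compact_continuous_image continuous_intros) auto
  then show ?thesis
    by (intro bounded_imp_bdd_above compact_imp_bounded)
qed

lemma frechet_dist_eq_0I:
  assumes "(T, \<phi>) \<in> parameterizations D" "(U, \<theta>) \<in> parameterizations D"
    and "time_change T \<alpha>" "time_change U \<beta>"
    and eq: "\<And>s. s \<in> {0..1} \<Longrightarrow> \<phi> (\<alpha> s) = \<theta> (\<beta> s)"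
  shows "frechet_dist T \<phi> U \<theta> = 0"
  unfolding frechet_dist_def
proof (rule cInf_eq_minimum)
  have "(SUP s\<in>{0..1}. dist (\<phi> (\<alpha> s)) (\<theta> (\<beta> s))) = (SUP s\<in>{0..1::real}. 0::real)"
    using eq by (intro SUP_cong) auto
  then have "(SUP s\<in>{0..1}. dist (\<phi> (\<alpha> s)) (\<theta> (\<beta> s))) = 0"
    by simp
  then show "0 \<in> {(SUP s\<in>{0..1}. dist (\<phi> (\<alpha> s)) (\<theta> (\<beta> s))) | \<alpha> \<beta>. time_change T \<alpha> \<and> time_change U \<beta>}"
    using assms(3,4) by force
next
  fix d assume "d \<in> {(SUP s\<in>{0..1}. dist (\<phi> (\<alpha> s)) (\<theta> (\<beta> s))) | \<alpha> \<beta>. time_change T \<alpha> \<and> time_change U \<beta>}"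
  then obtain \<alpha> \<beta> where d: "d = (SUP s\<in>{0..1}. dist (\<phi> (\<alpha> s)) (\<theta> (\<beta> s)))"
    and ab: "time_change T \<alpha>" "time_change U \<beta>" by auto
  have "dist (\<phi> (\<alpha> 0)) (\<theta> (\<beta> 0)) \<le> d"
    unfolding d by (rule cSUP_upper[OF _ frechet_bdd_above[OF assms(1,2) ab]]) auto
  then show "0 \<le> d"
    by (meson order_trans zero_le_dist)
qed

lemma same_curveD:
  assumes "((T, \<phi>), (U, \<theta>)) \<in> same_curve D" "\<epsilon> > 0"
  obtains \<alpha> \<beta> where "time_change T \<alpha>" "time_change U \<beta>"
    "\<And>s. s \<in> {0..1} \<Longrightarrow> dist (\<phi> (\<alpha> s)) (\<theta> (\<beta> s)) < \<epsilon>"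
proof -
  have p: "(T, \<phi>) \<in> parameterizations D" "(U, \<theta>) \<in> parameterizations D"
    and 0: "frechet_dist T \<phi> U \<theta> = 0"
    using assms(1) by (auto simp: same_curve_def)
  let ?X = "{(SUP s\<in>{0..1}. dist (\<phi> (\<alpha> s)) (\<theta> (\<beta> s))) | \<alpha> \<beta>. time_change T \<alpha> \<and> time_change U \<beta>}"
  have "0 < T" "0 < U"
    using p by (auto simp: parameterizations_def)
  then have "?X \<noteq> {}"
    using time_change_scale[of T] time_change_scale[of U] by auto
  moreover have "Inf ?X < \<epsilon>"
    using 0 assms(2) unfolding frechet_dist_def by simp
  ultimately obtain d where "d \<in> ?X" "d < \<epsilon>"
    by (metis (no_types, lifting) cInf_lessD)
  then obtain \<alpha> \<beta> where d: "(SUP s\<in>{0..1}. dist (\<phi> (\<alpha> s)) (\<theta> (\<beta> s))) < \<epsilon>"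
    and ab: "time_change T \<alpha>" "time_change U \<beta>" by blast
  show thesis
  proof (rule that[OF ab])
    fix s :: real assume "s \<in> {0..1}"
    then have "dist (\<phi> (\<alpha> s)) (\<theta> (\<beta> s)) \<le> (SUP s\<in>{0..1}. dist (\<phi> (\<alpha> s)) (\<theta> (\<beta> s)))"
      by (intro cSUP_upper frechet_bdd_above[OF p ab])
    then show "dist (\<phi> (\<alpha> s)) (\<theta> (\<beta> s)) < \<epsilon>"
      using d by simp
  qed
qed

lemma reparameterization_in_curve:
  assumes "(T, \<phi>) \<in> parameterizations D" "time_change T \<tau>"
  shows "(1, \<phi> \<circ> \<tau>) \<in> same_curve D `` {(T, \<phi>)}"
proof -
  have "continuous_on {0..T} \<phi>" "\<phi> ` {0..T} \<subseteq> D" "continuous_on {0..1} \<tau>" "\<tau> ` {0..1} = {0..T}"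
    using assms by (auto simp: parameterizations_def time_change_def)
  then have "(1, \<phi> \<circ> \<tau>) \<in> parameterizations D"
    using continuous_on_compose[of "{0..1}" \<tau> \<phi>] by (auto simp: parameterizations_def)
  moreover from this have "frechet_dist T \<phi> 1 (\<phi> \<circ> \<tau>) = 0"
    using assms time_change_scale[of 1]
    by (intro frechet_dist_eq_0I[of _ _ D _ _ \<tau> "\<lambda>s. s"]) auto
  ultimately show ?thesis
    using assms by (auto simp: same_curve_def)
qed

lemma same_curve_refl:
  assumes "(T, \<phi>) \<in> parameterizations D"
  shows "((T, \<phi>), (T, \<phi>)) \<in> same_curve D"
proof -
  have "0 < T"
    using assms by (simp add: parameterizations_def)
  then have "frechet_dist T \<phi> T \<phi> = 0"
    using assms by (intro frechet_dist_eq_0I[OF assms assms]) (auto intro: time_change_scale)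
  then show ?thesis
    using assms by (auto simp: same_curve_def)
qed

text \<open>A function that is Lipschitz on the unit interval represents a rectifiable curve. Image,
  endpoints and length have to be controlled for all representatives \<open>\<theta>\<close>. By definition, these
  only come arbitrarily close to \<open>\<phi>\<close> after reparameterization of both; no exact
  reparameterization is given.\<close>

lemma lipschitz_curve:
  fixes \<phi> :: "real \<Rightarrow> 'a::metric_space"
  assumes lip: "L-lipschitz_on {0..1} \<phi>" and E: "\<phi> ` {0..1} \<subseteq> E" "E \<subseteq> D"
  obtains \<gamma> where "\<gamma> \<in> curves_between D E (\<phi> 0) (\<phi> 1)" "(1, \<phi>) \<in> \<gamma>"
    "curve_image \<gamma> \<subseteq> \<phi> ` {0..1}" "curve_length \<gamma> \<le> ennreal L"
proof -
  define \<gamma> where "\<gamma> = same_curve D `` {(1, \<phi>)}"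
  have L: "0 \<le> L"
    using lip by (rule lipschitz_on_nonneg)
  have cont: "continuous_on {0..1} \<phi>"
    using lip by (rule lipschitz_on_continuous_on)
  have par: "(1, \<phi>) \<in> parameterizations D"
    using cont E by (auto simp: parameterizations_def)
  have "\<gamma> \<in> curves D"
    unfolding \<gamma>_def curves_def using par by (rule quotientI)
  have approx: "\<exists>\<alpha> \<beta>. time_change 1 \<alpha> \<and> time_change U \<beta> \<and> (\<forall>s\<in>{0..1}. dist (\<phi> (\<alpha> s)) (\<theta> (\<beta> s)) < \<epsilon>)"
    if "(U, \<theta>) \<in> \<gamma>" "\<epsilon> > 0" for U \<theta> \<epsilon>
  proof -
    have "((1, \<phi>), (U, \<theta>)) \<in> same_curve D"
      using that(1) by (simp add: \<gamma>_def)
    from same_curveD[OF this that(2)] show ?thesis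
      by metis
  qed
  have U: "0 < U" if "(U, \<theta>) \<in> \<gamma>" for U \<theta>
    using that by (auto simp: \<gamma>_def same_curve_def parameterizations_def)
  have image: "\<theta> u \<in> \<phi> ` {0..1}" if \<theta>: "(U, \<theta>) \<in> \<gamma>" and u: "u \<in> {0..U}" for U \<theta> u
  proof -
    have "\<exists>y\<in>\<phi> ` {0..1}. dist y (\<theta> u) < \<epsilon>" if "\<epsilon> > 0" for \<epsilon>
    proof -
      obtain \<alpha> \<beta> where ab: "time_change 1 \<alpha>" "time_change U \<beta>"
        "\<And>s. s \<in> {0..1} \<Longrightarrow> dist (\<phi> (\<alpha> s)) (\<theta> (\<beta> s)) < \<epsilon>"
        using approx[OF \<theta> \<open>\<epsilon> > 0\<close>] by blast
      then obtain s where "s \<in> {0..1}" "\<beta> s = u"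
        using u unfolding time_change_def by (metis imageE)
      moreover have "\<alpha> s \<in> {0..1}"
        using ab(1) \<open>s \<in> {0..1}\<close> unfolding time_change_def by blast
      ultimately show ?thesis
        using ab(3) by blast
    qed
    then have "\<theta> u \<in> closure (\<phi> ` {0..1})"
      unfolding closure_approachable by blast
    moreover have "closed (\<phi> ` {0..1})"
      using cont by (intro compact_imp_closed compact_continuous_image) auto
    ultimately show ?thesis
      by simp
  qed
  have start: "\<theta> 0 = \<phi> 0" and "end": "\<theta> U = \<phi> 1" if \<theta>: "(U, \<theta>) \<in> \<gamma>" for U \<theta>
  proof -
    have *: "dist (\<phi> 0) (\<theta> 0) \<le> \<epsilon> \<and> dist (\<phi> 1) (\<theta> U) \<le> \<epsilon>" if "\<epsilon> > 0" for \<epsilon>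
    proof -
      obtain \<alpha> \<beta> where ab: "time_change 1 \<alpha>" "time_change U \<beta>"
        "\<And>s. s \<in> {0..1} \<Longrightarrow> dist (\<phi> (\<alpha> s)) (\<theta> (\<beta> s)) < \<epsilon>"
        using approx[OF \<theta> \<open>\<epsilon> > 0\<close>] by blast
      then show ?thesis
        using time_change_endpoints[OF ab(1)] time_change_endpoints[OF ab(2) U[OF \<theta>]]
          ab(3)[of 0] ab(3)[of 1] by simp
    qed
    have "dist (\<phi> 0) (\<theta> 0) \<le> 0" "dist (\<phi> 1) (\<theta> U) \<le> 0"
      using field_le_epsilon[of "dist (\<phi> 0) (\<theta> 0)" 0] field_le_epsilon[of "dist (\<phi> 1) (\<theta> U)" 0] *
      by auto
    then show "\<theta> 0 = \<phi> 0" "\<theta> U = \<phi> 1" by auto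
  qed
  have "path_length U \<theta> \<le> ennreal L" if \<theta>: "(U, \<theta>) \<in> \<gamma>" for U \<theta>
    unfolding path_length_def
  proof (rule SUP_least, clarify)
    fix N :: nat and t :: "nat \<Rightarrow> real" assume t: "mono_on {..N} t" "t ` {..N} \<subseteq> {0..U}"
    have "(\<Sum>i<N. dist (\<theta> (t i)) (\<theta> (t (Suc i)))) \<le> L + \<epsilon>" if "\<epsilon> > 0" for \<epsilon>
    proof -
      define \<delta> where "\<delta> = \<epsilon> / (2 * (real N + 1))"
      have "\<delta> > 0" using \<open>\<epsilon> > 0\<close> by (simp add: \<delta>_def)
      obtain \<alpha> \<beta> where ab: "time_change 1 \<alpha>" "time_change U \<beta>"
        "\<And>s. s \<in> {0..1} \<Longrightarrow> dist (\<phi> (\<alpha> s)) (\<theta> (\<beta> s)) < \<delta>"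
        using approx[OF \<theta> \<open>\<delta> > 0\<close>] by blast
      have "\<forall>u\<in>{0..U}. \<exists>s\<in>{0..1}. \<beta> s = u"
        using ab(2) unfolding time_change_def by (metis imageE)
      \<comment> \<open>Parameters mapped to the partition points; they are automatically in the right order.\<close>
      then obtain g where g: "\<And>u. u \<in> {0..U} \<Longrightarrow> g u \<in> {0..1} \<and> \<beta> (g u) = u"
        by metis
      have mono_g: "g u \<le> g v" if "u \<in> {0..U}" "v \<in> {0..U}" "u \<le> v" for u v
      proof (rule ccontr)
        assume "\<not> g u \<le> g v"
        then have "\<beta> (g v) \<le> \<beta> (g u)"
          using ab(2) g that unfolding time_change_def by (meson mono_onD linear)
        then have "u = v" using g that by simp
        then show False using \<open>\<not> g u \<le> g v\<close> by simp
      qed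
      have t_in: "t i \<in> {0..U}" if "i \<le> N" for i
        using t(2) that by auto
      have \<alpha>_in: "\<alpha> (g (t i)) \<in> {0..1}" if "i \<le> N" for i
        using ab(1) g[OF t_in[OF that]] unfolding time_change_def by blast
      have "(\<Sum>i<N. dist (\<theta> (t i)) (\<theta> (t (Suc i)))) \<le>
          (\<Sum>i<N. L * (\<alpha> (g (t (Suc i))) - \<alpha> (g (t i))) + 2 * \<delta>)"
      proof (rule sum_mono)
        fix i assume "i \<in> {..<N}"
        then have i: "i \<le> N" "Suc i \<le> N" by auto
        have "t i \<le> t (Suc i)"
          using i by (intro mono_onD[OF t(1)]) auto
        then have "g (t i) \<le> g (t (Suc i))"
          using i by (intro mono_g t_in)
        then have le: "\<alpha> (g (t i)) \<le> \<alpha> (g (t (Suc i)))"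
          using ab(1) g[OF t_in[OF i(1)]] g[OF t_in[OF i(2)]] unfolding time_change_def
          by (auto intro: mono_onD)
        have near: "dist (\<phi> (\<alpha> (g (t j)))) (\<theta> (t j)) < \<delta>" if "j \<le> N" for j
          using ab(3)[of "g (t j)"] g[OF t_in[OF that]] by simp
        have "dist (\<theta> (t i)) (\<theta> (t (Suc i))) \<le>
            dist (\<phi> (\<alpha> (g (t i)))) (\<phi> (\<alpha> (g (t (Suc i))))) + 2 * \<delta>"
          using near[OF i(1)] near[OF i(2)]
            dist_triangle2[of "\<theta> (t i)" "\<theta> (t (Suc i))" "\<phi> (\<alpha> (g (t (Suc i))))"]
            dist_triangle3[of "\<theta> (t i)" "\<phi> (\<alpha> (g (t (Suc i))))" "\<phi> (\<alpha> (g (t i)))"]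
          by (simp add: dist_commute)
        also have "dist (\<phi> (\<alpha> (g (t i)))) (\<phi> (\<alpha> (g (t (Suc i))))) \<le>
            L * dist (\<alpha> (g (t i))) (\<alpha> (g (t (Suc i))))"
          by (intro lipschitz_onD[OF lip] \<alpha>_in i)
        also have "dist (\<alpha> (g (t i))) (\<alpha> (g (t (Suc i)))) = \<alpha> (g (t (Suc i))) - \<alpha> (g (t i))"
          using le by (simp add: dist_real_def)
        finally show "dist (\<theta> (t i)) (\<theta> (t (Suc i))) \<le> L * (\<alpha> (g (t (Suc i))) - \<alpha> (g (t i))) + 2 * \<delta>"
          by simp
      qed
      also have "\<dots> = L * (\<alpha> (g (t N)) - \<alpha> (g (t 0))) + real N * (2 * \<delta>)"
        by (simp add: sum.distrib sum_distrib_left[symmetric] sum_lessThan_telescope[of "\<lambda>i. \<alpha> (g (t i))"])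
      also have "\<dots> \<le> L * 1 + \<epsilon>"
      proof (intro add_mono mult_left_mono L)
        show "\<alpha> (g (t N)) - \<alpha> (g (t 0)) \<le> 1"
          using \<alpha>_in[of N] \<alpha>_in[of 0] by auto
        show "real N * (2 * \<delta>) \<le> \<epsilon>"
          using \<open>\<epsilon> > 0\<close> by (simp add: \<delta>_def divide_le_eq)
      qed
      finally show ?thesis by simp
    qed
    then have "(\<Sum>i<N. dist (\<theta> (t i)) (\<theta> (t (Suc i)))) \<le> L"
      by (rule field_le_epsilon)
    then show "(\<Sum>i<N. ennreal (dist (\<theta> (t i)) (\<theta> (t (Suc i))))) \<le> ennreal L"
      by (simp add: ennreal_leI)
  qed
  then have len: "curve_length \<gamma> \<le> ennreal L"
    unfolding curve_length_def by (auto intro: SUP_least)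
  have img: "curve_image \<gamma> \<subseteq> \<phi> ` {0..1}"
    using image unfolding curve_image_def by auto
  show thesis
  proof (rule that)
    show "(1, \<phi>) \<in> \<gamma>"
      using same_curve_refl[OF par] by (simp add: \<gamma>_def)
    show "\<gamma> \<in> curves_between D E (\<phi> 0) (\<phi> 1)"
      using \<open>\<gamma> \<in> curves D\<close> len img E(1) start "end"
      by (auto simp: curves_between_def rectifiable_curves_def starts_at_def ends_at_def
          intro: order.strict_trans1)
  qed fact+
qed

lemma path_length_leI:
  assumes "\<And>N t. mono_on {..N} t \<Longrightarrow> t ` {..N} \<subseteq> {0..T} \<Longrightarrow>
    (\<Sum>i<N. dist (\<phi> (t i)) (\<phi> (t (Suc i)))) \<le> c"
  shows "path_length T \<phi> \<le> ennreal c"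
  unfolding path_length_def using assms by (intro SUP_least) (auto intro!: ennreal_leI)

lemma path_length_ge:
  assumes "mono_on {..N} t" "t ` {..N} \<subseteq> {0..T}"
  shows "ennreal (\<Sum>i<N. dist (\<phi> (t i)) (\<phi> (t (Suc i)))) \<le> path_length T \<phi>"
proof -
  have "(\<Sum>i<N. ennreal (dist (\<phi> (t i)) (\<phi> (t (Suc i))))) \<le> path_length T \<phi>"
    unfolding path_length_def using assms
    by (intro SUP_upper2[of "(N, t)"]) auto
  then show ?thesis by simp
qed

lemma path_length_add_dist:
  assumes "0 \<le> s" "s \<le> s'"
  shows "path_length s \<phi> + ennreal (dist (\<phi> s) (\<phi> s')) \<le> path_length s' \<phi>"
proof -
  have "(\<Sum>i<N. ennreal (dist (\<phi> (t i)) (\<phi> (t (Suc i))))) + ennreal (dist (\<phi> s) (\<phi> s'))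
      \<le> path_length s' \<phi>"
    if t: "mono_on {..N} t" "t ` {..N} \<subseteq> {0..s}" for N and t :: "nat \<Rightarrow> real"
  proof -
    define t' where "t' i = (if i \<le> N then t i else if i = Suc N then s else s')" for i
    have t_le: "0 \<le> t i" "t i \<le> s" if "i \<le> N" for i
      using t(2) that by auto
    have "mono_on {..Suc (Suc N)} t'"
    proof (rule mono_onI)
      fix i j :: nat assume "i \<le> j"
      then show "t' i \<le> t' j"
        using t_le[of i] assms mono_onD[OF t(1), of i j] by (auto simp: t'_def)
    qed
    moreover have "t' ` {..Suc (Suc N)} \<subseteq> {0..s'}"
      using t_le assms by (force simp: t'_def)
    ultimately have "ennreal (\<Sum>i<Suc (Suc N). dist (\<phi> (t' i)) (\<phi> (t' (Suc i)))) \<le> path_length s' \<phi>"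
      by (rule path_length_ge)
    moreover have "(\<Sum>i<N. dist (\<phi> (t i)) (\<phi> (t (Suc i)))) + dist (\<phi> s) (\<phi> s') \<le>
        (\<Sum>i<Suc (Suc N). dist (\<phi> (t' i)) (\<phi> (t' (Suc i))))"
    proof -
      have "(\<Sum>i<N. dist (\<phi> (t' i)) (\<phi> (t' (Suc i)))) = (\<Sum>i<N. dist (\<phi> (t i)) (\<phi> (t (Suc i))))"
        by (rule sum.cong) (auto simp: t'_def)
      then show ?thesis
        by (simp add: t'_def)
    qed
    ultimately have "ennreal ((\<Sum>i<N. dist (\<phi> (t i)) (\<phi> (t (Suc i)))) + dist (\<phi> s) (\<phi> s'))
        \<le> path_length s' \<phi>"
      by (meson ennreal_leI order_trans)
    then show ?thesis
      by (simp add: ennreal_plus sum_nonneg)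
  qed
  then have "(SUP (N, t)\<in>{(N, t). mono_on {..N} t \<and> t ` {..N} \<subseteq> {0..s}}.
      (\<Sum>i<N. ennreal (dist (\<phi> (t i)) (\<phi> (t (Suc i))))) + ennreal (dist (\<phi> s) (\<phi> s'))) \<le> path_length s' \<phi>"
    by (intro SUP_least) auto
  moreover have "(SUP (N, t)\<in>{(N, t). mono_on {..N} t \<and> t ` {..N} \<subseteq> {0..s}}.
      (\<Sum>i<N. ennreal (dist (\<phi> (t i)) (\<phi> (t (Suc i))))) + ennreal (dist (\<phi> s) (\<phi> s'))) =
      path_length s \<phi> + ennreal (dist (\<phi> s) (\<phi> s'))"
  proof -
    have "(0, \<lambda>_. 0) \<in> {(N :: nat, t :: nat \<Rightarrow> real). mono_on {..N} t \<and> t ` {..N} \<subseteq> {0..s}}"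
      using assms by (auto simp: mono_on_def)
    then have ne: "{(N :: nat, t :: nat \<Rightarrow> real). mono_on {..N} t \<and> t ` {..N} \<subseteq> {0..s}} \<noteq> {}"
      by (metis empty_iff)
    show ?thesis
      unfolding path_length_def case_prod_unfold
      using ne unfolding case_prod_unfold by (rule ennreal_SUP_add_left)
  qed
  ultimately show ?thesis by simp
qed

text \<open>A continuous function of finite length has a Lipschitz reparameterization. Adding a small
  multiple of the parameter to the length function makes it strictly increasing; its generalized
  inverse is then continuous even without continuity of the length function.\<close>

lemma lipschitz_reparameterization:
  fixes \<phi> :: "real \<Rightarrow> 'a::metric_space"
  assumes T: "0 < T" and cont: "continuous_on {0..T} \<phi>" and len: "path_length T \<phi> \<le> ennreal \<Lambda>"
    and "0 \<le> \<Lambda>" "0 < \<epsilon>"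
  obtains \<tau> where "time_change T \<tau>" "(\<Lambda> + \<epsilon>)-lipschitz_on {0..1} (\<phi> \<circ> \<tau>)"
proof -
  define V where "V s = enn2real (path_length s \<phi>)" for s
  have pl_mono: "path_length s \<phi> \<le> path_length s' \<phi>" if "0 \<le> s" "s \<le> s'" for s s'
    using order_trans[OF add_increasing2[OF zero_le order_refl] path_length_add_dist[OF that]] .
  have fin: "path_length s \<phi> = ennreal (V s)" if "0 \<le> s" "s \<le> T" for s
  proof -
    have "path_length s \<phi> < top"
      using pl_mono[OF that] len by (meson ennreal_less_top order.strict_trans1)
    then show ?thesis by (simp add: V_def)
  qed
  have V_nonneg: "0 \<le> V s" for s
    by (simp add: V_def)
  have V_dist: "V s + dist (\<phi> s) (\<phi> s') \<le> V s'" if "0 \<le> s" "s \<le> s'" "s' \<le> T" for s s'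
  proof -
    have "ennreal (V s + dist (\<phi> s) (\<phi> s')) \<le> ennreal (V s')"
      using path_length_add_dist[OF that(1,2), of \<phi>] fin[of s] fin[of s'] that V_nonneg
      by (simp add: ennreal_plus)
    then show ?thesis
      using V_nonneg[of s'] by (simp only: ennreal_le_iff)
  qed
  have V_mono: "V s \<le> V s'" if "0 \<le> s" "s \<le> s'" "s' \<le> T" for s s'
    using V_dist[OF that] zero_le_dist[of "\<phi> s" "\<phi> s'"] by linarith
  have "path_length 0 \<phi> \<le> ennreal 0"
  proof (rule path_length_leI)
    fix N :: nat and t :: "nat \<Rightarrow> real" assume "t ` {..N} \<subseteq> {0..0}"
    then have "t i = 0" if "i \<le> N" for i using that by auto
    then show "(\<Sum>i<N. dist (\<phi> (t i)) (\<phi> (t (Suc i)))) \<le> 0" by simp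
  qed
  then have "V 0 = 0" by (simp add: V_def)
  have "V T \<le> \<Lambda>"
    using len fin[of T] T \<open>0 \<le> \<Lambda>\<close> by simp
  define \<kappa> where "\<kappa> = \<epsilon> / T"
  have \<kappa>: "0 < \<kappa>" using T \<open>0 < \<epsilon>\<close> by (simp add: \<kappa>_def)
  define \<sigma> where "\<sigma> s = V s + \<kappa> * s" for s
  define R where "R = \<sigma> T"
  have R: "0 < R" "R \<le> \<Lambda> + \<epsilon>"
    using V_nonneg[of T] \<open>V T \<le> \<Lambda>\<close> T \<open>0 < \<epsilon>\<close> by (auto simp: R_def \<sigma>_def \<kappa>_def)
  have "\<sigma> 0 = 0" by (simp add: \<sigma>_def \<open>V 0 = 0\<close>)
  define A where "A u = {s\<in>{0..T}. \<sigma> s \<le> u}" for u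
  \<comment> \<open>The generalized inverse of \<open>\<sigma>\<close>: constant across the jumps of \<open>\<sigma>\<close>, hence continuous.\<close>
  define \<tau>' where "\<tau>' u = Sup (A u)" for u
  have A0: "0 \<in> A u" if "0 \<le> u" for u
    using that T \<open>\<sigma> 0 = 0\<close> by (simp add: A_def)
  have bdd: "bdd_above (A u)" for u
    by (auto simp: A_def bdd_above_def)
  have \<tau>'_in: "\<tau>' u \<in> {0..T}" if "0 \<le> u" for u
  proof -
    have "0 \<le> \<tau>' u" unfolding \<tau>'_def by (rule cSup_upper[OF A0[OF that] bdd])
    moreover have "\<tau>' u \<le> T" unfolding \<tau>'_def using A0[OF that] by (intro cSup_least) (auto simp: A_def)
    ultimately show ?thesis by simp
  qed
  have \<tau>'_mono: "\<tau>' u \<le> \<tau>' u'" if "0 \<le> u" "u \<le> u'" for u u'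
    unfolding \<tau>'_def using A0[OF that(1)] that bdd by (intro cSup_subset_mono) (auto simp: A_def)
  have \<tau>'_0: "\<tau>' 0 = 0"
  proof -
    have "s = 0" if "s \<in> A 0" for s
    proof (rule ccontr)
      assume "s \<noteq> 0"
      then have "0 < \<kappa> * s" using that \<kappa> by (simp add: A_def)
      then show False using that V_nonneg[of s] by (simp add: A_def \<sigma>_def)
    qed
    then have "A 0 = {0}" using A0[of 0] by auto
    then show ?thesis by (simp add: \<tau>'_def)
  qed
  have \<tau>'_R: "\<tau>' R = T"
  proof -
    have "T \<in> A R" using T by (simp add: A_def R_def)
    then have "T \<le> \<tau>' R" unfolding \<tau>'_def by (intro cSup_upper bdd)
    then show ?thesis using \<tau>'_in[of R] R by simp
  qed
  have key: "\<kappa> * (\<tau>' u' - \<tau>' u) \<le> u' - u" "dist (\<phi> (\<tau>' u)) (\<phi> (\<tau>' u')) \<le> u' - u"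
    if u: "0 \<le> u" "u \<le> u'" for u u'
  proof -
    define s s' where "s = \<tau>' u" and "s' = \<tau>' u'"
    have s: "0 \<le> s" "s \<le> s'" "s' \<le> T"
      using \<tau>'_in[of u] \<tau>'_in[of u'] \<tau>'_mono[OF u] u by (auto simp: s_def s'_def)
    have "\<kappa> * (s' - s) \<le> u' - u \<and> dist (\<phi> s) (\<phi> s') \<le> u' - u"
    proof (cases "s = s'")
      case False
      then have "s < s'" using s by simp
      \<comment> \<open>Strictly inside the interval both estimates follow from the growth of \<open>\<sigma>\<close>; continuity of
          \<open>\<phi>\<close> extends them to the endpoints, where \<open>\<sigma>\<close> may jump.\<close>
      have inner: "\<kappa> * (b - a) \<le> u' - u \<and> dist (\<phi> a) (\<phi> b) \<le> u' - u" if ab: "s < a" "a \<le> b" "b < s'" for a b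
      proof -
        have "a \<notin> A u" using ab(1) cSup_upper[OF _ bdd, of a u] by (auto simp: s_def \<tau>'_def)
        then have a: "u < \<sigma> a" using ab s by (auto simp: A_def)
        obtain c where c: "c \<in> A u'" "b < c"
          using ab(3) less_cSup_iff[OF _ bdd, of u' b] A0[of u'] u unfolding s'_def \<tau>'_def by auto
        have "\<sigma> b \<le> \<sigma> c"
          unfolding \<sigma>_def using c ab s \<kappa> by (intro add_mono V_mono mult_left_mono) (auto simp: A_def)
        then have b: "\<sigma> b \<le> u'" using c by (simp add: A_def)
        have ab': "0 \<le> a" "a \<le> b" "b \<le> T" using ab s by auto
        have \<sigma>_diff: "\<sigma> b - \<sigma> a = (V b - V a) + \<kappa> * (b - a)"
          by (simp add: \<sigma>_def algebra_simps)
        have "0 \<le> \<kappa> * (b - a)"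
          using \<kappa> ab(2) by simp
        then have "\<kappa> * (b - a) \<le> \<sigma> b - \<sigma> a" "dist (\<phi> a) (\<phi> b) \<le> \<sigma> b - \<sigma> a"
          using V_dist[OF ab'] V_mono[OF ab'] unfolding \<sigma>_diff by linarith+
        then show ?thesis using a b by linarith
      qed
      define h where "h n = (s' - s) / (real n + 3)" for n
      have h: "0 < h n" "3 * h n \<le> s' - s" for n
      proof -
        have "h n \<le> (s' - s) / 3"
          unfolding h_def using \<open>s < s'\<close> by (intro divide_left_mono) auto
        then show "3 * h n \<le> s' - s"
          by (simp add: le_divide_eq mult.commute)
        show "0 < h n"
          using \<open>s < s'\<close> by (simp add: h_def)
      qed
      have "h \<longlonglongrightarrow> 0"
        unfolding h_def using LIMSEQ_ignore_initial_segment[OF lim_const_over_n[of "s' - s"], of 3] by simp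
      then have lim: "(\<lambda>n. s + h n) \<longlonglongrightarrow> s" "(\<lambda>n. s' - h n) \<longlonglongrightarrow> s'"
        by (auto intro: tendsto_eq_intros)
      have hT: "s + h n \<in> {0..T}" "s' - h n \<in> {0..T}" for n
        using h[of n] s by auto
      have lim_\<phi>: "(\<lambda>n. \<phi> (s + h n)) \<longlonglongrightarrow> \<phi> s" "(\<lambda>n. \<phi> (s' - h n)) \<longlonglongrightarrow> \<phi> s'"
        using continuous_on_tendsto_compose[OF cont lim(1)] continuous_on_tendsto_compose[OF cont lim(2)] hT s
        by auto
      have ineq: "\<kappa> * ((s' - h n) - (s + h n)) \<le> u' - u \<and> dist (\<phi> (s + h n)) (\<phi> (s' - h n)) \<le> u' - u" for n
        using h[of n] by (intro inner) auto
      have "(\<lambda>n. \<kappa> * ((s' - h n) - (s + h n))) \<longlonglongrightarrow> \<kappa> * (s' - s)"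
        by (intro tendsto_intros lim)
      then have "\<kappa> * (s' - s) \<le> u' - u"
        by (rule LIMSEQ_le_const2) (use ineq in auto)
      moreover have "dist (\<phi> s) (\<phi> s') \<le> u' - u"
        by (rule LIMSEQ_le_const2[OF tendsto_dist[OF lim_\<phi>]]) (use ineq in auto)
      ultimately show ?thesis by simp
    qed (use u in auto)
    then show "\<kappa> * (\<tau>' u' - \<tau>' u) \<le> u' - u" "dist (\<phi> (\<tau>' u)) (\<phi> (\<tau>' u')) \<le> u' - u"
      by (auto simp: s_def s'_def)
  qed
  define \<tau> where "\<tau> r = \<tau>' (R * r)" for r
  have lip: "(1 / \<kappa>)-lipschitz_on {0..R} \<tau>'"
  proof (rule lipschitz_onI)
    fix u v assume uv: "u \<in> {0..R}" "v \<in> {0..R}"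
    show "dist (\<tau>' u) (\<tau>' v) \<le> 1 / \<kappa> * dist u v"
    proof (cases "u \<le> v")
      case True
      then show ?thesis
        using key(1)[of u v] \<tau>'_mono[of u v] uv \<kappa> by (simp add: dist_real_def field_simps)
    next
      case False
      then show ?thesis
        using key(1)[of v u] \<tau>'_mono[of v u] uv \<kappa> by (simp add: dist_real_def field_simps)
    qed
  qed (use \<kappa> in simp)
  have Rr: "R * r \<in> {0..R}" if "r \<in> {0..1}" for r
    using that R(1) by (auto simp: mult_le_cancel_left1)
  have cont_\<tau>: "continuous_on {0..1} \<tau>"
    unfolding \<tau>_def
    by (rule continuous_on_compose2[OF lipschitz_on_continuous_on[OF lip]])
       (use Rr in \<open>auto intro!: continuous_intros\<close>)
  have "\<tau> 0 = 0" "\<tau> 1 = T"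
    by (auto simp: \<tau>_def \<tau>'_0 \<tau>'_R)
  have "time_change T \<tau>"
    unfolding time_change_def
  proof (intro conjI cont_\<tau> mono_onI)
    show "\<tau> r \<le> \<tau> s" if "r \<in> {0..1}" "r \<le> s" for r s
      unfolding \<tau>_def using that R(1) by (intro \<tau>'_mono) auto
    show "\<tau> ` {0..1} = {0..T}"
    proof
      show "\<tau> ` {0..1} \<subseteq> {0..T}"
        unfolding \<tau>_def using Rr \<tau>'_in by fastforce
      show "{0..T} \<subseteq> \<tau> ` {0..1}"
      proof
        fix y assume "y \<in> {0..T}"
        then have "\<exists>r\<ge>0. r \<le> 1 \<and> \<tau> r = y"
          using \<open>\<tau> 0 = 0\<close> \<open>\<tau> 1 = T\<close> by (intro IVT' cont_\<tau>) auto
        then show "y \<in> \<tau> ` {0..1}" by force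
      qed
    qed
  qed
  moreover have "R-lipschitz_on {0..1} (\<phi> \<circ> \<tau>)"
  proof (rule lipschitz_onI)
    fix r s :: real assume rs: "r \<in> {0..1}" "s \<in> {0..1}"
    show "dist ((\<phi> \<circ> \<tau>) r) ((\<phi> \<circ> \<tau>) s) \<le> R * dist r s"
    proof (cases "r \<le> s")
      case True
      then show ?thesis
        using key(2)[of "R * r" "R * s"] rs R(1) by (simp add: \<tau>_def dist_real_def algebra_simps)
    next
      case False
      then show ?thesis
        using key(2)[of "R * s" "R * r"] rs R(1)
        by (simp add: \<tau>_def dist_real_def dist_commute algebra_simps)
    qed
  qed (use R in simp)
  ultimately show thesis
    using that R(2) lipschitz_on_le by blast
qed

section \<open>The action of a Lipschitz curve as a limit of finite sums\<close>

lemma local_action_zero: "local_action D l \<Longrightarrow> x \<in> D \<Longrightarrow> l x 0 = 0"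
  unfolding local_action_def by (metis mult_zero_left order_refl scaleR_zero_left)

lemma local_action_scale: "local_action D l \<Longrightarrow> x \<in> D \<Longrightarrow> 0 \<le> c \<Longrightarrow> l x (c *\<^sub>R y) = c * l x y"
  unfolding local_action_def by blast

lemma local_action_nonneg: "local_action D l \<Longrightarrow> x \<in> D \<Longrightarrow> 0 \<le> l x y"
  unfolding local_action_def by blast

lemma local_action_normalized:
  assumes "local_action D l" "x \<in> D"
  shows "l x y = norm y * l x (sgn y)"
  using local_action_scale[OF assms, of "norm y" "sgn y"] local_action_zero[OF assms]
  by (cases "y = 0") (simp_all add: sgn_div_norm)

lemma local_action_add:
  assumes "local_action D l" "x \<in> D"
  shows "l x (y + z) \<le> l x y + l x z"
proof -
  have "convex_on UNIV (l x)"
    using assms unfolding local_action_def by blast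
  then have "l x ((1 - 1 / 2) *\<^sub>R (2 *\<^sub>R y) + (1 / 2) *\<^sub>R (2 *\<^sub>R z)) \<le>
      (1 - 1 / 2) * l x (2 *\<^sub>R y) + (1 / 2) * l x (2 *\<^sub>R z)"
    by (intro convex_onD) auto
  then show ?thesis
    by (simp add: local_action_scale[OF assms])
qed

lemma local_action_sum:
  assumes "local_action D l" "x \<in> D" "finite I"
  shows "l x (\<Sum>i\<in>I. y i) \<le> (\<Sum>i\<in>I. l x (y i))"
  using assms(3)
proof (induction I)
  case empty
  then show ?case by (simp add: local_action_zero[OF assms(1,2)])
next
  case (insert i I)
  then show ?case
    using local_action_add[OF assms(1,2), of "y i" "\<Sum>i\<in>I. y i"] by simp
qed

lemma norm_sgn_le_one: "norm (sgn (y :: 'a::real_normed_vector)) \<le> 1"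
  by (simp add: norm_sgn)

lemma local_action_bounded:
  assumes l: "local_action D l" and K: "compact K" "K \<subseteq> D"
  obtains C where "C > 0" "\<And>x y. x \<in> K \<Longrightarrow> l x y \<le> C * norm y"
proof -
  have "compact ((\<lambda>(x, y). l x y) ` (K \<times> cball 0 1))"
    using l K unfolding local_action_def
    by (intro compact_continuous_image compact_Times) (auto elim!: continuous_on_subset)
  then obtain C where C: "\<And>x y. x \<in> K \<Longrightarrow> norm y \<le> 1 \<Longrightarrow> \<bar>l x y\<bar> \<le> C"
    by (force dest!: compact_imp_bounded simp: bounded_iff)
  have "l x y \<le> (\<bar>C\<bar> + 1) * norm y" if "x \<in> K" for x y
  proof -
    have "l x (sgn y) \<le> \<bar>C\<bar> + 1"
      using C[OF that norm_sgn_le_one[of y]] by simp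
    then show ?thesis
      using local_action_normalized[OF l, of x y] that K(2)
      by (metis mult.commute mult_right_mono norm_ge_zero subsetD)
  qed
  then show thesis
    using that[of "\<bar>C\<bar> + 1"] by simp
qed

lemma local_action_equicontinuous:
  assumes l: "local_action D l" and K: "compact K" "K \<subseteq> D" and "\<epsilon> > 0"
  obtains \<delta> where "\<delta> > 0"
    "\<And>p q y. p \<in> K \<Longrightarrow> q \<in> K \<Longrightarrow> dist p q < \<delta> \<Longrightarrow> l p y \<le> l q y + \<epsilon> * norm y"
proof -
  have "uniformly_continuous_on (K \<times> cball 0 1) (\<lambda>(x, y). l x y)"
    using l K unfolding local_action_def
    by (intro compact_uniformly_continuous compact_Times) (auto elim!: continuous_on_subset)
  then obtain \<delta> where \<delta>: "\<delta> > 0"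
    "\<And>p q y. p \<in> K \<Longrightarrow> q \<in> K \<Longrightarrow> norm y \<le> 1 \<Longrightarrow> dist p q < \<delta> \<Longrightarrow> dist (l p y) (l q y) < \<epsilon>"
    using \<open>\<epsilon> > 0\<close> unfolding uniformly_continuous_on_def
    by (force simp: dist_Pair_Pair)
  have "l p y \<le> l q y + \<epsilon> * norm y" if "p \<in> K" "q \<in> K" "dist p q < \<delta>" for p q y
  proof -
    have "l p (sgn y) \<le> l q (sgn y) + \<epsilon>"
      using \<delta>(2)[OF that(1,2) norm_sgn_le_one[of y] that(3)] by (simp add: dist_real_def)
    then have "norm y * l p (sgn y) \<le> norm y * (l q (sgn y) + \<epsilon>)"
      by (intro mult_left_mono) auto
    then show ?thesis
      using local_action_normalized[OF l, of p y] local_action_normalized[OF l, of q y] that K(2)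
      by (simp add: subset_eq algebra_simps)
  qed
  then show thesis
    using that[of \<delta>] \<delta>(1) by simp
qed

text \<open>The Riemann sum of the action over \<open>N\<close> equal subintervals of \<open>[0,1]\<close>. By homogeneity of \<open>l\<close> in
  the second argument no step size appears. For \<open>N = 0\<close> the sum is empty.\<close>

definition action_sum :: "('a \<Rightarrow> 'a::euclidean_space \<Rightarrow> real) \<Rightarrow> (real \<Rightarrow> 'a) \<Rightarrow> nat \<Rightarrow> real" where
  "action_sum l \<phi> N =
     (\<Sum>i<N. l (\<phi> (real i / real N)) (\<phi> (real (Suc i) / real N) - \<phi> (real i / real N)))"

lemma grid_in_unit: "i \<le> N \<Longrightarrow> real i / real N \<in> {0..1}"
  by (cases "N = 0") (auto simp: divide_le_eq)

lemma grid_step: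
  assumes "L-lipschitz_on {0..1} \<phi>" "i < N"
  shows "norm (\<phi> (real (Suc i) / real N) - \<phi> (real i / real N)) \<le> L / real N"
proof -
  have "dist (\<phi> (real (Suc i) / real N)) (\<phi> (real i / real N)) \<le> L * dist (real (Suc i) / real N) (real i / real N)"
    using assms by (intro lipschitz_onD[OF assms(1)] grid_in_unit) auto
  also have "dist (real (Suc i) / real N) (real i / real N) = 1 / real N"
    by (simp add: dist_real_def add_divide_distrib)
  finally show ?thesis
    by (simp add: dist_norm)
qed

lemma grid_interval_unique:
  assumes "t \<in> {real i / real N..<real (Suc i) / real N}" "N > 0"
  shows "i = nat \<lfloor>real N * t\<rfloor>"
proof -
  have "real i \<le> real N * t" "real N * t < real i + 1"
    using assms by (auto simp: field_simps)
  then show ?thesis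
    by linarith
qed

lemma action_sum_le:
  assumes lip: "L-lipschitz_on {0..1} \<phi>" and "\<phi> ` {0..1} \<subseteq> K" and C: "0 \<le> C" "\<And>x y. x \<in> K \<Longrightarrow> l x y \<le> C * norm y"
  shows "action_sum l \<phi> N \<le> C * L"
proof -
  have "action_sum l \<phi> N \<le> (\<Sum>i<N. C * (L / real N))"
    unfolding action_sum_def
  proof (rule sum_mono)
    fix i assume "i \<in> {..<N}"
    then have i: "i < N" by simp
    then have "\<phi> (real i / real N) \<in> K"
      using assms(2) grid_in_unit[of i N] by auto
    then have "l (\<phi> (real i / real N)) (\<phi> (real (Suc i) / real N) - \<phi> (real i / real N)) \<le>
        C * norm (\<phi> (real (Suc i) / real N) - \<phi> (real i / real N))"
      by (rule C(2))
    also have "\<dots> \<le> C * (L / real N)"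
      using grid_step[OF lip i] C(1) by (rule mult_left_mono)
    finally show "l (\<phi> (real i / real N)) (\<phi> (real (Suc i) / real N) - \<phi> (real i / real N)) \<le> C * (L / real N)" .
  qed
  also have "\<dots> \<le> C * L"
    using C(1) lipschitz_on_nonneg[OF lip] by (cases "N = 0") auto
  finally show ?thesis .
qed

text \<open>The sums are integrals of uniformly bounded step functions \<open>u N\<close>, which converge to the
  integrand at every point of differentiability, so dominated convergence applies.\<close>

lemma action_sum_tendsto:
  fixes \<phi> :: "real \<Rightarrow> 'a::euclidean_space"
  assumes l: "local_action D l" and lip: "L-lipschitz_on {0..1} \<phi>" and D: "\<phi> ` {0..1} \<subseteq> D"
  obtains s where "0 \<le> s" "action_sum l \<phi> \<longlonglongrightarrow> s"
    "(\<integral>\<^sup>+ \<alpha>. ennreal (l (\<phi> \<alpha>) (vector_derivative \<phi> (at \<alpha>))) \<partial>lebesgue_on {0..1}) = ennreal s"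
proof -
  have L: "0 \<le> L"
    using lip by (rule lipschitz_on_nonneg)
  define K where "K = \<phi> ` {0..1}"
  have K: "compact K" "K \<subseteq> D"
    using D lip by (auto simp: K_def intro!: compact_continuous_image lipschitz_on_continuous_on)
  obtain C where C: "C > 0" "\<And>x y. x \<in> K \<Longrightarrow> l x y \<le> C * norm y"
    using local_action_bounded[OF l K] by blast
  let ?M = "lebesgue_on {0..1::real}"
  define \<Delta> where "\<Delta> N i = \<phi> (real (Suc i) / real N) - \<phi> (real i / real N)" for N i :: nat
  define c where "c N i = l (\<phi> (real i / real N)) (real N *\<^sub>R \<Delta> N i)" for N i :: nat
  define I where "I N i = {real i / real N..<real (Suc i) / real N}" for N i :: nat
  define u where "u N t = (\<Sum>i<N. ennreal (c N i) * indicator (I N i) t)" for N t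
  have inK: "\<phi> (real i / real N) \<in> K" if "i \<le> N" for i N
    using grid_in_unit[OF that] by (auto simp: K_def)
  have c_le: "c N i \<le> C * L" if "i < N" for N i
  proof -
    have "c N i \<le> C * norm (real N *\<^sub>R \<Delta> N i)"
      unfolding c_def using that by (intro C(2) inK) auto
    also have "norm (real N *\<^sub>R \<Delta> N i) \<le> L"
      using grid_step[OF lip that] that by (simp add: \<Delta>_def pos_le_divide_eq mult.commute)
    finally show ?thesis using C(1) by simp
  qed
  have c_nonneg: "0 \<le> c N i" if "i \<le> N" for N i
    unfolding c_def using inK[OF that] K(2) by (auto intro: local_action_nonneg[OF l])
  have meas_I: "(\<lambda>t. ennreal (c N i) * indicator (I N i) t) \<in> borel_measurable ?M" for N i
    unfolding I_def by (intro measurable_restrict_space1 measurable_completion) measurable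
  then have meas: "u N \<in> borel_measurable ?M" for N
    unfolding u_def by (intro borel_measurable_sum)
  have u_eq: "u N t = ennreal (c N (nat \<lfloor>real N * t\<rfloor>))" if t: "0 \<le> t" "t < 1" and "N > 0" for N t
  proof -
    define k where "k = nat \<lfloor>real N * t\<rfloor>"
    have "real N * t < real N"
      using t \<open>N > 0\<close> by simp
    moreover have "0 \<le> real N * t"
      using t by simp
    ultimately have "k < N"
      unfolding k_def by linarith
    have "real k \<le> real N * t" "real N * t < real k + 1"
      using \<open>0 \<le> real N * t\<close> unfolding k_def by linarith+
    then have "t \<in> I N k"
      using \<open>N > 0\<close> by (auto simp: I_def field_simps)
    have "u N t = (\<Sum>i<N. if i = k then ennreal (c N k) else 0)"
      unfolding u_def
    proof (rule sum.cong)
      fix i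
      show "ennreal (c N i) * indicator (I N i) t = (if i = k then ennreal (c N k) else 0)"
      proof (cases "i = k")
        case False
        then have "t \<notin> I N i"
          using grid_interval_unique[of t i N] \<open>N > 0\<close> unfolding I_def k_def by blast
        then show ?thesis using False by simp
      qed (use \<open>t \<in> I N k\<close> in simp)
    qed simp
    then show ?thesis
      using \<open>k < N\<close> by (simp add: k_def)
  qed
  have int_u: "(\<integral>\<^sup>+ t. u N t \<partial>?M) = ennreal (action_sum l \<phi> N)" if "N > 0" for N
  proof -
    have "(\<integral>\<^sup>+ t. u N t \<partial>?M) = (\<Sum>i<N. \<integral>\<^sup>+ t. ennreal (c N i) * indicator (I N i) t \<partial>?M)"
      unfolding u_def by (intro nn_integral_sum meas_I)
    also have "\<dots> = (\<Sum>i<N. ennreal (l (\<phi> (real i / real N)) (\<Delta> N i)))"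
    proof (rule sum.cong)
      fix i assume i: "i \<in> {..<N}"
      have "real (Suc i) / real N \<le> 1"
        using i by (simp add: divide_le_eq)
      moreover have "0 \<le> real i / real N"
        by simp
      ultimately have "I N i \<subseteq> {0..1}"
        unfolding I_def by (meson atLeastLessThan_subseteq_atLeastAtMost_iff)
      then have "I N i \<in> sets ?M" "emeasure ?M (I N i) = ennreal (1 / real N)"
        using \<open>N > 0\<close>
        by (auto simp: sets_restrict_space_iff emeasure_restrict_space I_def divide_right_mono
             simp flip: diff_divide_distrib)
      then have "(\<integral>\<^sup>+ t. ennreal (c N i) * indicator (I N i) t \<partial>?M) = ennreal (c N i) * ennreal (1 / real N)"
        by (simp add: nn_integral_cmult_indicator)
      also have "\<dots> = ennreal (c N i / real N)"
        using c_nonneg[of i N] i by (simp flip: ennreal_mult)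
      also have "c N i / real N = l (\<phi> (real i / real N)) (\<Delta> N i)"
        using \<open>N > 0\<close> inK[of i N] i K(2) local_action_scale[OF l, of "\<phi> (real i / real N)" "real N"]
        unfolding c_def by auto
      finally show "(\<integral>\<^sup>+ t. ennreal (c N i) * indicator (I N i) t \<partial>?M) =
          ennreal (l (\<phi> (real i / real N)) (\<Delta> N i))" .
    qed simp
    also have "\<dots> = ennreal (\<Sum>i<N. l (\<phi> (real i / real N)) (\<Delta> N i))"
      using inK K(2) by (intro sum_ennreal local_action_nonneg[OF l]) auto
    finally show ?thesis
      by (simp add: action_sum_def \<Delta>_def)
  qed
  define F where "F t = ennreal (l (\<phi> t) (vector_derivative \<phi> (at t)))" for t
  have lim_u: "(\<lambda>N. u N t) \<longlonglongrightarrow> F t" if t: "0 < t" "t < 1" and diff: "\<phi> differentiable (at t)" for t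
  proof -
    define k where "k N = nat \<lfloor>real N * t\<rfloor>" for N :: nat
    have k: "real (k N) \<le> real N * t \<and> real N * t < real (Suc (k N))" for N
      using t unfolding k_def by (auto intro: order_trans) linarith+
    have ev: "\<forall>\<^sub>F N in sequentially. real (k N) / real N \<le> t \<and> t \<le> real (Suc (k N)) / real N \<and>
        real (k N) / real N < real (Suc (k N)) / real N"
      using eventually_gt_at_top[of 0]
      by eventually_elim (use k in \<open>auto simp: field_simps less_imp_le\<close>)
    have step: "real (Suc (k N)) / real N - real (k N) / real N = 1 / real N" for N
      by (simp add: add_divide_distrib)
    have step0: "(\<lambda>N. real (Suc (k N)) / real N - real (k N) / real N) \<longlonglongrightarrow> 0"
      unfolding step by (rule lim_1_over_n)
    have "(\<lambda>N. (\<phi> (real (Suc (k N)) / real N) - \<phi> (real (k N) / real N)) /\<^sub>R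
           (real (Suc (k N)) / real N - real (k N) / real N)) \<longlonglongrightarrow> vector_derivative \<phi> (at t)"
      by (rule has_vector_derivative_straddle[OF _ ev step0])
         (use diff in \<open>simp add: vector_derivative_works[symmetric]\<close>)
    then have slope: "(\<lambda>N. real N *\<^sub>R \<Delta> N (k N)) \<longlonglongrightarrow> vector_derivative \<phi> (at t)"
      unfolding step \<Delta>_def by simp
    have "(\<lambda>N. real (k N) / real N) \<longlonglongrightarrow> t"
    proof (rule tendsto_sandwich)
      show "\<forall>\<^sub>F N in sequentially. t - 1 / real N \<le> real (k N) / real N"
        using ev by eventually_elim (use step in \<open>auto simp: algebra_simps\<close>)
      show "\<forall>\<^sub>F N in sequentially. real (k N) / real N \<le> t"
        using ev by eventually_elim auto
      show "(\<lambda>N. t - 1 / real N) \<longlonglongrightarrow> t"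
        using tendsto_diff[OF tendsto_const lim_1_over_n, of t] by simp
    qed simp
    moreover have "isCont \<phi> t"
      using diff by (rule differentiable_imp_continuous_within)
    ultimately have node: "(\<lambda>N. \<phi> (real (k N) / real N)) \<longlonglongrightarrow> \<phi> t"
      by (rule isCont_tendsto_compose[rotated])
    have "\<phi> t \<in> D"
      using D t by auto
    have ev_in: "\<forall>\<^sub>F N in sequentially. 0 < N \<and> k N \<le> N"
      using eventually_gt_at_top[of 0]
    proof eventually_elim
      case (elim N)
      have "real N * t < real N" using elim t by simp
      then show ?case using k[of N] elim by linarith
    qed
    have "continuous_on (D \<times> UNIV) (\<lambda>(x, y). l x y)"
      using l unfolding local_action_def by blast
    then have "(\<lambda>N. (\<lambda>(x, y). l x y) (\<phi> (real (k N) / real N), real N *\<^sub>R \<Delta> N (k N)))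
        \<longlonglongrightarrow> (\<lambda>(x, y). l x y) (\<phi> t, vector_derivative \<phi> (at t))"
    proof (rule continuous_on_tendsto_compose)
      show "\<forall>\<^sub>F N in sequentially. (\<phi> (real (k N) / real N), real N *\<^sub>R \<Delta> N (k N)) \<in> D \<times> UNIV"
        using ev_in by eventually_elim (use inK K(2) in auto)
    qed (use \<open>\<phi> t \<in> D\<close> node slope in \<open>auto intro: tendsto_Pair\<close>)
    then have "(\<lambda>N. c N (k N)) \<longlonglongrightarrow> l (\<phi> t) (vector_derivative \<phi> (at t))"
      by (simp add: c_def)
    then have "(\<lambda>N. ennreal (c N (k N))) \<longlonglongrightarrow> F t"
      unfolding F_def by (rule tendsto_ennrealI)
    moreover have "\<forall>\<^sub>F N in sequentially. ennreal (c N (k N)) = u N t"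
      using eventually_gt_at_top[of 0] by eventually_elim (use u_eq t in \<open>auto simp: k_def\<close>)
    ultimately show ?thesis
      by (rule Lim_transform_eventually)
  qed
  \<comment> \<open>A measurable function that agrees with the integrand almost everywhere.\<close>
  define G where "G t = liminf (\<lambda>N. u N t)" for t
  have "G \<in> borel_measurable ?M"
    unfolding G_def by (intro borel_measurable_liminf meas)
  have AE_lim: "AE t in ?M. (\<lambda>N. u N t) \<longlonglongrightarrow> F t"
  proof -
    \<comment> \<open>Extend \<open>\<phi>\<close> from the unit interval to a Lipschitz function on the real line.\<close>
    define \<phi>' where "\<phi>' t = \<phi> (max 0 (min 1 t))" for t
    have "L-lipschitz_on UNIV \<phi>'"
    proof (rule lipschitz_onI)
      fix s t :: real
      have "dist (\<phi>' s) (\<phi>' t) \<le> L * dist (max 0 (min 1 s)) (max 0 (min 1 t))"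
        unfolding \<phi>'_def by (rule lipschitz_onD[OF lip]) auto
      also have "\<dots> \<le> L * dist s t"
        using L by (intro mult_left_mono) (auto simp: dist_real_def)
      finally show "dist (\<phi>' s) (\<phi>' t) \<le> L * dist s t" .
    qed (rule L)
    then have "negligible {t. \<not> \<phi>' differentiable (at t)}"
      by (rule lipschitz_differentiable_AE)
    then have "negligible ({t. \<not> \<phi>' differentiable (at t)} \<union> {0, 1})"
      by (intro negligible_Un) auto
    then have "{t. \<not> \<phi>' differentiable (at t)} \<union> {0, 1} \<in> null_sets lebesgue"
      by (simp add: negligible_iff_null_sets)
    then have "AE t in lebesgue. t \<notin> {t. \<not> \<phi>' differentiable (at t)} \<union> {0, 1}"
      by (rule AE_not_in)
    then have "AE t in lebesgue. t \<in> {0..1} \<longrightarrow> (\<lambda>N. u N t) \<longlonglongrightarrow> F t"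
    proof (rule AE_mp, intro AE_I2 impI)
      fix t assume *: "t \<notin> {t. \<not> \<phi>' differentiable (at t)} \<union> {0, 1}" "t \<in> {0..1::real}"
      then have t: "0 < t" "t < 1" by (auto simp: less_le)
      have "\<phi> differentiable (at t within {0<..<1})"
      proof (rule differentiable_transform_within[of \<phi>' t "{0<..<1}" 1])
        show "\<phi>' differentiable (at t within {0<..<1})"
          using * by (auto intro: differentiable_at_withinI)
      qed (use t in \<open>auto simp: \<phi>'_def\<close>)
      then have "\<phi> differentiable (at t)"
        using t at_within_open[of t "{0<..<1}"] by simp
      then show "(\<lambda>N. u N t) \<longlonglongrightarrow> F t"
        using t by (intro lim_u)
    qed
    then show ?thesis
      by (simp add: AE_restrict_space_iff)
  qed
  then have AE_G: "AE t in ?M. (\<lambda>N. u N t) \<longlonglongrightarrow> G t" and AE_FG: "AE t in ?M. F t = G t"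
    by (auto elim!: eventually_mono simp: G_def lim_imp_Liminf)
  have "(\<lambda>N. \<integral>\<^sup>+ t. u (Suc N) t \<partial>?M) \<longlonglongrightarrow> (\<integral>\<^sup>+ t. G t \<partial>?M)"
  proof (rule nn_integral_dominated_convergence[where w = "\<lambda>_. ennreal (C * L)"])
    show "AE t in ?M. u (Suc N) t \<le> ennreal (C * L)" for N
    proof -
      have "AE t in lebesgue. t \<notin> {1::real}"
        by (intro AE_not_in) (simp add: negligible_iff_null_sets[symmetric])
      then have "AE t in lebesgue. t \<in> {0..1::real} \<longrightarrow> u (Suc N) t \<le> ennreal (C * L)"
      proof (rule AE_mp, intro AE_I2 impI)
        fix t :: real assume "t \<notin> {1}" "t \<in> {0..1}"
        then have t: "0 \<le> t" "t < 1" by auto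
        have "nat \<lfloor>real (Suc N) * t\<rfloor> < Suc N"
        proof -
          have "real (Suc N) * t < real (Suc N)" using t by simp
          then show ?thesis by linarith
        qed
        then show "u (Suc N) t \<le> ennreal (C * L)"
          using t c_le by (subst u_eq) (auto intro!: ennreal_leI)
      qed
      then show ?thesis
        by (simp add: AE_restrict_space_iff)
    qed
    show "(\<integral>\<^sup>+ t. ennreal (C * L) \<partial>?M) < \<infinity>"
      by (simp add: emeasure_restrict_space ennreal_mult_less_top)
    show "AE t in ?M. (\<lambda>N. u (Suc N) t) \<longlonglongrightarrow> G t"
      using AE_G by eventually_elim (rule LIMSEQ_Suc)
  qed (use meas \<open>G \<in> borel_measurable ?M\<close> in auto)
  also have "(\<integral>\<^sup>+ t. G t \<partial>?M) = (\<integral>\<^sup>+ t. F t \<partial>?M)"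
    using AE_FG by (intro nn_integral_cong_AE) auto
  finally have lim: "(\<lambda>N. ennreal (action_sum l \<phi> (Suc N))) \<longlonglongrightarrow> (\<integral>\<^sup>+ t. F t \<partial>?M)"
    by (simp add: int_u)
  have sum_nonneg: "0 \<le> action_sum l \<phi> N" for N
    unfolding action_sum_def using inK K(2) by (intro sum_nonneg local_action_nonneg[OF l]) auto
  have "ennreal (action_sum l \<phi> (Suc N)) \<le> ennreal (C * L)" for N
    using C by (intro ennreal_leI action_sum_le[OF lip, where K = K]) (auto simp: K_def)
  then have "(\<integral>\<^sup>+ t. F t \<partial>?M) \<le> ennreal (C * L)"
    by (intro LIMSEQ_le_const2[OF lim]) auto
  then obtain s where s: "s \<ge> 0" "(\<integral>\<^sup>+ t. F t \<partial>?M) = ennreal s"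
    by (cases "\<integral>\<^sup>+ t. F t \<partial>?M") (auto simp: top_unique)
  have "(\<lambda>N. action_sum l \<phi> (Suc N)) \<longlonglongrightarrow> s"
    using lim s sum_nonneg by (auto dest: tendsto_ennrealD)
  then have "action_sum l \<phi> \<longlonglongrightarrow> s"
    by (rule LIMSEQ_imp_Suc)
  then show thesis
    using that[of s] s unfolding F_def by simp
qed

section \<open>Lipschitz parameterizations and lower semicontinuity of the action\<close>

text \<open>The representative provided here is the one that generates the equivalence class, for
  which all its reparameterizations are evidently equivalent to it.\<close>

lemma curves_betweenE:
  assumes "\<gamma> \<in> curves_between D E x y"
  obtains T \<phi> where "(T, \<phi>) \<in> \<gamma>" "0 < T" "continuous_on {0..T} \<phi>" "path_length T \<phi> \<le> curve_length \<gamma>"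
    "\<And>\<tau>. time_change T \<tau> \<Longrightarrow> (1, \<phi> \<circ> \<tau>) \<in> \<gamma>"
proof -
  have "\<gamma> \<in> curves D"
    using assms by (simp add: curves_between_def rectifiable_curves_def)
  then obtain p where p: "p \<in> parameterizations D" "\<gamma> = same_curve D `` {p}"
    unfolding curves_def by (rule quotientE)
  obtain T \<phi> where T: "p = (T, \<phi>)" by (cases p)
  have "(T, \<phi>) \<in> \<gamma>"
    using same_curve_refl[of T \<phi> D] p T by auto
  then have "path_length T \<phi> \<le> curve_length \<gamma>"
    unfolding curve_length_def by (intro SUP_upper2[of "(T, \<phi>)"]) auto
  then show thesis
    using that[OF \<open>(T, \<phi>) \<in> \<gamma>\<close>] p T reparameterization_in_curve[of T \<phi> D]
    by (auto simp: parameterizations_def)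
qed

lemma curves_between_parameterization:
  assumes "\<gamma> \<in> curves_between D E x y" "(1, \<phi>) \<in> \<gamma>"
  shows "\<phi> ` {0..1} \<subseteq> E" "\<phi> 0 = x" "\<phi> 1 = y"
proof -
  have "curve_image \<gamma> \<subseteq> E" "starts_at \<gamma> x" "ends_at \<gamma> y"
    using assms(1) by (auto simp: curves_between_def)
  then show "\<phi> ` {0..1} \<subseteq> E" "\<phi> 0 = x" "\<phi> 1 = y"
    using assms(2) unfolding curve_image_def starts_at_def ends_at_def by fastforce+
qed

lemma lipschitz_parameterization:
  assumes \<gamma>: "\<gamma> \<in> curves_between D E x y" "curve_length \<gamma> \<le> ennreal \<Lambda>" and "0 \<le> \<Lambda>" "0 < \<epsilon>"
  obtains \<phi> where "(1, \<phi>) \<in> \<gamma>" "(\<Lambda> + \<epsilon>)-lipschitz_on {0..1} \<phi>"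
proof -
  obtain T \<phi> where \<phi>: "0 < T" "continuous_on {0..T} \<phi>" "path_length T \<phi> \<le> curve_length \<gamma>"
    "\<And>\<tau>. time_change T \<tau> \<Longrightarrow> (1, \<phi> \<circ> \<tau>) \<in> \<gamma>"
    using curves_betweenE[OF \<gamma>(1)] by metis
  obtain \<tau> where "time_change T \<tau>" "(\<Lambda> + \<epsilon>)-lipschitz_on {0..1} (\<phi> \<circ> \<tau>)"
    using lipschitz_reparameterization[OF \<phi>(1,2) order_trans[OF \<phi>(3) \<gamma>(2)] assms(3,4)] .
  then show thesis
    using that \<phi>(4) by blast
qed

lemma lipschitz_reparameterized_in_curve:
  assumes "\<gamma> \<in> curves_between D E x y"
  obtains T \<phi> \<tau> L where "time_change T \<tau>" "L-lipschitz_on {0..1} (\<phi> \<circ> \<tau>)"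
    "\<And>\<sigma>. time_change T \<sigma> \<Longrightarrow> (1, \<phi> \<circ> \<sigma>) \<in> \<gamma>"
proof -
  obtain T \<phi> where \<phi>: "0 < T" "continuous_on {0..T} \<phi>" "path_length T \<phi> \<le> curve_length \<gamma>"
    "\<And>\<tau>. time_change T \<tau> \<Longrightarrow> (1, \<phi> \<circ> \<tau>) \<in> \<gamma>"
    using curves_betweenE[OF assms] by metis
  have "curve_length \<gamma> < \<infinity>"
    using assms by (simp add: curves_between_def rectifiable_curves_def)
  then have "path_length T \<phi> \<le> ennreal (enn2real (curve_length \<gamma>))"
    using \<phi>(3) by simp
  then obtain \<tau> where "time_change T \<tau>" "(enn2real (curve_length \<gamma>) + 1)-lipschitz_on {0..1} (\<phi> \<circ> \<tau>)"
    by (rule lipschitz_reparameterization[OF \<phi>(1,2), where \<epsilon> = 1]) auto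
  then show thesis
    using that \<phi>(4) by blast
qed

lemma sum_consecutive_blocks:
  fixes d :: "nat \<Rightarrow> real"
  assumes "mono_on {..m} k"
  shows "(\<Sum>i<m. \<Sum>j\<in>{k i..<k (Suc i)}. d j) = (\<Sum>j\<in>{k 0..<k m}. d j)"
  using assms
proof (induction m)
  case (Suc m)
  have "k 0 \<le> k m" "k m \<le> k (Suc m)"
    using Suc.prems by (auto intro: mono_onD)
  moreover have "mono_on {..m} k"
    using Suc.prems by (rule mono_on_subset) auto
  ultimately show ?case
    using Suc.IH by (simp add: sum.atLeastLessThan_concat)
qed simp

text \<open>For a Lipschitz function it suffices to bound the sums over equidistant partitions: an arbitrary
  partition can be rounded to a fine grid.\<close>

lemma path_length_le_of_grid:
  fixes \<phi> :: "real \<Rightarrow> 'a::real_normed_vector"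
  assumes lip: "L-lipschitz_on {0..1} \<phi>"
    and grid: "\<And>N. 0 < N \<Longrightarrow> (\<Sum>i<N. norm (\<phi> (real (Suc i) / real N) - \<phi> (real i / real N))) \<le> c"
  shows "path_length 1 \<phi> \<le> ennreal c"
proof (rule path_length_leI)
  fix m :: nat and t :: "nat \<Rightarrow> real" assume t: "mono_on {..m} t" "t ` {..m} \<subseteq> {0..1}"
  have L: "0 \<le> L" using lip by (rule lipschitz_on_nonneg)
  have t_in: "0 \<le> t i" "t i \<le> 1" if "i \<le> m" for i
    using t(2) that by auto
  have bound: "(\<Sum>i<m. dist (\<phi> (t i)) (\<phi> (t (Suc i)))) \<le> c + 2 * real m * L / real N" if N: "N > 0" for N :: nat
  proof -
    define k where "k i = nat \<lfloor>real N * t i\<rfloor>" for i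
    define d where "d j = norm (\<phi> (real (Suc j) / real N) - \<phi> (real j / real N))" for j
    have kN: "k i \<le> N" if "i \<le> m" for i
    proof -
      have "real N * t i \<le> real N * 1"
        using t_in[OF that] by (intro mult_left_mono) auto
      then show ?thesis unfolding k_def by linarith
    qed
    have mono_k: "mono_on {..m} k"
    proof (rule mono_onI)
      fix i j assume "i \<in> {..m}" "j \<in> {..m}" "i \<le> j"
      then have "real N * t i \<le> real N * t j"
        by (intro mult_left_mono mono_onD[OF t(1)]) auto
      then show "k i \<le> k j"
        unfolding k_def by (intro nat_mono floor_mono)
    qed
    have near: "dist (\<phi> (t i)) (\<phi> (real (k i) / real N)) \<le> L / real N" if "i \<le> m" for i
    proof -
      have "0 \<le> real N * t i" using t_in[OF that] by simp
      then have "real (k i) \<le> real N * t i" "real N * t i \<le> real (k i) + 1"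
        unfolding k_def by linarith+
      then have "real (k i) / real N \<le> t i" "t i \<le> (real (k i) + 1) / real N"
        using N by (simp_all add: divide_le_eq le_divide_eq mult.commute)
      then have "\<bar>t i - real (k i) / real N\<bar> \<le> 1 / real N"
        by (simp add: add_divide_distrib)
      then have "L * dist (t i) (real (k i) / real N) \<le> L * (1 / real N)"
        using L by (intro mult_left_mono) (auto simp: dist_real_def)
      moreover have "dist (\<phi> (t i)) (\<phi> (real (k i) / real N)) \<le> L * dist (t i) (real (k i) / real N)"
        using t_in[OF that] grid_in_unit[OF kN[OF that]] by (intro lipschitz_onD[OF lip]) auto
      ultimately show ?thesis by simp
    qed
    have block: "dist (\<phi> (real a / real N)) (\<phi> (real b / real N)) \<le> (\<Sum>j\<in>{a..<b}. d j)" if "a \<le> b" for a b :: nat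
    proof -
      have "\<phi> (real b / real N) - \<phi> (real a / real N) =
          (\<Sum>j\<in>{a..<b}. \<phi> (real (Suc j) / real N) - \<phi> (real j / real N))"
        using sum_Suc_diff'[OF that, of "\<lambda>j. \<phi> (real j / real N)"] by simp
      moreover have "norm (\<Sum>j\<in>{a..<b}. \<phi> (real (Suc j) / real N) - \<phi> (real j / real N)) \<le> (\<Sum>j\<in>{a..<b}. d j)"
        unfolding d_def by (rule norm_sum)
      ultimately show ?thesis
        by (simp only: dist_norm norm_minus_commute[of "\<phi> (real a / real N)"])
    qed
    have "(\<Sum>i<m. dist (\<phi> (t i)) (\<phi> (t (Suc i)))) \<le> (\<Sum>i<m. (\<Sum>j\<in>{k i..<k (Suc i)}. d j) + 2 * L / real N)"
    proof (rule sum_mono)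
      fix i assume "i \<in> {..<m}"
      then have i: "i \<le> m" "Suc i \<le> m" by auto
      have "k i \<le> k (Suc i)"
        using i by (intro mono_onD[OF mono_k]) auto
      then have "dist (\<phi> (real (k i) / real N)) (\<phi> (real (k (Suc i)) / real N)) \<le> (\<Sum>j\<in>{k i..<k (Suc i)}. d j)"
        by (rule block)
      then show "dist (\<phi> (t i)) (\<phi> (t (Suc i))) \<le> (\<Sum>j\<in>{k i..<k (Suc i)}. d j) + 2 * L / real N"
        using near[OF i(1)] near[OF i(2)]
          dist_triangle[of "\<phi> (t i)" "\<phi> (t (Suc i))" "\<phi> (real (k i) / real N)"]
          dist_triangle2[of "\<phi> (real (k i) / real N)" "\<phi> (t (Suc i))" "\<phi> (real (k (Suc i)) / real N)"]
        by simp
    qed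
    also have "\<dots> = (\<Sum>j\<in>{k 0..<k m}. d j) + real m * (2 * L / real N)"
      using sum_consecutive_blocks[OF mono_k, of d] by (simp add: sum.distrib d_def)
    also have "(\<Sum>j\<in>{k 0..<k m}. d j) \<le> (\<Sum>j<N. d j)"
      using kN[of m] by (intro sum_mono2) (auto simp: d_def)
    also have "\<dots> \<le> c"
      unfolding d_def using N by (rule grid)
    finally show ?thesis
      by (simp add: mult.commute mult.left_commute)
  qed
  have "(\<lambda>N. c + 2 * real m * L / real N) \<longlonglongrightarrow> c + 0"
    by (intro tendsto_add tendsto_const lim_const_over_n)
  then show "(\<Sum>i<m. dist (\<phi> (t i)) (\<phi> (t (Suc i)))) \<le> c"
    by (intro tendsto_lowerbound[of _ "c" sequentially])
       (auto intro: eventually_mono[OF eventually_gt_at_top[of 0]] bound)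
qed

text \<open>Reversing one curve and appending another one connects the endpoints of two curves that
  start at the same point.\<close>

lemma lipschitz_join_at_start:
  fixes \<phi>\<^sub>1 \<phi>\<^sub>2 :: "real \<Rightarrow> 'a::metric_space"
  assumes "L-lipschitz_on {0..1} \<phi>\<^sub>1" "L-lipschitz_on {0..1} \<phi>\<^sub>2" "\<phi>\<^sub>1 0 = \<phi>\<^sub>2 0"
  obtains \<phi> :: "real \<Rightarrow> 'a" where "(2 * L)-lipschitz_on {0..1} \<phi>" "\<phi> 0 = \<phi>\<^sub>1 1" "\<phi> 1 = \<phi>\<^sub>2 1"
    "\<phi> ` {0..1} \<subseteq> \<phi>\<^sub>1 ` {0..1} \<union> \<phi>\<^sub>2 ` {0..1}"
proof -
  define \<phi> where "\<phi> r = (if r \<le> 1 / 2 then \<phi>\<^sub>1 (1 - 2 * r) else \<phi>\<^sub>2 (2 * r - 1))" for r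
  have L: "0 \<le> L" using assms(1) by (rule lipschitz_on_nonneg)
  have "(2 * L)-lipschitz_on {0..1/2} (\<lambda>r. \<phi>\<^sub>1 (1 - 2 * r))"
  proof (rule lipschitz_onI)
    fix r s :: real assume "r \<in> {0..1/2}" "s \<in> {0..1/2}"
    then have "dist (\<phi>\<^sub>1 (1 - 2 * r)) (\<phi>\<^sub>1 (1 - 2 * s)) \<le> L * dist (1 - 2 * r) (1 - 2 * s)"
      by (intro lipschitz_onD[OF assms(1)]) auto
    also have "dist (1 - 2 * r) (1 - 2 * s) = 2 * dist r s"
      by (auto simp: dist_real_def abs_if)
    finally show "dist (\<phi>\<^sub>1 (1 - 2 * r)) (\<phi>\<^sub>1 (1 - 2 * s)) \<le> 2 * L * dist r s"
      by simp
  qed (use L in simp)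
  moreover have "(2 * L)-lipschitz_on {1/2..1} (\<lambda>r. \<phi>\<^sub>2 (2 * r - 1))"
  proof (rule lipschitz_onI)
    fix r s :: real assume "r \<in> {1/2..1}" "s \<in> {1/2..1}"
    then have "dist (\<phi>\<^sub>2 (2 * r - 1)) (\<phi>\<^sub>2 (2 * s - 1)) \<le> L * dist (2 * r - 1) (2 * s - 1)"
      by (intro lipschitz_onD[OF assms(2)]) auto
    also have "dist (2 * r - 1) (2 * s - 1) = 2 * dist r s"
      by (auto simp: dist_real_def abs_if)
    finally show "dist (\<phi>\<^sub>2 (2 * r - 1)) (\<phi>\<^sub>2 (2 * s - 1)) \<le> 2 * L * dist r s"
      by simp
  qed (use L in simp)
  ultimately have "(2 * L)-lipschitz_on {0..1} \<phi>"
    unfolding \<phi>_def using assms(3) by (intro lipschitz_on_concat) auto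
  moreover have "\<phi> ` {0..1} \<subseteq> \<phi>\<^sub>1 ` {0..1} \<union> \<phi>\<^sub>2 ` {0..1}"
    by (auto simp: \<phi>_def)
  ultimately show thesis
    by (intro that[of \<phi>]) (auto simp: \<phi>_def)
qed

lemma lipschitz_pw_abs_continuous:
  assumes lip: "L-lipschitz_on {0..1} \<phi>" and "\<phi> ` {0..1} \<subseteq> D"
  shows "\<phi> \<in> pw_abs_continuous D"
proof -
  have L: "0 \<le> L" using lip by (rule lipschitz_on_nonneg)
  have "abs_continuous_on ({0..1} \<inter> ball \<alpha> 1) \<phi>" for \<alpha>
    unfolding abs_continuous_on_def
  proof (intro allI impI)
    fix \<epsilon> :: real assume "\<epsilon> > 0"
    show "\<exists>\<delta>>0. \<forall>(N::nat) u v. (\<forall>i<N. u i \<le> v i \<and> {u i..v i} \<subseteq> {0..1} \<inter> ball \<alpha> 1) \<and>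
        disjoint_family_on (\<lambda>i. {u i<..<v i}) {..<N} \<and> (\<Sum>i<N. v i - u i) < \<delta> \<longrightarrow>
        (\<Sum>i<N. dist (\<phi> (u i)) (\<phi> (v i))) < \<epsilon>"
    proof (intro exI[of _ "\<epsilon> / (L + 1)"] conjI allI impI)
      fix N :: nat and u v :: "nat \<Rightarrow> real"
      assume *: "(\<forall>i<N. u i \<le> v i \<and> {u i..v i} \<subseteq> {0..1} \<inter> ball \<alpha> 1) \<and>
        disjoint_family_on (\<lambda>i. {u i<..<v i}) {..<N} \<and> (\<Sum>i<N. v i - u i) < \<epsilon> / (L + 1)"
      have "(\<Sum>i<N. dist (\<phi> (u i)) (\<phi> (v i))) \<le> (\<Sum>i<N. L * (v i - u i))"
      proof (rule sum_mono)
        fix i assume "i \<in> {..<N}"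
        then have i: "u i \<le> v i" "{u i..v i} \<subseteq> {0..1}"
          using * by auto
        then have "dist (\<phi> (u i)) (\<phi> (v i)) \<le> L * dist (u i) (v i)"
          by (intro lipschitz_onD[OF lip]) auto
        then show "dist (\<phi> (u i)) (\<phi> (v i)) \<le> L * (v i - u i)"
          using i by (simp add: dist_real_def)
      qed
      also have "\<dots> \<le> (L + 1) * (\<Sum>i<N. v i - u i)"
        unfolding sum_distrib_left using * by (intro sum_mono mult_right_mono) auto
      also have "\<dots> < \<epsilon>"
        using * L by (simp add: pos_less_divide_eq mult.commute)
      finally show "(\<Sum>i<N. dist (\<phi> (u i)) (\<phi> (v i))) < \<epsilon>" .
    qed (use \<open>\<epsilon> > 0\<close> L in simp)
  qed
  then show ?thesis
    using assms lipschitz_on_continuous_on[OF lip] unfolding pw_abs_continuous_def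
    by (auto intro!: exI[of _ "{}"] exI[of _ 1])
qed

lemma action_of_lipschitz_curve:
  fixes D :: "'a::euclidean_space set"
  assumes S: "has_local_action D l S" and \<gamma>: "\<gamma> \<in> curves_between D E x y" "(1, \<phi>) \<in> \<gamma>" and "E \<subseteq> D"
    and lip: "L-lipschitz_on {0..1} \<phi>"
  obtains s where "0 \<le> s" "S \<gamma> = ennreal s" "action_sum l \<phi> \<longlonglongrightarrow> s"
proof -
  have D: "\<phi> ` {0..1} \<subseteq> D"
    using curves_between_parameterization[OF \<gamma>] \<open>E \<subseteq> D\<close> by blast
  have pw: "\<phi> \<in> pw_abs_continuous D"
    using lip D by (rule lipschitz_pw_abs_continuous)
  moreover have "\<gamma> \<in> pw_abs_continuous_curves D"
    using \<gamma> pw by (auto simp: pw_abs_continuous_curves_def curves_between_def rectifiable_curves_def)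
  ultimately have *: "S \<gamma> = (\<integral>\<^sup>+ \<alpha>. ennreal (l (\<phi> \<alpha>) (vector_derivative \<phi> (at \<alpha>))) \<partial>lebesgue_on {0..1})"
    using S \<gamma>(2) unfolding has_local_action_def by blast
  have "local_action D l"
    using S by (simp add: has_local_action_def)
  then show thesis
    using action_sum_tendsto[OF _ lip D] * that by metis
qed

text \<open>Lower semicontinuity of the action under uniform convergence of equi-Lipschitz curves. On each
  interval of a coarse grid the first argument of the local action is frozen, so that
  subadditivity in the second argument replaces the fine increments by their sum.\<close>

lemma action_lower_semicontinuous:
  fixes \<phi> :: "real \<Rightarrow> 'a::euclidean_space"
  assumes l: "local_action D l" and K: "compact K" "K \<subseteq> D"
    and \<phi>: "L-lipschitz_on {0..1} \<phi>" "\<phi> ` {0..1} \<subseteq> K" "action_sum l \<phi> \<longlonglongrightarrow> s"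
    and \<phi>n: "\<And>n. L-lipschitz_on {0..1} (\<phi>n n)" "\<And>n. \<phi>n n ` {0..1} \<subseteq> K"
      "\<And>n. action_sum l (\<phi>n n) \<longlonglongrightarrow> sn n"
    and conv: "\<And>\<epsilon>. \<epsilon> > 0 \<Longrightarrow> \<forall>\<^sub>F n in sequentially. \<forall>t\<in>{0..1}. dist (\<phi>n n t) (\<phi> t) < \<epsilon>"
    and lim: "sn \<longlonglongrightarrow> c"
  shows "s \<le> c"
proof -
  have L: "0 \<le> L" using \<phi>(1) by (rule lipschitz_on_nonneg)
  have "s \<le> c + \<omega> * L" if "\<omega> > 0" for \<omega>
  proof -
    obtain \<delta> where \<delta>: "\<delta> > 0"
      "\<And>p q y. p \<in> K \<Longrightarrow> q \<in> K \<Longrightarrow> dist p q < \<delta> \<Longrightarrow> l p y \<le> l q y + \<omega> * norm y"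
      using local_action_equicontinuous[OF l K \<open>\<omega> > 0\<close>] by blast
    have coarse: "(\<Sum>i<N. l (\<phi> (real i / real N)) (\<phi>n n (real (Suc i) / real N) - \<phi>n n (real i / real N)))
        \<le> sn n + \<omega> * L"
      if N: "0 < N" "L / real N < \<delta> / 2" and n: "\<forall>t\<in>{0..1}. dist (\<phi>n n t) (\<phi> t) < \<delta> / 2" for N n
    proof -
      have fine: "(\<Sum>i<N. l (\<phi> (real i / real N)) (\<phi>n n (real (Suc i) / real N) - \<phi>n n (real i / real N)))
          \<le> action_sum l (\<phi>n n) (N * k) + \<omega> * L" if k: "0 < k" for k
      proof -
        let ?M = "N * k"
        define p where "p j = \<phi>n n (real j / real ?M)" for j
        have M: "0 < ?M" using N k by simp
        have coarse_node: "\<phi>n n (real i / real N) = p (i * k)" for i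
          using k by (simp add: p_def)
        have node: "\<phi> (real i / real N) \<in> K" if "i \<le> N" for i
          using \<phi>(2) grid_in_unit[OF that] by blast
        have node': "p j \<in> K" if "j \<le> ?M" for j
          using \<phi>n(2)[of n] grid_in_unit[OF that] unfolding p_def by blast
        \<comment> \<open>Subadditivity, followed by moving the first argument from the coarse to the fine node.\<close>
        have *: "l (\<phi> (real i / real N)) (p (Suc i * k) - p (i * k)) \<le>
            (\<Sum>j\<in>{i * k..<Suc i * k}. l (p j) (p (Suc j) - p j) + \<omega> * (L / real ?M))" if i: "i < N" for i
        proof -
          have "p (Suc i * k) - p (i * k) = (\<Sum>j\<in>{i * k..<Suc i * k}. p (Suc j) - p j)"
            using sum_Suc_diff'[of "i * k" "Suc i * k" p] by simp
          then have "l (\<phi> (real i / real N)) (p (Suc i * k) - p (i * k)) \<le>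
              (\<Sum>j\<in>{i * k..<Suc i * k}. l (\<phi> (real i / real N)) (p (Suc j) - p j))"
            using node[of i] K(2) i by (auto intro!: local_action_sum[OF l])
          also have "\<dots> \<le> (\<Sum>j\<in>{i * k..<Suc i * k}. l (p j) (p (Suc j) - p j) + \<omega> * (L / real ?M))"
          proof (rule sum_mono)
            fix j assume j: "j \<in> {i * k..<Suc i * k}"
            have "Suc i * k \<le> ?M"
              using i by (intro mult_right_mono) auto
            then have jM: "j < ?M" using j by simp
            have "real j / real ?M - real i / real N = (real j - real (i * k)) / real ?M"
              using k N by (simp add: field_simps)
            moreover have "\<bar>real j - real (i * k)\<bar> \<le> real k"
            proof -
              have "i * k \<le> j" "j - i * k \<le> k" using j by auto
              then show ?thesis
                by (metis abs_of_nat of_nat_diff of_nat_le_iff)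
            qed
            ultimately have "\<bar>real i / real N - real j / real ?M\<bar> \<le> real k / real ?M"
              by (metis abs_divide abs_minus_commute abs_of_nat divide_right_mono of_nat_0_le_iff)
            also have "real k / real ?M = 1 / real N"
              using k by simp
            finally have time: "dist (real i / real N) (real j / real ?M) \<le> 1 / real N"
              by (simp add: dist_real_def)
            have "dist (\<phi> (real i / real N)) (\<phi> (real j / real ?M)) \<le> L * dist (real i / real N) (real j / real ?M)"
              using i jM by (intro lipschitz_onD[OF \<phi>(1)] grid_in_unit) auto
            also have "\<dots> \<le> L / real N"
              using mult_left_mono[OF time L] by simp
            also have "\<dots> < \<delta> / 2" by fact
            finally have "dist (\<phi> (real i / real N)) (\<phi> (real j / real ?M)) < \<delta> / 2" .
            moreover have "dist (p j) (\<phi> (real j / real ?M)) < \<delta> / 2"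
              unfolding p_def using n grid_in_unit[OF less_imp_le[OF jM]] by blast
            ultimately have "dist (\<phi> (real i / real N)) (p j) < \<delta>"
              using dist_triangle2[of "\<phi> (real i / real N)" "p j" "\<phi> (real j / real ?M)"] by simp
            then have "l (\<phi> (real i / real N)) (p (Suc j) - p j) \<le> l (p j) (p (Suc j) - p j) + \<omega> * norm (p (Suc j) - p j)"
              using i jM by (intro \<delta>(2) node node') auto
            also have "norm (p (Suc j) - p j) \<le> L / real ?M"
              unfolding p_def by (rule grid_step[OF \<phi>n(1) jM])
            finally show "l (\<phi> (real i / real N)) (p (Suc j) - p j) \<le> l (p j) (p (Suc j) - p j) + \<omega> * (L / real ?M)"
              using \<open>\<omega> > 0\<close> by simp
          qed
          finally show ?thesis .
        qed
        have "(\<Sum>i<N. l (\<phi> (real i / real N)) (\<phi>n n (real (Suc i) / real N) - \<phi>n n (real i / real N))) \<le>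
            (\<Sum>i<N. \<Sum>j\<in>{i * k..<Suc i * k}. l (p j) (p (Suc j) - p j) + \<omega> * (L / real ?M))"
          unfolding coarse_node using * by (intro sum_mono) auto
        also have "\<dots> = (\<Sum>j<?M. l (p j) (p (Suc j) - p j) + \<omega> * (L / real ?M))"
          using sum.nat_group[of "\<lambda>j. l (p j) (p (Suc j) - p j) + \<omega> * (L / real ?M)" k N]
          by (simp add: add.commute mult.commute)
        also have "\<dots> = action_sum l (\<phi>n n) ?M + \<omega> * L"
          using M by (simp add: sum.distrib action_sum_def p_def)
        finally show ?thesis .
      qed
      have "filterlim (\<lambda>k. N * k) sequentially sequentially"
        using N(1) by (intro filterlim_subseq strict_monoI) auto
      then have "(\<lambda>k. action_sum l (\<phi>n n) (N * k)) \<longlonglongrightarrow> sn n"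
        by (rule filterlim_compose[OF \<phi>n(3)])
      then have "(\<lambda>k. action_sum l (\<phi>n n) (N * k) + \<omega> * L) \<longlonglongrightarrow> sn n + \<omega> * L"
        by (intro tendsto_intros)
      then show ?thesis
        by (rule tendsto_lowerbound[OF _ eventually_mono[OF eventually_gt_at_top[of 0] fine]]) auto
    qed
    have limit: "action_sum l \<phi> N \<le> c + \<omega> * L" if N: "0 < N" "L / real N < \<delta> / 2" for N
    proof -
      have pointwise: "(\<lambda>n. \<phi>n n t) \<longlonglongrightarrow> \<phi> t" if "t \<in> {0..1}" for t
      proof (rule tendstoI)
        fix e :: real assume "e > 0"
        show "\<forall>\<^sub>F n in sequentially. dist (\<phi>n n t) (\<phi> t) < e"
          using conv[OF \<open>e > 0\<close>] by eventually_elim (use that in auto)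
      qed
      have "(\<lambda>n. \<Sum>i<N. l (\<phi> (real i / real N)) (\<phi>n n (real (Suc i) / real N) - \<phi>n n (real i / real N)))
          \<longlonglongrightarrow> action_sum l \<phi> N"
        unfolding action_sum_def
      proof (rule tendsto_sum)
        fix i assume "i \<in> {..<N}"
        then have i: "i \<le> N" "Suc i \<le> N" by auto
        have "\<phi> (real i / real N) \<in> D"
          using \<phi>(2) K(2) grid_in_unit[OF i(1)] by blast
        then have "continuous_on UNIV (\<lambda>y. l (\<phi> (real i / real N)) y)"
          using l unfolding local_action_def
          by (intro continuous_on_compose2[of "D \<times> UNIV" "\<lambda>(x, y). l x y" UNIV "\<lambda>y. (\<phi> (real i / real N), y)", simplified])
             (auto intro!: continuous_intros)
        then show "(\<lambda>n. l (\<phi> (real i / real N)) (\<phi>n n (real (Suc i) / real N) - \<phi>n n (real i / real N)))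
            \<longlonglongrightarrow> l (\<phi> (real i / real N)) (\<phi> (real (Suc i) / real N) - \<phi> (real i / real N))"
          using grid_in_unit[OF i(1)] grid_in_unit[OF i(2)]
          by (intro continuous_on_tendsto_compose[where s = UNIV and f = "l (\<phi> (real i / real N))"]
                tendsto_diff pointwise) auto
      qed
      moreover have "(\<lambda>n. sn n + \<omega> * L) \<longlonglongrightarrow> c + \<omega> * L"
        by (intro tendsto_intros lim)
      moreover have "\<forall>\<^sub>F n in sequentially. (\<Sum>i<N. l (\<phi> (real i / real N))
          (\<phi>n n (real (Suc i) / real N) - \<phi>n n (real i / real N))) \<le> sn n + \<omega> * L"
        using conv[OF half_gt_zero[OF \<delta>(1)]] by eventually_elim (rule coarse[OF N])
      ultimately show ?thesis
        by (intro tendsto_le[OF sequentially_bot])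
    qed
    have "\<forall>\<^sub>F N in sequentially. L / real N < \<delta> / 2"
      using lim_const_over_n[of L] \<delta>(1) by (intro order_tendstoD) auto
    with eventually_gt_at_top[of 0] have "\<forall>\<^sub>F N in sequentially. action_sum l \<phi> N \<le> c + \<omega> * L"
      by eventually_elim (rule limit)
    then show ?thesis
      by (intro tendsto_upperbound[OF \<phi>(3)]) auto
  qed
  then have "s \<le> c + \<epsilon>" if "\<epsilon> > 0" for \<epsilon>
  proof -
    have "s \<le> c + \<epsilon> / (L + 1) * L"
      using \<open>\<And>\<omega>. \<omega> > 0 \<Longrightarrow> s \<le> c + \<omega> * L\<close>[of "\<epsilon> / (L + 1)"] that L by simp
    also have "\<epsilon> / (L + 1) * L \<le> \<epsilon>"
      using that L by (simp add: field_simps)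
    finally show ?thesis by simp
  qed
  then show ?thesis
    by (rule field_le_epsilon)
qed

section \<open>Length and decrease of a level function along curves of bounded action\<close>

text \<open>The drift estimate controls all directions except that of \<open>b x\<close>, and in that direction \<open>f' x\<close> is
  positive. Quantitatively, \<open>y\<close> is split into \<open>(|y| / |b x|) b x\<close> and a remainder \<open>z\<close>, whose square is
  \<open>2 |y| / |b x|\<close> times the drift expression \<open>q = |b x| |y| - \<langle>b x, y\<rangle>\<close>.\<close>

lemma drift_controls_length:
  fixes b :: "'a::euclidean_space \<Rightarrow> 'a" and f' :: "'a \<Rightarrow> 'a \<Rightarrow>\<^sub>L real" and l :: "'a \<Rightarrow> 'a \<Rightarrow> real"
  assumes V: "compact V" and cont: "continuous_on V b" "continuous_on V f'"
    and pos: "\<And>x. x \<in> V \<Longrightarrow> 0 < f' x (b x)"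
    and "0 < c" and drift: "\<And>x y. x \<in> V \<Longrightarrow> c * (norm (b x) * norm y - b x \<bullet> y) \<le> l x y"
  shows "\<exists>A>0. \<exists>B>0. \<forall>x\<in>V. \<forall>y. norm y \<le> A * l x y + B * f' x y"
proof (cases "V = {}")
  case False
  have "continuous_on V (\<lambda>x. f' x (b x))"
    using cont by (intro continuous_intros)
  then obtain x0 where x0: "x0 \<in> V" "\<And>x. x \<in> V \<Longrightarrow> f' x0 (b x0) \<le> f' x (b x)"
    using continuous_attains_inf[OF V False] by blast
  define m where "m = f' x0 (b x0)"
  have m: "0 < m" "\<And>x. x \<in> V \<Longrightarrow> m \<le> f' x (b x)"
    using pos x0 by (auto simp: m_def)
  obtain \<beta> where \<beta>: "0 < \<beta>" "\<And>x. x \<in> V \<Longrightarrow> norm (b x) \<le> \<beta>"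
    using compact_imp_bounded[OF compact_continuous_image[OF cont(1) V]] by (auto simp: bounded_pos)
  obtain G where G: "0 < G" "\<And>x. x \<in> V \<Longrightarrow> norm (f' x) \<le> G"
    using compact_imp_bounded[OF compact_continuous_image[OF cont(2) V]] by (auto simp: bounded_pos)
  define k where "k = m / \<beta>"
  have k: "0 < k" using m \<beta> by (simp add: k_def)
  define B where "B = 2 / k"
  define A where "A = 2 * G ^ 3 / (k\<^sup>2 * m * c)"
  have "norm y \<le> A * l x y + B * f' x y" if x: "x \<in> V" for x y
  proof (cases "y = 0")
    case True
    then show ?thesis
      using drift[OF x, of 0] A_def G k m \<open>0 < c\<close> by (simp add: blinfun.zero_right)
  next
    case False
    define q where "q = norm (b x) * norm y - b x \<bullet> y"
    have q: "0 \<le> q" using norm_cauchy_schwarz[of "b x" y] by (simp add: q_def)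
    have m_le: "m \<le> G * norm (b x)"
    proof -
      have "m \<le> norm (f' x (b x))" using m(2)[OF x] by simp
      also have "\<dots> \<le> norm (f' x) * norm (b x)" by (rule norm_blinfun)
      also have "\<dots> \<le> G * norm (b x)" using G(2)[OF x] by (intro mult_right_mono) auto
      finally show ?thesis .
    qed
    then have b0: "0 < norm (b x)" using m(1) by (cases "b x = 0") auto
    define z where "z = y - (norm y / norm (b x)) *\<^sub>R b x"
    have z2: "(norm z)\<^sup>2 = 2 * norm y * (q / norm (b x))"
    proof -
      have "(norm z)\<^sup>2 = y \<bullet> y - 2 * (norm y / norm (b x)) * (b x \<bullet> y) + (norm y / norm (b x))\<^sup>2 * (b x \<bullet> b x)"
        unfolding power2_norm_eq_inner z_def
        by (simp add: inner_diff_left inner_diff_right inner_commute power2_eq_square algebra_simps)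
      also have "y \<bullet> y = (norm y)\<^sup>2" by (simp add: power2_norm_eq_inner)
      also have "(norm y / norm (b x))\<^sup>2 * (b x \<bullet> b x) = (norm y)\<^sup>2"
        using b0 by (simp add: power2_norm_eq_inner[symmetric] power_divide)
      finally have "(norm z)\<^sup>2 = 2 * (norm y)\<^sup>2 - 2 * (norm y / norm (b x)) * (b x \<bullet> y)" by simp
      also have "\<dots> = 2 * norm y * (q / norm (b x))"
        using b0 by (simp add: q_def power2_eq_square field_simps)
      finally show ?thesis .
    qed
    have "G * norm z \<le> k / 2 * norm y + G\<^sup>2 / k * (q / norm (b x))"
    proof -
      \<comment> \<open>Young's inequality, with weights that leave half of the gain \<open>k |y|\<close>.\<close>
      have "0 \<le> (k * norm y - G * norm z)\<^sup>2" by simp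
      also have "\<dots> = k\<^sup>2 * (norm y)\<^sup>2 - 2 * k * norm y * (G * norm z) + G\<^sup>2 * (norm z)\<^sup>2"
        by (simp add: power2_eq_square algebra_simps)
      also have "\<dots> = (2 * k * norm y) * (k / 2 * norm y + G\<^sup>2 / k * (q / norm (b x)) - G * norm z)"
        unfolding z2 using k by (simp add: power2_eq_square field_simps)
      finally have prod: "0 \<le> (2 * k * norm y) * (k / 2 * norm y + G\<^sup>2 / k * (q / norm (b x)) - G * norm z)" .
      have "0 \<le> k / 2 * norm y + G\<^sup>2 / k * (q / norm (b x)) - G * norm z"
      proof (rule ccontr)
        assume "\<not> ?thesis"
        then have "(2 * k * norm y) * (k / 2 * norm y + G\<^sup>2 / k * (q / norm (b x)) - G * norm z) < 0"
          using k False by (intro mult_pos_neg) auto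
        then show False using prod by linarith
      qed
      then show ?thesis by simp
    qed
    moreover have "q / norm (b x) \<le> q * (G / m)"
    proof -
      have "1 / norm (b x) \<le> G / m"
        using m_le b0 m(1) by (simp add: field_simps)
      then have "q * (1 / norm (b x)) \<le> q * (G / m)" using q by (rule mult_left_mono)
      then show ?thesis by simp
    qed
    then have "G\<^sup>2 / k * (q / norm (b x)) \<le> G\<^sup>2 / k * (q * (G / m))"
      using k by (intro mult_left_mono) auto
    moreover have "k * norm y \<le> (norm y / norm (b x)) * f' x (b x)"
    proof -
      have "norm y * (m / \<beta>) \<le> norm y * (f' x (b x) / norm (b x))"
        using m(1) m(2)[OF x] \<beta>(2)[OF x] b0 by (intro mult_left_mono frac_le) auto
      then show ?thesis by (simp add: k_def mult.commute)
    qed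
    moreover have "- (G * norm z) \<le> f' x z"
    proof -
      have "\<bar>f' x z\<bar> \<le> norm (f' x) * norm z" using norm_blinfun[of "f' x" z] by simp
      also have "\<dots> \<le> G * norm z" using G(2)[OF x] by (intro mult_right_mono) auto
      finally show ?thesis by simp
    qed
    moreover have "f' x y = (norm y / norm (b x)) * f' x (b x) + f' x z"
      by (simp add: z_def blinfun.diff_right blinfun.scaleR_right)
    ultimately have "k / 2 * norm y \<le> f' x y + G\<^sup>2 / k * (q * (G / m))"
      by linarith
    then have "B * (k / 2 * norm y) \<le> B * (f' x y + G\<^sup>2 / k * (q * (G / m)))"
      using k by (intro mult_left_mono) (auto simp: B_def)
    then have "norm y \<le> B * f' x y + A * (c * q)"
      using k m \<open>0 < c\<close> by (simp add: B_def A_def power2_eq_square power3_eq_cube field_simps)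
    also have "A * (c * q) \<le> A * l x y"
      using drift[OF x, of y] G k m \<open>0 < c\<close> by (intro mult_left_mono) (auto simp: A_def q_def)
    finally show ?thesis by (simp add: algebra_simps)
  qed
  moreover have "0 < A" "0 < B"
    using G k m \<open>0 < c\<close> by (auto simp: A_def B_def)
  ultimately show ?thesis by blast
next
  case True
  then show ?thesis by (auto intro!: exI[of _ 1])
qed

lemma compact_Union_cball:
  fixes M :: "'a::euclidean_space set"
  assumes "compact M"
  shows "compact (\<Union>y\<in>M. cball y e)"
proof -
  have eq: "(\<Union>y\<in>M. cball y e) = {y + z |y z. y \<in> M \<and> z \<in> cball 0 e}"
  proof (intro set_eqI iffI)
    fix p assume "p \<in> (\<Union>y\<in>M. cball y e)"
    then obtain y where y: "y \<in> M" "dist y p \<le> e" by auto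
    then have "p = y + (p - y)" "p - y \<in> cball 0 e"
      by (auto simp: dist_norm norm_minus_commute)
    then show "p \<in> {y + z |y z. y \<in> M \<and> z \<in> cball 0 e}" using y(1) by blast
  next
    fix p assume "p \<in> {y + z |y z. y \<in> M \<and> z \<in> cball 0 e}"
    then obtain y z where "y \<in> M" "norm z \<le> e" "p = y + z" by auto
    then show "p \<in> (\<Union>y\<in>M. cball y e)" by (intro UN_I[of y]) (auto simp: dist_norm)
  qed
  show ?thesis
    unfolding eq using assms by (intro compact_sums compact_cball)
qed

lemma C1_uniformly_differentiable:
  fixes f :: "'a::euclidean_space \<Rightarrow> real" and f' :: "'a \<Rightarrow> 'a \<Rightarrow>\<^sub>L real"
  assumes "open U" "compact V" "V \<subseteq> U" and der: "\<And>x. x \<in> U \<Longrightarrow> (f has_derivative f' x) (at x)"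
    and cont: "continuous_on U f'" and "\<epsilon> > 0"
  obtains \<delta> where "\<delta> > 0"
    "\<And>p q. p \<in> V \<Longrightarrow> dist p q < \<delta> \<Longrightarrow> \<bar>f q - f p - f' p (q - p)\<bar> \<le> \<epsilon> * norm (q - p)"
proof -
  obtain e where e: "e > 0" "(\<Union>x\<in>V. cball x e) \<subseteq> U"
    using compact_subset_open_imp_cball_epsilon_subset[OF assms(2,1,3)] .
  define W where "W = (\<Union>p\<in>V. cball p e)"
  have "compact W"
    unfolding W_def using assms(2) by (rule compact_Union_cball)
  have W: "q \<in> W" if "p \<in> V" "dist p q \<le> e" for p q
    unfolding W_def using that by auto
  have "W \<subseteq> U"
    using e(2) by (simp add: W_def)
  then have "uniformly_continuous_on W f'"
    using \<open>compact W\<close> cont by (intro compact_uniformly_continuous) (auto elim: continuous_on_subset)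
  then obtain \<delta> where \<delta>: "\<delta> > 0" "\<And>p q. p \<in> W \<Longrightarrow> q \<in> W \<Longrightarrow> dist q p < \<delta> \<Longrightarrow> dist (f' q) (f' p) < \<epsilon>"
    using \<open>\<epsilon> > 0\<close> unfolding uniformly_continuous_on_def by metis
  show thesis
  proof (rule that[of "min \<delta> e"])
    fix p q assume p: "p \<in> V" and q: "dist p q < min \<delta> e"
    let ?S = "ball p (min \<delta> e)"
    have S: "?S \<subseteq> W" "p \<in> W"
      using W[OF p] e(1) by (auto simp: less_imp_le)
    have "norm (f q - f p - f' p (q - p)) \<le> norm (q - p) * \<epsilon>"
    proof (rule differentiable_bound_linearization[where S = "?S" and f' = "\<lambda>x. blinfun_apply (f' x)"])
      fix t :: real assume t: "t \<in> {0..1}"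
      have "norm (t *\<^sub>R (q - p)) \<le> norm (q - p)"
        using t by (simp add: mult_left_le_one_le)
      then show "p + t *\<^sub>R (q - p) \<in> ?S"
        using q by (simp add: dist_norm norm_minus_commute)
    next
      fix x assume x: "x \<in> ?S"
      show "(f has_derivative f' x) (at x within ?S)"
        using der x S \<open>W \<subseteq> U\<close> by (meson has_derivative_at_withinI subsetD)
      have "dist (f' x) (f' p) < \<epsilon>"
        using x S by (intro \<delta>(2)) (auto simp: dist_commute)
      then show "onorm (blinfun_apply (f' x) - blinfun_apply (f' p)) \<le> \<epsilon>"
        by (simp add: dist_norm norm_blinfun.rep_eq minus_blinfun.rep_eq fun_diff_def)
    qed (use \<delta> e in auto)
    then show "\<bar>f q - f p - f' p (q - p)\<bar> \<le> \<epsilon> * norm (q - p)"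
      by (simp add: mult.commute)
  qed (use \<delta> e in auto)
qed

text \<open>A Lipschitz curve \<open>\<phi>\<close> in \<open>D\<close> of action \<open>s\<close>, and a function \<open>f\<close>, continuously differentiable near
  the compact set \<open>V\<close>, such that on \<open>V\<close> the norm is controlled by the local action \<open>l\<close> and the
  derivative of \<open>f\<close>. The curve need not stay in \<open>V\<close>.\<close>

locale controlled_curve =
  fixes D U V :: "'a::euclidean_space set" and l :: "'a \<Rightarrow> 'a \<Rightarrow> real"
    and f :: "'a \<Rightarrow> real" and f' :: "'a \<Rightarrow> 'a \<Rightarrow>\<^sub>L real" and A B L s :: real and \<phi> :: "real \<Rightarrow> 'a"
  assumes l: "local_action D l" and U: "open U" "U \<subseteq> D" and V: "compact V" "V \<subseteq> U"
    and der: "\<And>x. x \<in> U \<Longrightarrow> (f has_derivative f' x) (at x)" and cont_f': "continuous_on U f'"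
    and A: "0 < A" and B: "0 < B" and control: "\<And>x y. x \<in> V \<Longrightarrow> norm y \<le> A * l x y + B * f' x y"
    and lip: "L-lipschitz_on {0..1} \<phi>" and in_D: "\<phi> ` {0..1} \<subseteq> D" and s: "action_sum l \<phi> \<longlonglongrightarrow> s"
begin

text \<open>The discrete form of \<open>length \<le> A S + B (f(end) - f(start))\<close>, uniformly for all parts of the curve
  between two grid points that stay in \<open>V\<close>. The action of the part is bounded by that of the
  whole curve.\<close>

lemma grid_control:
  assumes "\<epsilon> > 0"
  shows "\<forall>\<^sub>F N in sequentially. \<forall>i j. i \<le> j \<and> j \<le> N \<and> (\<forall>k\<in>{i..j}. \<phi> (real k / real N) \<in> V) \<longrightarrow>
    (\<Sum>k\<in>{i..<j}. norm (\<phi> (real (Suc k) / real N) - \<phi> (real k / real N))) \<le>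
      A * action_sum l \<phi> N + B * (f (\<phi> (real j / real N)) - f (\<phi> (real i / real N))) + \<epsilon>"
proof -
  have L: "0 \<le> L" using lip by (rule lipschitz_on_nonneg)
  define \<epsilon>' where "\<epsilon>' = \<epsilon> / (B * L + 1)"
  have BL: "0 < B * L + 1" using B L by (simp add: add_nonneg_pos)
  have \<epsilon>': "0 < \<epsilon>'" "B * \<epsilon>' * L \<le> \<epsilon>"
    using BL \<open>\<epsilon> > 0\<close> by (auto simp: \<epsilon>'_def divide_le_eq algebra_simps)
  obtain \<delta> where \<delta>: "\<delta> > 0"
    "\<And>p q. p \<in> V \<Longrightarrow> dist p q < \<delta> \<Longrightarrow> \<bar>f q - f p - f' p (q - p)\<bar> \<le> \<epsilon>' * norm (q - p)"
    using C1_uniformly_differentiable[OF U(1) V der cont_f' \<epsilon>'(1)] by blast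
  have "\<forall>\<^sub>F N in sequentially. L / real N < \<delta>"
    using lim_const_over_n[of L] \<delta>(1) by (intro order_tendstoD) auto
  then show ?thesis
    using eventually_gt_at_top[of 0]
  proof eventually_elim
    case (elim N)
    define p where "p k = \<phi> (real k / real N)" for k
    show ?case
      unfolding p_def[symmetric]
    proof (intro allI impI)
      fix i j assume ij: "i \<le> j \<and> j \<le> N \<and> (\<forall>k\<in>{i..j}. p k \<in> V)"
      have step: "norm (p (Suc k) - p k) \<le> A * l (p k) (p (Suc k) - p k) + B * (f (p (Suc k)) - f (p k)) + B * \<epsilon>' * (L / real N)"
        if k: "k \<in> {i..<j}" for k
      proof -
        have pk: "p k \<in> V" using ij k by auto
        have n: "norm (p (Suc k) - p k) \<le> L / real N"
          unfolding p_def using k ij by (intro grid_step[OF lip]) auto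
        then have "dist (p k) (p (Suc k)) < \<delta>"
          using elim by (simp add: dist_norm norm_minus_commute)
        then have "f' (p k) (p (Suc k) - p k) \<le> f (p (Suc k)) - f (p k) + \<epsilon>' * norm (p (Suc k) - p k)"
          using \<delta>(2)[OF pk, of "p (Suc k)"] by simp
        also have "\<dots> \<le> f (p (Suc k)) - f (p k) + \<epsilon>' * (L / real N)"
          using n \<epsilon>'(1) by (intro add_left_mono mult_left_mono) auto
        finally have "B * f' (p k) (p (Suc k) - p k) \<le> B * (f (p (Suc k)) - f (p k) + \<epsilon>' * (L / real N))"
          using B by simp
        then show ?thesis
          using control[OF pk, of "p (Suc k) - p k"] by (simp add: algebra_simps)
      qed
      have "(\<Sum>k\<in>{i..<j}. norm (p (Suc k) - p k)) \<le>
          (\<Sum>k\<in>{i..<j}. A * l (p k) (p (Suc k) - p k) + B * (f (p (Suc k)) - f (p k)) + B * \<epsilon>' * (L / real N))"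
        using step by (rule sum_mono)
      also have "\<dots> = A * (\<Sum>k\<in>{i..<j}. l (p k) (p (Suc k) - p k)) + B * (f (p j) - f (p i)) + real (j - i) * (B * \<epsilon>' * (L / real N))"
        using sum_Suc_diff'[of i j "\<lambda>k. f (p k)"] ij
        by (simp add: sum.distrib sum_distrib_left[symmetric])
      also have "(\<Sum>k\<in>{i..<j}. l (p k) (p (Suc k) - p k)) \<le> action_sum l \<phi> N"
        unfolding action_sum_def p_def
      proof (rule sum_mono2)
        fix k assume "k \<in> {..<N} - {i..<j}"
        then have "\<phi> (real k / real N) \<in> D"
          using in_D grid_in_unit[of k N] by auto
        then show "0 \<le> l (\<phi> (real k / real N)) (\<phi> (real (Suc k) / real N) - \<phi> (real k / real N))"
          by (rule local_action_nonneg[OF l])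
      qed (use ij in auto)
      also have "real (j - i) * (B * \<epsilon>' * (L / real N)) \<le> real N * (B * \<epsilon>' * (L / real N))"
        using ij B \<epsilon>'(1) L by (intro mult_right_mono) auto
      also have "\<dots> \<le> \<epsilon>"
        using \<epsilon>'(2) elim by simp
      finally show "(\<Sum>k\<in>{i..<j}. norm (p (Suc k) - p k)) \<le> A * action_sum l \<phi> N + B * (f (p j) - f (p i)) + \<epsilon>"
        using A by simp
    qed
  qed
qed

lemma decrease_costs_action:
  assumes st: "0 \<le> t\<^sub>1" "t\<^sub>1 < t\<^sub>2" "t\<^sub>2 \<le> 1" and in_V: "\<phi> ` {t\<^sub>1..t\<^sub>2} \<subseteq> V"
  shows "B * (f (\<phi> t\<^sub>1) - f (\<phi> t\<^sub>2)) \<le> A * s"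
proof (rule field_le_epsilon)
  fix \<epsilon> :: real assume "\<epsilon> > 0"
  \<comment> \<open>The first and the last grid point within \<open>[t\<^sub>1, t\<^sub>2]\<close>.\<close>
  define i j where "i N = nat \<lceil>real N * t\<^sub>1\<rceil>" and "j N = nat \<lfloor>real N * t\<^sub>2\<rfloor>" for N :: nat
  have i: "real N * t\<^sub>1 \<le> real (i N)" "real (i N) \<le> real N * t\<^sub>1 + 1" for N
  proof -
    have "0 \<le> real N * t\<^sub>1" using st by simp
    then show "real N * t\<^sub>1 \<le> real (i N)" "real (i N) \<le> real N * t\<^sub>1 + 1"
      unfolding i_def by linarith+
  qed
  have j: "real (j N) \<le> real N * t\<^sub>2" "real N * t\<^sub>2 \<le> real (j N) + 1" for N
  proof -
    have "0 \<le> real N * t\<^sub>2" using st by simp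
    then show "real (j N) \<le> real N * t\<^sub>2" "real N * t\<^sub>2 \<le> real (j N) + 1"
      unfolding j_def by linarith+
  qed
  have lim_N: "(\<lambda>N. t + 1 / real N) \<longlonglongrightarrow> t" "(\<lambda>N. t - 1 / real N) \<longlonglongrightarrow> t" for t
    using tendsto_add[OF tendsto_const lim_1_over_n, of t] tendsto_diff[OF tendsto_const lim_1_over_n, of t]
    by simp_all
  have ev: "\<forall>\<^sub>F N in sequentially. t\<^sub>1 \<le> real (i N) / real N \<and> real (i N) / real N \<le> t\<^sub>1 + 1 / real N \<and>
      t\<^sub>2 - 1 / real N \<le> real (j N) / real N \<and> real (j N) / real N \<le> t\<^sub>2"
    using eventually_gt_at_top[of 0]
  proof eventually_elim
    case (elim N)
    have "t\<^sub>1 \<le> real (i N) / real N" "real (i N) / real N \<le> (real N * t\<^sub>1 + 1) / real N"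
      "(real N * t\<^sub>2 - 1) / real N \<le> real (j N) / real N" "real (j N) / real N \<le> t\<^sub>2"
      using i[of N] j[of N] elim by (auto simp: le_divide_eq divide_le_eq mult.commute intro!: divide_right_mono)
    then show ?case
      using elim by (simp add: add_divide_distrib diff_divide_distrib)
  qed
  have lim_i: "(\<lambda>N. real (i N) / real N) \<longlonglongrightarrow> t\<^sub>1"
    by (rule tendsto_sandwich[OF _ _ tendsto_const lim_N(1)]) (use ev in \<open>auto elim: eventually_mono\<close>)
  have lim_j: "(\<lambda>N. real (j N) / real N) \<longlonglongrightarrow> t\<^sub>2"
    by (rule tendsto_sandwich[OF _ _ lim_N(2) tendsto_const]) (use ev in \<open>auto elim: eventually_mono\<close>)
  define \<mu> where "\<mu> = (t\<^sub>1 + t\<^sub>2) / 2"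
  have "\<forall>\<^sub>F N in sequentially. real (i N) / real N < \<mu>" "\<forall>\<^sub>F N in sequentially. \<mu> < real (j N) / real N"
    using order_tendstoD[OF lim_i, of \<mu>] order_tendstoD[OF lim_j, of \<mu>] st by (auto simp: \<mu>_def)
  then have ev': "\<forall>\<^sub>F N in sequentially. i N \<le> j N \<and> j N \<le> N \<and> real (i N) / real N \<in> {t\<^sub>1..t\<^sub>2} \<and>
      real (j N) / real N \<in> {t\<^sub>1..t\<^sub>2} \<and> (\<forall>k\<in>{i N..j N}. \<phi> (real k / real N) \<in> V)"
    using ev eventually_gt_at_top[of 0]
  proof eventually_elim
    case (elim N)
    have "real (i N) / real N < real (j N) / real N" using elim by simp
    then have ij: "i N \<le> j N" using elim by (simp add: divide_less_cancel)
    have "real (j N) / real N \<le> 1" using elim st by linarith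
    then have jN: "j N \<le> N" using elim by (simp add: divide_le_eq)
    have "\<phi> (real k / real N) \<in> V" if "k \<in> {i N..j N}" for k
    proof -
      have "real (i N) / real N \<le> real k / real N" "real k / real N \<le> real (j N) / real N"
        using that by (auto intro!: divide_right_mono)
      then have "real k / real N \<in> {t\<^sub>1..t\<^sub>2}" using elim by simp
      then show ?thesis using in_V by blast
    qed
    then show ?case using ij jN elim by auto
  qed
  have "continuous_on V f"
    using der V(2) by (meson continuous_at_imp_continuous_on has_derivative_continuous subsetD)
  moreover have "continuous_on {t\<^sub>1..t\<^sub>2} \<phi>"
    using lipschitz_on_continuous_on[OF lip] st by (auto elim: continuous_on_subset)
  ultimately have cont: "continuous_on {t\<^sub>1..t\<^sub>2} (\<lambda>t. f (\<phi> t))"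
    by (rule continuous_on_compose2) (use in_V in auto)
  have "(\<lambda>N. f (\<phi> (real (i N) / real N))) \<longlonglongrightarrow> f (\<phi> t\<^sub>1)"
    using st ev' by (intro continuous_on_tendsto_compose[OF cont lim_i]) (auto elim: eventually_mono)
  moreover have "(\<lambda>N. f (\<phi> (real (j N) / real N))) \<longlonglongrightarrow> f (\<phi> t\<^sub>2)"
    using st ev' by (intro continuous_on_tendsto_compose[OF cont lim_j]) (auto elim: eventually_mono)
  ultimately have "(\<lambda>N. B * (f (\<phi> (real (i N) / real N)) - f (\<phi> (real (j N) / real N)))) \<longlonglongrightarrow> B * (f (\<phi> t\<^sub>1) - f (\<phi> t\<^sub>2))"
    by (intro tendsto_intros)
  moreover have "(\<lambda>N. A * action_sum l \<phi> N + \<epsilon>) \<longlonglongrightarrow> A * s + \<epsilon>"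
    by (intro tendsto_intros s)
  moreover have "\<forall>\<^sub>F N in sequentially.
      B * (f (\<phi> (real (i N) / real N)) - f (\<phi> (real (j N) / real N))) \<le> A * action_sum l \<phi> N + \<epsilon>"
    using grid_control[OF \<open>\<epsilon> > 0\<close>] ev'
  proof eventually_elim
    case (elim N)
    have "0 \<le> (\<Sum>k\<in>{i N..<j N}. norm (\<phi> (real (Suc k) / real N) - \<phi> (real k / real N)))"
      by (intro sum_nonneg) auto
    also have "\<dots> \<le> A * action_sum l \<phi> N + B * (f (\<phi> (real (j N) / real N)) - f (\<phi> (real (i N) / real N))) + \<epsilon>"
      using elim by blast
    finally show ?case by (simp add: algebra_simps)
  qed
  ultimately show "B * (f (\<phi> t\<^sub>1) - f (\<phi> t\<^sub>2)) \<le> A * s + \<epsilon>"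
    by (intro tendsto_le[OF sequentially_bot])
qed

lemma grid_length_bound:
  assumes in_V: "\<phi> ` {0..1} \<subseteq> V" and "0 < N"
  shows "(\<Sum>k<N. norm (\<phi> (real (Suc k) / real N) - \<phi> (real k / real N))) \<le> A * s + B * (f (\<phi> 1) - f (\<phi> 0))"
proof (rule field_le_epsilon)
  fix \<epsilon> :: real assume "\<epsilon> > 0"
  define \<Sigma> where "\<Sigma> N = (\<Sum>k<N. norm (\<phi> (real (Suc k) / real N) - \<phi> (real k / real N)))" for N
  \<comment> \<open>The sums increase under refinement, so the asymptotic bound holds for every \<open>N\<close>.\<close>
  have refine: "\<Sigma> N \<le> \<Sigma> (N * k)" if k: "0 < k" for k
  proof -
    let ?M = "N * k"
    define p where "p j = \<phi> (real j / real ?M)" for j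
    have coarse: "\<phi> (real i / real N) = p (i * k)" for i
      using k by (simp add: p_def)
    have "\<Sigma> N \<le> (\<Sum>i<N. \<Sum>j\<in>{i * k..<Suc i * k}. norm (p (Suc j) - p j))"
      unfolding \<Sigma>_def coarse
    proof (rule sum_mono)
      fix i
      have "p (Suc i * k) - p (i * k) = (\<Sum>j\<in>{i * k..<Suc i * k}. p (Suc j) - p j)"
        using sum_Suc_diff'[of "i * k" "Suc i * k" p] by simp
      then show "norm (p (Suc i * k) - p (i * k)) \<le> (\<Sum>j\<in>{i * k..<Suc i * k}. norm (p (Suc j) - p j))"
        by (simp add: norm_sum)
    qed
    also have "\<dots> = \<Sigma> ?M"
      using sum.nat_group[of "\<lambda>j. norm (p (Suc j) - p j)" k N]
      by (simp add: add.commute mult.commute \<Sigma>_def p_def)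
    finally show ?thesis .
  qed
  have "\<forall>\<^sub>F N in sequentially. \<Sigma> N \<le> A * action_sum l \<phi> N + B * (f (\<phi> 1) - f (\<phi> 0)) + \<epsilon>"
    using grid_control[OF \<open>\<epsilon> > 0\<close>] eventually_gt_at_top[of 0]
  proof eventually_elim
    case (elim N)
    have "\<forall>k\<in>{0..N}. \<phi> (real k / real N) \<in> V"
      using in_V grid_in_unit[of _ N] by auto
    then have "(\<Sum>k\<in>{0..<N}. norm (\<phi> (real (Suc k) / real N) - \<phi> (real k / real N))) \<le>
      A * action_sum l \<phi> N + B * (f (\<phi> (real N / real N)) - f (\<phi> (real 0 / real N))) + \<epsilon>"
      using elim(1) by blast
    then show ?case
      using elim(2) by (simp add: \<Sigma>_def atLeast0LessThan)
  qed
  moreover have sub: "filterlim (\<lambda>k. N * k) sequentially sequentially"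
    using \<open>0 < N\<close> by (intro filterlim_subseq strict_monoI) auto
  ultimately have "\<forall>\<^sub>F k in sequentially. \<Sigma> (N * k) \<le> A * action_sum l \<phi> (N * k) + B * (f (\<phi> 1) - f (\<phi> 0)) + \<epsilon>"
    by (rule eventually_compose_filterlim)
  then have "\<forall>\<^sub>F k in sequentially. \<Sigma> N \<le> A * action_sum l \<phi> (N * k) + B * (f (\<phi> 1) - f (\<phi> 0)) + \<epsilon>"
    using eventually_gt_at_top[of 0] 
  proof eventually_elim
    case (elim k)
    then show ?case
      using refine[of k] by linarith
  qed
  moreover have "(\<lambda>k. A * action_sum l \<phi> (N * k) + B * (f (\<phi> 1) - f (\<phi> 0)) + \<epsilon>) \<longlonglongrightarrow>
      A * s + B * (f (\<phi> 1) - f (\<phi> 0)) + \<epsilon>"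
    by (intro tendsto_intros filterlim_compose[OF s sub])
  ultimately have "\<Sigma> N \<le> A * s + B * (f (\<phi> 1) - f (\<phi> 0)) + \<epsilon>"
    by (intro tendsto_lowerbound) auto
  then show "(\<Sum>k<N. norm (\<phi> (real (Suc k) / real N) - \<phi> (real k / real N))) \<le>
      A * s + B * (f (\<phi> 1) - f (\<phi> 0)) + \<epsilon>"
    by (simp add: \<Sigma>_def)
qed

end

section \<open>Transport of admissible manifolds along the flow\<close>

lemma C1_locally_lipschitz:
  fixes b :: "'a::euclidean_space \<Rightarrow> 'b::euclidean_space"
  assumes "open D" "C1_on D b" "p \<in> D"
  obtains \<rho> \<Lambda> where "\<rho> > 0" "\<Lambda> \<ge> 0" "cball p \<rho> \<subseteq> D"
    "\<And>x y. x \<in> cball p \<rho> \<Longrightarrow> y \<in> cball p \<rho> \<Longrightarrow> norm (b x - b y) \<le> \<Lambda> * norm (x - y)"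
proof -
  obtain b' where b': "\<And>x. x \<in> D \<Longrightarrow> (b has_derivative blinfun_apply (b' x)) (at x)" "continuous_on D b'"
    using assms(2) unfolding C1_on_def by blast
  obtain \<rho> where \<rho>: "\<rho> > 0" "cball p \<rho> \<subseteq> D"
    using assms(1,3) open_contains_cball by blast
  have "compact (b' ` cball p \<rho>)"
    using b'(2) \<rho>(2) by (intro compact_continuous_image) (auto elim: continuous_on_subset)
  then obtain \<Lambda> where \<Lambda>: "\<Lambda> > 0" "\<And>x. x \<in> cball p \<rho> \<Longrightarrow> norm (b' x) \<le> \<Lambda>"
    by (auto dest!: compact_imp_bounded simp: bounded_pos)
  show thesis
  proof (rule that[OF \<rho>(1) less_imp_le[OF \<Lambda>(1)] \<rho>(2)])
    show "norm (b x - b y) \<le> \<Lambda> * norm (x - y)" if "x \<in> cball p \<rho>" "y \<in> cball p \<rho>" for x y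
    proof (rule differentiable_bound[OF convex_cball _ _ that, where f' = "\<lambda>x. blinfun_apply (b' x)"])
      show "(b has_derivative blinfun_apply (b' x)) (at x within cball p \<rho>)" if "x \<in> cball p \<rho>" for x
        using b'(1) \<rho>(2) that by (meson has_derivative_at_withinI subsetD)
      show "onorm (blinfun_apply (b' x)) \<le> \<Lambda>" if "x \<in> cball p \<rho>" for x
        using \<Lambda>(2)[OF that] by (simp add: norm_blinfun.rep_eq)
    qed
  qed
qed

lemma autonomous_ode_unique:
  fixes b :: "'a::euclidean_space \<Rightarrow> 'a"
  assumes "open D" "C1_on D b"
    and u: "\<And>t. u t \<in> D" "\<And>t. (u has_vector_derivative b (u t)) (at t)"
    and v: "\<And>t. v t \<in> D" "\<And>t. (v has_vector_derivative b (v t)) (at t)"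
    and "u 0 = v 0"
  shows "u t = v t"
proof -
  have cont: "continuous_on UNIV u" "continuous_on UNIV v"
    using u(2) v(2) by (auto intro!: continuous_at_imp_continuous_on has_vector_derivative_continuous)
  define Z where "Z = {t. u t = v t}"
  have "closed Z"
    unfolding Z_def using cont by (intro closed_Collect_eq)
  moreover have "open Z"
    unfolding open_contains_cball
  proof
    fix t0 assume "t0 \<in> Z"
    then have eq: "u t0 = v t0" by (simp add: Z_def)
    obtain \<rho> \<Lambda> where \<rho>: "\<rho> > 0" "\<Lambda> \<ge> 0"
      "\<And>x y. x \<in> cball (u t0) \<rho> \<Longrightarrow> y \<in> cball (u t0) \<rho> \<Longrightarrow> norm (b x - b y) \<le> \<Lambda> * norm (x - y)"
      using C1_locally_lipschitz[OF assms(1,2) u(1)[of t0]] by metis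
    have "\<forall>\<^sub>F t in at t0. dist (u t) (u t0) < \<rho>" "\<forall>\<^sub>F t in at t0. dist (v t) (v t0) < \<rho>"
      using cont \<rho>(1) by (auto simp: continuous_on_eq_continuous_at isCont_def intro: tendstoD)
    then have "\<forall>\<^sub>F t in at t0. dist (u t) (u t0) < \<rho> \<and> dist (v t) (v t0) < \<rho>"
      by eventually_elim simp
    then obtain d where d: "d > 0" "\<And>t. t \<noteq> t0 \<Longrightarrow> dist t t0 < d \<Longrightarrow> dist (u t) (u t0) < \<rho> \<and> dist (v t) (v t0) < \<rho>"
      unfolding eventually_at by auto
    define \<delta> where "\<delta> = min (d / 2) (1 / (2 * (\<Lambda> + 1)))"
    have \<delta>: "\<delta> > 0" "\<delta> < d" "\<Lambda> * \<delta> \<le> 1 / 2"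
    proof -
      show "\<delta> > 0" "\<delta> < d" using d(1) \<rho>(2) by (auto simp: \<delta>_def)
      have "\<Lambda> * \<delta> \<le> \<Lambda> * (1 / (2 * (\<Lambda> + 1)))"
        using \<rho>(2) by (intro mult_left_mono) (auto simp: \<delta>_def)
      also have "\<dots> \<le> 1 / 2" using \<rho>(2) by (simp add: field_simps)
      finally show "\<Lambda> * \<delta> \<le> 1 / 2" .
    qed
    have near: "u t \<in> cball (u t0) \<rho>" "v t \<in> cball (u t0) \<rho>" if "t \<in> cball t0 \<delta>" for t
      using d(2)[of t] that \<delta>(2) eq \<rho>(1) by (cases "t = t0"; force simp: dist_commute)+
    have "continuous_on (cball t0 \<delta>) (\<lambda>t. norm (u t - v t))"
      using cont by (auto intro!: continuous_intros elim: continuous_on_subset)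
    then obtain \<tau> where \<tau>: "\<tau> \<in> cball t0 \<delta>" "\<And>t. t \<in> cball t0 \<delta> \<Longrightarrow> norm (u t - v t) \<le> norm (u \<tau> - v \<tau>)"
      using continuous_attains_sup[of "cball t0 \<delta>" "\<lambda>t. norm (u t - v t)"] \<delta>(1) by auto
    \<comment> \<open>On this interval the maximal distance \<open>m\<close> of the solutions is at most \<open>m / 2\<close>.\<close>
    define m where "m = norm (u \<tau> - v \<tau>)"
    have "norm ((u \<tau> - v \<tau>) - (u t0 - v t0)) \<le> \<Lambda> * m * norm (\<tau> - t0)"
    proof (rule differentiable_bound[OF convex_cball[of t0 \<delta>], where f' = "\<lambda>t h. h *\<^sub>R (b (u t) - b (v t))"])
      fix t assume t: "t \<in> cball t0 \<delta>"
      have "((\<lambda>t. u t - v t) has_vector_derivative b (u t) - b (v t)) (at t)"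
        by (intro has_vector_derivative_diff u v)
      then show "((\<lambda>t. u t - v t) has_derivative (\<lambda>h. h *\<^sub>R (b (u t) - b (v t)))) (at t within cball t0 \<delta>)"
        unfolding has_vector_derivative_def by (rule has_derivative_at_withinI)
      have "norm (b (u t) - b (v t)) \<le> \<Lambda> * norm (u t - v t)"
        using near[OF t] by (rule \<rho>(3))
      also have "\<dots> \<le> \<Lambda> * m"
        unfolding m_def using \<tau>(2)[OF t] \<rho>(2) by (rule mult_left_mono)
      finally have "norm (h *\<^sub>R (b (u t) - b (v t))) \<le> \<Lambda> * m * norm h" for h :: real
        by (simp add: mult.commute mult_left_mono)
      then show "onorm (\<lambda>h. h *\<^sub>R (b (u t) - b (v t))) \<le> \<Lambda> * m"
        by (rule onorm_le)
    qed (use \<tau>(1) \<delta>(1) in auto)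
    also have "\<dots> \<le> \<Lambda> * m * \<delta>"
      using \<tau>(1) \<rho>(2) by (intro mult_left_mono) (auto simp: dist_real_def m_def)
    also have "\<dots> \<le> m / 2"
      using mult_right_mono[OF \<delta>(3), of m] by (simp add: m_def algebra_simps)
    finally have "m \<le> 0" by (simp add: eq m_def)
    then have "cball t0 \<delta> \<subseteq> Z"
      using \<tau>(2) unfolding Z_def m_def by (force simp: subset_iff)
    then show "\<exists>e>0. cball t0 e \<subseteq> Z" using \<delta>(1) by blast
  qed
  ultimately have "Z = UNIV"
    using clopen[of Z] \<open>u 0 = v 0\<close> unfolding Z_def by blast
  then show ?thesis by (auto simp: Z_def)
qed

lemma flow_add:
  assumes "open D" "C1_on D b" and \<psi>: "is_flow D b \<psi>" and "x \<in> D"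
  shows "\<psi> (\<psi> (x, s), t) = \<psi> (x, s + t)"
proof (rule autonomous_ode_unique[OF assms(1,2), of "\<lambda>t. \<psi> (\<psi> (x, s), t)" "\<lambda>t. \<psi> (x, s + t)"])
  have in_D: "\<psi> (y, t) \<in> D" and der: "((\<lambda>t. \<psi> (y, t)) has_vector_derivative b (\<psi> (y, t))) (at t)"
    and zero: "\<psi> (y, 0) = y" if "y \<in> D" for y t
    using \<psi> that unfolding is_flow_def by auto
  show "\<psi> (\<psi> (x, s), t) \<in> D" "\<psi> (x, s + t) \<in> D" for t
    using in_D \<open>x \<in> D\<close> by auto
  show "((\<lambda>t. \<psi> (\<psi> (x, s), t)) has_vector_derivative b (\<psi> (\<psi> (x, s), t))) (at t)" for t
    using der in_D \<open>x \<in> D\<close> by auto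
  show "((\<lambda>t. \<psi> (x, s + t)) has_vector_derivative b (\<psi> (x, s + t))) (at t)" for t
  proof -
    have "((\<lambda>t. s + t) has_vector_derivative 0 + 1) (at t)"
      by (intro has_vector_derivative_add has_vector_derivative_const has_vector_derivative_id)
    then show ?thesis
      using vector_diff_chain_at[of "\<lambda>t. s + t" 1 t "\<lambda>t. \<psi> (x, t)"] der[OF \<open>x \<in> D\<close>, of "s + t"]
      by (simp add: o_def)
  qed
  show "\<psi> (\<psi> (x, s), 0) = \<psi> (x, s + 0)"
    using zero in_D \<open>x \<in> D\<close> by simp
qed

lemma C1_on_continuous_on: "C1_on U f \<Longrightarrow> continuous_on U f"
  unfolding C1_on_def by (meson continuous_at_imp_continuous_on has_derivative_continuous)

text \<open>If \<open>f\<close> defines \<open>M\<close> then \<open>g y = f (\<psi> (y, - t))\<close> defines \<open>\<psi>(M, t)\<close>, so every point of \<open>\<psi>(M, \<real>)\<close> lies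
  on the zero set of such a function. Instead of the gradient of \<open>g\<close>, its derivative \<open>g'\<close> as a
  bounded linear functional is used.\<close>

lemma admissible_manifold_through:
  fixes D :: "'a::euclidean_space set"
  assumes "open D" "C1_on D b" and \<psi>: "is_flow D b \<psi>" and M: "admissible_manifold D b M"
    and x: "x \<in> \<psi> ` (M \<times> UNIV)"
  obtains g g' U where "continuous_on D (g :: 'a \<Rightarrow> real)" "compact {y \<in> D. g y = 0}"
    "open U" "{y \<in> D. g y = 0} \<subseteq> U" "U \<subseteq> D"
    "\<And>y. y \<in> U \<Longrightarrow> (g has_derivative blinfun_apply (g' y)) (at y)" "continuous_on U g'"
    "\<And>y. y \<in> D \<Longrightarrow> g y = 0 \<Longrightarrow> 0 < g' y (b y)" "x \<in> D" "g x = 0"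
proof -
  obtain f U where f: "continuous_on D f" "M = {x \<in> D. f x = 0}" "compact M" "open U" "M \<subseteq> U" "U \<subseteq> D"
      "C1_on U f" "\<And>x. x \<in> M \<Longrightarrow> \<exists>g. GDERIV f x :> g \<and> g \<bullet> b x > (0::real)"
    using M unfolding admissible_manifold_def by blast
  obtain f' where f': "\<And>x. x \<in> U \<Longrightarrow> (f has_derivative blinfun_apply (f' x)) (at x)" "continuous_on U f'"
    using f(7) unfolding C1_on_def by blast
  obtain w t0 where w: "w \<in> M" "x = \<psi> (w, t0)"
    using x by auto
  have C1: "C1_on (D \<times> UNIV) \<psi>" and in_D: "\<And>y t. y \<in> D \<Longrightarrow> \<psi> (y, t) \<in> D"
    and \<psi>0: "\<And>y. y \<in> D \<Longrightarrow> \<psi> (y, 0) = y"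
    and der: "\<And>y t. y \<in> D \<Longrightarrow> ((\<lambda>t. \<psi> (y, t)) has_vector_derivative b (\<psi> (y, t))) (at t)"
    using \<psi> unfolding is_flow_def by auto
  obtain \<psi>' where \<psi>': "\<And>p. p \<in> D \<times> UNIV \<Longrightarrow> (\<psi> has_derivative blinfun_apply (\<psi>' p)) (at p)"
    "continuous_on (D \<times> UNIV) \<psi>'"
    using C1 unfolding C1_on_def by blast
  have add: "\<psi> (\<psi> (y, s), t) = \<psi> (y, s + t)" if "y \<in> D" for y s t
    using flow_add[OF assms(1,2) \<psi> that] .
  define h where "h y = \<psi> (y, - t0)" for y
  have cont_\<psi>: "continuous_on D (\<lambda>y. \<psi> (y, t))" for t
    by (rule continuous_on_compose2[OF C1_on_continuous_on[OF C1]]) (auto intro!: continuous_intros)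
  then have cont_h: "continuous_on D h"
    unfolding h_def .
  have h_D: "h y \<in> D" if "y \<in> D" for y
    using in_D[OF that] by (simp add: h_def)
  have h_inv: "h (\<psi> (y, t0)) = y" "\<psi> (h y, t0) = y" if "y \<in> D" for y
    using add[OF that] \<psi>0[OF that] by (simp_all add: h_def)
  define g where "g y = f (h y)" for y
  define U' where "U' = D \<inter> h -` U"
  define j where "j = Blinfun (\<lambda>v :: 'a. (v, 0 :: real))"
  have j: "blinfun_apply j = (\<lambda>v. (v, 0))"
    unfolding j_def by (intro bounded_linear_Blinfun_apply bounded_linear_intros)
  define g' where "g' y = f' (h y) o\<^sub>L (\<psi>' (y, - t0) o\<^sub>L j)" for y
  have g_der: "(g has_derivative blinfun_apply (g' y)) (at y)" if "y \<in> U'" for y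
  proof -
    have "((\<lambda>y. (y, - t0)) has_derivative (\<lambda>v. (v, 0))) (at y)"
      by (auto intro!: derivative_eq_intros)
    moreover have "(\<psi> has_derivative blinfun_apply (\<psi>' (y, - t0))) (at (y, - t0))"
      using that by (intro \<psi>'(1)) (auto simp: U'_def)
    ultimately have "(h has_derivative (\<lambda>v. \<psi>' (y, - t0) (v, 0))) (at y)"
      unfolding h_def by (rule has_derivative_compose)
    moreover have "(f has_derivative blinfun_apply (f' (h y))) (at (h y))"
      using that by (intro f'(1)) (auto simp: U'_def)
    ultimately have "((\<lambda>y. f (h y)) has_derivative (\<lambda>v. f' (h y) (\<psi>' (y, - t0) (v, 0)))) (at y)"
      by (rule has_derivative_compose)
    then show ?thesis
      by (simp add: g_def[abs_def] g'_def j blinfun_compose.rep_eq o_def)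
  qed
  have M': "{y \<in> D. g y = 0} = (\<lambda>y. \<psi> (y, t0)) ` M"
  proof
    show "{y \<in> D. g y = 0} \<subseteq> (\<lambda>y. \<psi> (y, t0)) ` M"
    proof
      fix y assume "y \<in> {y \<in> D. g y = 0}"
      then have "h y \<in> M" "y = \<psi> (h y, t0)"
        using h_D h_inv by (auto simp: g_def f(2))
      then show "y \<in> (\<lambda>y. \<psi> (y, t0)) ` M" by blast
    qed
    show "(\<lambda>y. \<psi> (y, t0)) ` M \<subseteq> {y \<in> D. g y = 0}"
      using in_D h_inv by (auto simp: g_def f(2))
  qed
  show thesis
  proof (rule that[of g U' g'])
    show "continuous_on D g"
      unfolding g_def by (rule continuous_on_compose2[OF f(1) cont_h]) (use h_D in auto)
    show "compact {y \<in> D. g y = 0}"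
      unfolding M' using f(2,3) by (intro compact_continuous_image continuous_on_subset[OF cont_\<psi>]) auto
    show "open U'"
      unfolding U'_def using cont_h assms(1) f(4) by (rule continuous_open_preimage)
    show "{y \<in> D. g y = 0} \<subseteq> U'"
      using h_D f(2,5) by (auto simp: U'_def g_def)
    then have U'_zero: "y \<in> U'" if "y \<in> D" "g y = 0" for y
      using that by blast
    show "U' \<subseteq> D" by (auto simp: U'_def)
    show "(g has_derivative blinfun_apply (g' y)) (at y)" if "y \<in> U'" for y
      using that by (rule g_der)
    have "continuous_on U' (\<lambda>y. f' (h y))"
      by (rule continuous_on_compose2[OF f'(2)]) (auto simp: U'_def intro: continuous_on_subset[OF cont_h])
    moreover have "continuous_on U' (\<lambda>y. \<psi>' (y, - t0))"
      by (rule continuous_on_compose2[OF \<psi>'(2)]) (auto simp: U'_def intro!: continuous_intros)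
    ultimately show "continuous_on U' g'"
      unfolding g'_def
      by (intro bounded_bilinear.continuous_on[OF bounded_bilinear_blinfun_compose] continuous_on_const)
    show "0 < g' y (b y)" if y: "y \<in> D" "g y = 0" for y
    proof -
      define z where "z = h y"
      have z: "z \<in> M" "z \<in> D"
        using y h_D by (auto simp: z_def g_def f(2))
      \<comment> \<open>The derivative of \<open>g\<close> along the orbit of \<open>y\<close> is that of \<open>f\<close> along the orbit of \<open>z\<close>.\<close>
      have orbit: "g (\<psi> (y, s)) = f (\<psi> (z, s))" for s
        using add[OF y(1)] by (simp add: g_def h_def z_def add.commute)
      have "((\<lambda>s. g (\<psi> (y, s))) has_vector_derivative g' y (b y)) (at 0)"
        using vector_derivative_diff_chain_within[of "\<lambda>s. \<psi> (y, s)" "b y" 0 UNIV g "g' y"]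
          der[OF y(1), of 0] g_der[OF U'_zero[OF y]] \<psi>0[OF y(1)]
        by (simp add: o_def has_derivative_at_withinI)
      moreover obtain v where v: "GDERIV f z :> v" "v \<bullet> b z > 0"
        using f(8)[OF z(1)] by blast
      have "((\<lambda>s. f (\<psi> (z, s))) has_vector_derivative b z \<bullet> v) (at 0)"
        using vector_derivative_diff_chain_within[of "\<lambda>s. \<psi> (z, s)" "b z" 0 UNIV f "\<lambda>y. y \<bullet> v"]
          der[OF z(2), of 0] v(1) \<psi>0[OF z(2)]
        by (simp add: o_def has_derivative_at_withinI gderiv_def)
      ultimately have "g' y (b y) = b z \<bullet> v"
        unfolding orbit by (rule vector_derivative_unique_at)
      then show ?thesis
        using v(2) by (simp add: inner_commute)
    qed
    show "x \<in> D" "g x = 0"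
      using w M' by auto
  qed
qed

section \<open>Existence of minimizers\<close>

text \<open>The direct method: if all curves of sufficiently small action between the two points have
  equi-Lipschitz parameterizations within a fixed compact set, then a limit of a minimizing
  sequence is a minimizer.\<close>

lemma strong_minimizer_exists:
  fixes D E :: "'a::euclidean_space set"
  assumes "E \<subseteq> D" and S: "has_local_action D l S" and K: "compact K" "K \<subseteq> E"
    and small: "\<gamma>\<^sub>0 \<in> curves_between D E x\<^sub>1 x\<^sub>2" "S \<gamma>\<^sub>0 < \<sigma>"
    and par: "\<And>\<gamma>. \<gamma> \<in> curves_between D E x\<^sub>1 x\<^sub>2 \<Longrightarrow> S \<gamma> < \<sigma> \<Longrightarrow>
      \<exists>\<phi>. (1, \<phi>) \<in> \<gamma> \<and> \<eta>-lipschitz_on {0..1} \<phi> \<and> \<phi> ` {0..1} \<subseteq> K"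
  shows "\<exists>\<gamma>. strong_minimizer D E S x\<^sub>1 x\<^sub>2 \<gamma> \<and> curve_image \<gamma> \<subseteq> K \<and> curve_length \<gamma> \<le> ennreal \<eta>"
proof -
  let ?\<Gamma> = "curves_between D E x\<^sub>1 x\<^sub>2"
  have l: "local_action D l" using S by (simp add: has_local_action_def)
  have "K \<subseteq> D" using K(2) \<open>E \<subseteq> D\<close> by blast
  define I where "I = (INF \<gamma>\<in>?\<Gamma>. S \<gamma>)"
  have "I < \<sigma>"
    unfolding I_def using small by (meson INF_lower order.strict_trans1)
  obtain a :: "nat \<Rightarrow> ennreal" where a: "decseq a" "range a \<subseteq> S ` ?\<Gamma>" "Inf (S ` ?\<Gamma>) = (INF i. a i)"
    using ennreal_Inf_countable_INF[of "S ` ?\<Gamma>"] small(1) by blast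
  have "a \<longlonglongrightarrow> I"
    using LIMSEQ_INF[OF a(1)] a(3) by (simp add: I_def)
  then have "\<forall>\<^sub>F n in sequentially. a n < \<sigma>"
    using \<open>I < \<sigma>\<close> by (rule order_tendstoD)
  then obtain n0 where n0: "\<And>n. n \<ge> n0 \<Longrightarrow> a n < \<sigma>"
    unfolding eventually_sequentially by blast
  have "\<exists>\<gamma>. \<gamma> \<in> ?\<Gamma> \<and> S \<gamma> = a (n + n0)" for n
    using a(2) by (metis (no_types, lifting) imageE rangeI subsetD)
  then obtain \<gamma> where \<gamma>: "\<And>n. \<gamma> n \<in> ?\<Gamma>" "\<And>n. S (\<gamma> n) = a (n + n0)"
    by metis
  have "S (\<gamma> n) < \<sigma>" for n
    using n0 \<gamma>(2) by simp
  then have "\<exists>\<phi>. (1, \<phi>) \<in> \<gamma> n \<and> \<eta>-lipschitz_on {0..1} \<phi> \<and> \<phi> ` {0..1} \<subseteq> K" for n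
    using par \<gamma>(1) by blast
  then obtain \<phi> where \<phi>: "\<And>n. (1, \<phi> n) \<in> \<gamma> n" "\<And>n. \<eta>-lipschitz_on {0..1} (\<phi> n)" "\<And>n. \<phi> n ` {0..1} \<subseteq> K"
    by metis
  have \<eta>: "0 \<le> \<eta>" using \<phi>(2) by (rule lipschitz_on_nonneg)
  have "\<exists>s\<ge>0. S (\<gamma> n) = ennreal s \<and> action_sum l (\<phi> n) \<longlonglongrightarrow> s" for n
    using action_of_lipschitz_curve[OF S \<gamma>(1) \<phi>(1) \<open>E \<subseteq> D\<close> \<phi>(2)] by metis
  then obtain s where s: "\<And>n. 0 \<le> s n" "\<And>n. S (\<gamma> n) = ennreal (s n)" "\<And>n. action_sum l (\<phi> n) \<longlonglongrightarrow> s n"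
    by metis
  have "I < top" using \<open>I < \<sigma>\<close> top_greatest by (rule order.strict_trans2)
  then obtain c where c: "0 \<le> c" "I = ennreal c"
    by (cases I) auto
  have "(\<lambda>n. ennreal (s n)) \<longlonglongrightarrow> ennreal c"
    using LIMSEQ_ignore_initial_segment[OF \<open>a \<longlonglongrightarrow> I\<close>, of n0] by (simp add: c(2) flip: s(2) \<gamma>(2))
  then have s_lim: "s \<longlonglongrightarrow> c"
    using s(1) c(1) by (intro tendsto_ennrealD) auto
  obtain R where R: "\<And>y. y \<in> K \<Longrightarrow> norm y \<le> R"
    using compact_imp_bounded[OF K(1)] by (auto simp: bounded_iff)
  obtain h ks where h: "strict_mono (ks :: nat \<Rightarrow> nat)"
    "\<And>e. 0 < e \<Longrightarrow> \<exists>N. \<forall>n t. n \<ge> N \<and> t \<in> {0..1} \<longrightarrow> norm (\<phi> (ks n) t - h t) < e"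
  proof (rule Arzela_Ascoli[of "{0..1::real}" \<phi> R])
    show "norm (\<phi> n t) \<le> R" if "t \<in> {0..1}" for n t
      using \<phi>(3) that by (intro R) blast
    show "\<exists>d>0. \<forall>n u. u \<in> {0..1} \<and> norm (t - u) < d \<longrightarrow> norm (\<phi> n t - \<phi> n u) < e"
      if "t \<in> {0..1}" "0 < e" for t e
    proof (intro exI[of _ "e / (\<eta> + 1)"] conjI allI impI)
      fix n u assume u: "u \<in> {0..1} \<and> norm (t - u) < e / (\<eta> + 1)"
      have "dist (\<phi> n t) (\<phi> n u) \<le> \<eta> * dist t u"
        using u that by (intro lipschitz_onD[OF \<phi>(2)]) auto
      also have "\<dots> \<le> (\<eta> + 1) * dist t u"
        by (intro mult_right_mono) auto
      also have "\<dots> < e"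
        using u \<eta> by (simp add: dist_norm pos_less_divide_eq mult.commute)
      finally show "norm (\<phi> n t - \<phi> n u) < e" by (simp add: dist_norm)
    qed (use that \<eta> in auto)
  qed auto
  have unif: "\<forall>\<^sub>F n in sequentially. \<forall>t\<in>{0..1}. dist (\<phi> (ks n) t) (h t) < e" if "e > 0" for e
    using h(2)[OF that] unfolding eventually_sequentially dist_norm by blast
  have pointwise: "(\<lambda>n. \<phi> (ks n) t) \<longlonglongrightarrow> h t" if "t \<in> {0..1}" for t
  proof (rule tendstoI)
    fix e :: real assume "e > 0"
    show "\<forall>\<^sub>F n in sequentially. dist (\<phi> (ks n) t) (h t) < e"
      using unif[OF \<open>e > 0\<close>] by eventually_elim (use that in auto)
  qed
  have h_lip: "\<eta>-lipschitz_on {0..1} h"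
  proof (rule lipschitz_onI[OF _ \<eta>])
    fix t u :: real assume tu: "t \<in> {0..1}" "u \<in> {0..1}"
    show "dist (h t) (h u) \<le> \<eta> * dist t u"
      by (rule LIMSEQ_le_const2[OF tendsto_dist[OF pointwise[OF tu(1)] pointwise[OF tu(2)]]])
         (use lipschitz_onD[OF \<phi>(2) tu] in auto)
  qed
  have h_K: "h ` {0..1} \<subseteq> K"
  proof
    fix y assume "y \<in> h ` {0..1}"
    then obtain t where t: "t \<in> {0..1}" "y = h t" by blast
    show "y \<in> K"
      unfolding t(2) using compact_imp_closed[OF K(1)]
      by (rule closed_sequentially[OF _ _ pointwise[OF t(1)]]) (use \<phi>(3) t(1) in blast)
  qed
  have "\<phi> n 0 = x\<^sub>1" "\<phi> n 1 = x\<^sub>2" for n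
    using curves_between_parameterization[OF \<gamma>(1) \<phi>(1)] by auto
  then have h_ends: "h 0 = x\<^sub>1" "h 1 = x\<^sub>2"
    using pointwise[of 0] pointwise[of 1] by (auto simp: LIMSEQ_const_iff)
  obtain \<gamma>' where \<gamma>': "\<gamma>' \<in> ?\<Gamma>" "(1, h) \<in> \<gamma>'" "curve_image \<gamma>' \<subseteq> h ` {0..1}" "curve_length \<gamma>' \<le> ennreal \<eta>"
    using lipschitz_curve[OF h_lip order_trans[OF h_K K(2)] \<open>E \<subseteq> D\<close>] h_ends by metis
  obtain s' where s': "0 \<le> s'" "S \<gamma>' = ennreal s'" "action_sum l h \<longlonglongrightarrow> s'"
    using action_of_lipschitz_curve[OF S \<gamma>'(1,2) \<open>E \<subseteq> D\<close> h_lip] .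
  have "s' \<le> c"
    using action_lower_semicontinuous[OF l K(1) \<open>K \<subseteq> D\<close> h_lip h_K s'(3) \<phi>(2) \<phi>(3) s(3) unif
        LIMSEQ_subseq_LIMSEQ[OF s_lim h(1), unfolded o_def]] .
  then have "S \<gamma>' \<le> I"
    by (simp add: s' c ennreal_leI)
  moreover have "I \<le> S \<gamma>'"
    unfolding I_def using \<gamma>'(1) by (rule INF_lower)
  ultimately have "strong_minimizer D E S x\<^sub>1 x\<^sub>2 \<gamma>'"
    using \<gamma>'(1) by (simp add: strong_minimizer_def I_def)
  then show ?thesis
    using \<gamma>' h_K by blast
qed

text \<open>A continuous function that decreases from at least \<open>p\<close> to at most \<open>q\<close> has a part that runs from
  \<open>p\<close> to \<open>q\<close> between these two values: up to the first time at which it reaches \<open>q\<close>, from the last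
  time before at which it is at least \<open>p\<close>.\<close>

lemma continuous_drop_interval:
  fixes \<kappa> :: "real \<Rightarrow> real"
  assumes cont: "continuous_on {a..b} \<kappa>" and "a \<le> b" "p > q" "\<kappa> a \<ge> p" "\<kappa> b \<le> q"
  obtains s t where "a \<le> s" "s < t" "t \<le> b" "\<kappa> s = p" "\<kappa> t = q" "\<And>u. u \<in> {s..t} \<Longrightarrow> q \<le> \<kappa> u \<and> \<kappa> u \<le> p"
proof -
  define Q where "Q = {u\<in>{a..b}. \<kappa> u \<le> q}"
  have "closed Q"
    unfolding Q_def using continuous_on_closed_Collect_le[OF cont continuous_on_const closed_atLeastAtMost] .
  moreover have "b \<in> Q" "bdd_below Q"
    using assms by (auto simp: Q_def)
  ultimately have t: "Inf Q \<in> Q"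
    by (intro closed_contains_Inf) auto
  define t where "t = Inf Q"
  have above: "q < \<kappa> u" if "u \<in> {a..<t}" for u
    using t cInf_lower[OF _ \<open>bdd_below Q\<close>, of u] that unfolding t_def by (force simp: Q_def)+
  have tQ: "a \<le> t" "t \<le> b" "\<kappa> t \<le> q"
    using t unfolding t_def by (auto simp: Q_def)
  have cont_t: "continuous_on {a..t} \<kappa>"
    using cont tQ by (auto elim: continuous_on_subset)
  have "a \<noteq> t" using assms tQ by auto
  have "\<kappa> t = q"
  proof (rule ccontr)
    assume "\<kappa> t \<noteq> q"
    then have "\<kappa> t < q" using tQ by simp
    then obtain u where "a \<le> u" "u \<le> t" "\<kappa> u = q"
      using IVT2'[OF _ _ tQ(1) cont_t, of q] assms by auto
    then show False
      using above[of u] \<open>\<kappa> t < q\<close> by (cases "u = t") auto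
  qed
  define P where "P = {u\<in>{a..t}. p \<le> \<kappa> u}"
  have "closed P"
    unfolding P_def using continuous_on_closed_Collect_le[OF continuous_on_const cont_t closed_atLeastAtMost] .
  moreover have "a \<in> P" "bdd_above P"
    using assms tQ by (auto simp: P_def)
  ultimately have s: "Sup P \<in> P"
    by (intro closed_contains_Sup) auto
  define s where "s = Sup P"
  have sP: "a \<le> s" "s \<le> t" "p \<le> \<kappa> s"
    using s unfolding s_def by (auto simp: P_def)
  have below: "\<kappa> u < p" if "u \<in> {s<..t}" for u
    using cSup_upper[OF _ \<open>bdd_above P\<close>, of u] that sP unfolding s_def by (force simp: P_def)
  have "s \<noteq> t" using sP \<open>\<kappa> t = q\<close> assms by auto
  have "\<kappa> s = p"
  proof (rule ccontr)
    assume "\<kappa> s \<noteq> p"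
    then have "p < \<kappa> s" using sP by simp
    moreover have "continuous_on {s..t} \<kappa>"
      using cont_t sP by (auto elim: continuous_on_subset)
    ultimately obtain u where "s \<le> u" "u \<le> t" "\<kappa> u = p"
      using IVT2'[of \<kappa> t p s] sP \<open>\<kappa> t = q\<close> assms by auto
    then show False
      using below[of u] \<open>p < \<kappa> s\<close> by (cases "u = s") auto
  qed
  show thesis
  proof (rule that[of s t])
    fix u assume u: "u \<in> {s..t}"
    have "q \<le> \<kappa> u"
      using above[of u] u sP \<open>\<kappa> t = q\<close> by (cases "u = t") auto
    moreover have "\<kappa> u \<le> p"
      using below[of u] u \<open>\<kappa> s = p\<close> by (cases "u = s") auto
    ultimately show "q \<le> \<kappa> u \<and> \<kappa> u \<le> p" ..
  qed (use sP tQ \<open>s \<noteq> t\<close> \<open>\<kappa> s = p\<close> \<open>\<kappa> t = q\<close> in auto)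
qed

text \<open>The theorem for a point on the zero set of a level function \<open>g\<close> that increases along the drift.
  Curves of small action between points near \<open>x\<close> cannot leave the neighbourhood \<open>V\<close> of the zero
  set, and are of bounded length there.\<close>

lemma strong_local_minimizers_on_manifold:
  fixes D E :: "'a::euclidean_space set" and g :: "'a \<Rightarrow> real" and g' :: "'a \<Rightarrow> 'a \<Rightarrow>\<^sub>L real"
  assumes "open D" "E \<subseteq> D" and closed: "closedin (top_of_set D) E" and short: "locally_short_connected D E"
    and S: "has_local_action D l S" and "continuous_on D b"
    and drift: "\<And>K. compact K \<Longrightarrow> K \<subseteq> D \<Longrightarrow> \<exists>c>0. \<forall>x\<in>K. \<forall>y. c * (norm (b x) * norm y - b x \<bullet> y) \<le> l x y"
    and g: "continuous_on D g" "compact {y \<in> D. g y = 0}" "open U" "{y \<in> D. g y = 0} \<subseteq> U" "U \<subseteq> D"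
    and g': "\<And>y. y \<in> U \<Longrightarrow> (g has_derivative blinfun_apply (g' y)) (at y)" "continuous_on U g'"
      "\<And>y. y \<in> D \<Longrightarrow> g y = 0 \<Longrightarrow> 0 < g' y (b y)"
    and x: "x \<in> E" "g x = 0"
  shows "has_strong_local_minimizers D E S x"
proof -
  have l: "local_action D l" using S by (simp add: has_local_action_def)
  define M where "M = {y \<in> D. g y = 0}"
  have "x \<in> M" using x \<open>E \<subseteq> D\<close> by (auto simp: M_def)
  define P where "P = U \<inter> (\<lambda>y. g' y (b y)) -` {0<..}"
  have "continuous_on U (\<lambda>y. g' y (b y))"
    using g'(2) \<open>continuous_on D b\<close> g(5) by (intro continuous_intros) (auto elim: continuous_on_subset)
  then have "open P"
    unfolding P_def using g(3) by (intro continuous_open_preimage) auto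
  have "M \<subseteq> P"
    using g(4) g'(3) by (auto simp: M_def P_def)
  obtain e where e: "e > 0" "(\<Union>y\<in>M. cball y e) \<subseteq> P"
    using compact_subset_open_imp_cball_epsilon_subset[OF g(2)[folded M_def] \<open>open P\<close> \<open>M \<subseteq> P\<close>] .
  define V where "V = (\<Union>y\<in>M. cball y e)"
  define W where "W = (\<Union>y\<in>M. ball y e)"
  have "compact V"
    unfolding V_def using g(2) by (intro compact_Union_cball) (auto simp: M_def)
  have "V \<subseteq> P" using e(2) by (simp add: V_def)
  then have "V \<subseteq> U" "V \<subseteq> D" using g(5) by (auto simp: P_def)
  have "open W" "M \<subseteq> W" "W \<subseteq> V"
    using e(1) by (auto simp: W_def V_def intro: less_imp_le)
  obtain \<tau> where \<tau>: "\<tau> > 0" "\<And>y. y \<in> V - W \<Longrightarrow> \<tau> < \<bar>g y\<bar>"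
  proof (cases "V - W = {}")
    case False
    have "compact (V - W)" using \<open>compact V\<close> \<open>open W\<close> by (rule compact_diff)
    moreover have "continuous_on (V - W) (\<lambda>y. \<bar>g y\<bar>)"
      using g(1) \<open>V \<subseteq> D\<close> by (intro continuous_intros) (auto elim: continuous_on_subset)
    ultimately obtain y0 where y0: "y0 \<in> V - W" "\<And>y. y \<in> V - W \<Longrightarrow> \<bar>g y0\<bar> \<le> \<bar>g y\<bar>"
      using continuous_attains_inf False by metis
    have "g y0 \<noteq> 0" using y0(1) \<open>V \<subseteq> D\<close> \<open>M \<subseteq> W\<close> by (auto simp: M_def)
    then show thesis
      using y0(2) by (intro that[of "\<bar>g y0\<bar> / 2"]) force+
  qed (use that[of 1] in auto)
  \<comment> \<open>The level function, truncated at \<open>\<plusminus>\<tau>\<close>; outside \<open>V\<close> only its sign is kept. On the overlap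
      \<open>V - W\<close> both definitions agree by the choice of \<open>\<tau>\<close>.\<close>
  define k where "k y = (if y \<in> V then max (- \<tau>) (min \<tau> (g y)) else \<tau> * sgn (g y))" for y
  have "continuous_on (V \<union> (D - W)) k"
    unfolding k_def
  proof (rule continuous_on_cases_local)
    have VD: "V \<union> (D - W) = D" using \<open>V \<subseteq> D\<close> \<open>W \<subseteq> V\<close> by blast
    show "closedin (top_of_set (V \<union> (D - W))) V"
      unfolding VD using \<open>compact V\<close> \<open>V \<subseteq> D\<close> by (intro closed_subset compact_imp_closed)
    show "closedin (top_of_set (V \<union> (D - W))) (D - W)"
      unfolding VD using \<open>open W\<close> by (simp add: closedin_diff openin_open_Int Diff_Int_distrib2 closedin_closed Diff_eq) (metis closed_Compl)
    show "continuous_on V (\<lambda>y. max (- \<tau>) (min \<tau> (g y)))"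
      using g(1) \<open>V \<subseteq> D\<close> by (intro continuous_intros) (auto elim: continuous_on_subset)
    show "continuous_on (D - W) (\<lambda>y. \<tau> * sgn (g y))"
      using g(1) \<open>M \<subseteq> W\<close>
      by (intro continuous_intros continuous_on_sgn) (auto simp: M_def elim: continuous_on_subset)
    show "max (- \<tau>) (min \<tau> (g y)) = \<tau> * sgn (g y)"
      if "y \<in> V \<and> y \<notin> V \<or> y \<in> D - W \<and> y \<in> V" for y
    proof -
      have "\<tau> < \<bar>g y\<bar>" using that by (intro \<tau>(2)) auto
      then show ?thesis using \<tau>(1) by (cases "g y > 0") auto
    qed
  qed
  moreover have "V \<union> (D - W) = D" using \<open>V \<subseteq> D\<close> \<open>W \<subseteq> V\<close> by blast
  ultimately have cont_k: "continuous_on D k" by simp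
  have k_inner: "y \<in> V \<and> k y = g y" if "y \<in> D" "\<bar>k y\<bar> < \<tau>" for y
  proof -
    have "y \<in> V"
    proof (rule ccontr)
      assume "y \<notin> V"
      moreover from this have "g y \<noteq> 0" using that(1) \<open>M \<subseteq> W\<close> \<open>W \<subseteq> V\<close> by (auto simp: M_def)
      ultimately have "\<bar>k y\<bar> = \<tau>" using \<tau>(1) by (simp add: k_def abs_mult sgn_if)
      then show False using that(2) by simp
    qed
    then show ?thesis using that(2) \<tau>(1) by (auto simp: k_def max_def min_def split: if_splits)
  qed
  have k_outer: "k y = \<tau> \<or> k y = - \<tau>" if "y \<in> D" "y \<notin> V" for y
    using that \<open>M \<subseteq> W\<close> \<open>W \<subseteq> V\<close> by (auto simp: k_def sgn_if M_def)
  obtain c where c: "c > 0" "\<And>x y. x \<in> V \<Longrightarrow> c * (norm (b x) * norm y - b x \<bullet> y) \<le> l x y"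
    using drift[OF \<open>compact V\<close> \<open>V \<subseteq> D\<close>] by blast
  have cont_V: "continuous_on V b" "continuous_on V g'"
    using \<open>continuous_on D b\<close> g'(2) \<open>V \<subseteq> D\<close> \<open>V \<subseteq> U\<close> by (auto elim: continuous_on_subset)
  have pos_V: "0 < g' y (b y)" if "y \<in> V" for y
    using that \<open>V \<subseteq> P\<close> by (auto simp: P_def)
  have "\<exists>A>0. \<exists>B>0. \<forall>x\<in>V. \<forall>y. norm y \<le> A * l x y + B * g' x y"
    by (rule drift_controls_length[where b = b and c = c]) (fact \<open>compact V\<close> cont_V pos_V c)+
  then obtain A B where AB: "0 < A" "0 < B" "\<And>x y. x \<in> V \<Longrightarrow> norm y \<le> A * l x y + B * g' x y"
    by blast
  obtain R where R: "R > 0" "cball x R \<subseteq> W"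
    using \<open>open W\<close> \<open>M \<subseteq> W\<close> \<open>x \<in> M\<close> open_contains_cball by blast
  have "cball x R \<subseteq> V" "cball x R \<subseteq> D" using R(2) \<open>W \<subseteq> V\<close> \<open>V \<subseteq> D\<close> by auto
  obtain C where C: "C > 0" "\<And>y v. y \<in> cball x R \<Longrightarrow> l y v \<le> C * norm v"
    using local_action_bounded[OF l compact_cball \<open>cball x R \<subseteq> D\<close>] by blast
  \<comment> \<open>Half of the action that a decrease of the level function by \<open>\<tau> / 2\<close> costs.\<close>
  define \<sigma> where "\<sigma> = B * \<tau> / (4 * A)"
  have \<sigma>: "\<sigma> > 0" "A * \<sigma> = B * \<tau> / 4" using AB \<tau>(1) by (auto simp: \<sigma>_def)
  \<comment> \<open>Curves from \<open>x\<close> of length \<open>\<nu>\<close> have parameterizations with Lipschitz constant \<open>2 \<nu>\<close>, and joining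
      two of them gives the constant \<open>4 \<nu>\<close>.\<close>
  define \<nu> where "\<nu> = min (R / 2) (\<sigma> / (8 * C))"
  have \<nu>: "\<nu> > 0" "2 * \<nu> \<le> R" "C * (4 * \<nu>) < \<sigma>"
  proof -
    show "\<nu> > 0" "2 * \<nu> \<le> R" using R \<sigma> C(1) by (auto simp: \<nu>_def)
    have "C * (4 * \<nu>) \<le> C * (4 * (\<sigma> / (8 * C)))"
      using C(1) by (intro mult_left_mono) (auto simp: \<nu>_def)
    also have "\<dots> < \<sigma>" using C(1) \<sigma>(1) by simp
    finally show "C * (4 * \<nu>) < \<sigma>" .
  qed
  obtain r0 where r0: "r0 > 0" "\<And>w. w \<in> cball x r0 \<inter> E \<Longrightarrow> \<exists>\<gamma>\<in>curves_between D E x w. curve_length \<gamma> \<le> ennreal \<nu>"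
    using short x(1) \<nu>(1) unfolding locally_short_connected_def by blast
  have "continuous (at x) g"
    using g'(1) \<open>x \<in> M\<close> g(4) by (auto simp: M_def intro: has_derivative_continuous)
  then obtain r1 where r1: "r1 > 0" "\<And>y. dist y x < r1 \<Longrightarrow> \<bar>g y\<bar> < \<tau> / 4"
    using x(2) \<tau>(1) unfolding continuous_at_eps_delta
    by (metis dist_0_norm dist_commute divide_pos_pos real_norm_def zero_less_numeral)
  define r where "r = min (min r0 (r1 / 2)) R"
  have r: "r > 0" using r0(1) r1(1) R(1) by (simp add: r_def)
  \<comment> \<open>The length of the curves considered is at most \<open>A \<sigma> + B \<tau> / 2 \<le> B \<tau>\<close>; the
      summand \<open>1\<close> leaves room for the reparameterization.\<close>
  define \<eta> where "\<eta> = B * \<tau> + 1"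
  have "\<eta> > 0" using AB(2) \<tau>(1) by (simp add: \<eta>_def add_pos_pos)
  define K where "K = V \<inter> E"
  have "compact K" "K \<subseteq> E"
  proof -
    obtain T where "closed T" "E = D \<inter> T"
      using closed unfolding closedin_closed by blast
    then have "K = V \<inter> T" using \<open>V \<subseteq> D\<close> by (auto simp: K_def)
    then show "compact K" using \<open>compact V\<close> \<open>closed T\<close> by (simp add: compact_Int_closed)
  qed (auto simp: K_def)
  have "\<exists>\<gamma>. strong_minimizer D E S x\<^sub>1 x\<^sub>2 \<gamma> \<and> curve_image \<gamma> \<subseteq> K \<and> curve_length \<gamma> \<le> ennreal \<eta>"
    if x12: "x\<^sub>1 \<in> cball x r \<inter> E" "x\<^sub>2 \<in> cball x r \<inter> E" for x\<^sub>1 x\<^sub>2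
  proof -
    have near: "y \<in> V" "\<bar>g y\<bar> < \<tau> / 4" "k y = g y" if "y \<in> cball x r" for y
    proof -
      show "y \<in> V" using that \<open>cball x R \<subseteq> V\<close> by (auto simp: r_def)
      show "\<bar>g y\<bar> < \<tau> / 4" using that r1 by (auto simp: r_def dist_commute)
      with \<open>y \<in> V\<close> show "k y = g y" using \<tau>(1) by (auto simp: k_def)
    qed
    have to_x: "\<exists>\<phi> :: real \<Rightarrow> 'a. (2 * \<nu>)-lipschitz_on {0..1} \<phi> \<and> \<phi> ` {0..1} \<subseteq> E \<and> \<phi> 0 = x \<and> \<phi> 1 = w" if w: "w \<in> cball x r \<inter> E" for w
    proof -
      obtain \<gamma> where \<gamma>: "\<gamma> \<in> curves_between D E x w" "curve_length \<gamma> \<le> ennreal \<nu>"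
        using r0(2)[of w] w by (auto simp: r_def)
      obtain \<phi> where \<phi>: "(1, \<phi>) \<in> \<gamma>" "(\<nu> + \<nu>)-lipschitz_on {0..1} \<phi>"
        using lipschitz_parameterization[OF \<gamma> less_imp_le[OF \<nu>(1)] \<nu>(1)] .
      have "(2 * \<nu>)-lipschitz_on {0..1} \<phi>"
        using \<phi>(2) by (simp only: mult_2)
      then show ?thesis
        using curves_between_parameterization[OF \<gamma>(1) \<phi>(1)] by (intro exI[of _ \<phi>] conjI)
    qed
    obtain \<phi>\<^sub>1 :: "real \<Rightarrow> 'a" where \<phi>1: "(2 * \<nu>)-lipschitz_on {0..1} \<phi>\<^sub>1" "\<phi>\<^sub>1 ` {0..1} \<subseteq> E" "\<phi>\<^sub>1 0 = x" "\<phi>\<^sub>1 1 = x\<^sub>1"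
      using to_x[OF x12(1)] by blast
    obtain \<phi>\<^sub>2 :: "real \<Rightarrow> 'a" where \<phi>2: "(2 * \<nu>)-lipschitz_on {0..1} \<phi>\<^sub>2" "\<phi>\<^sub>2 ` {0..1} \<subseteq> E" "\<phi>\<^sub>2 0 = x" "\<phi>\<^sub>2 1 = x\<^sub>2"
      using to_x[OF x12(2)] by blast
    have in_ball: "\<phi> ` {0..1} \<subseteq> cball x R" if \<phi>: "(2 * \<nu>)-lipschitz_on {0..1} \<phi>" "\<phi> 0 = x" for \<phi> :: "real \<Rightarrow> 'a"
    proof
      fix y assume "y \<in> \<phi> ` {0..1}"
      then obtain t where t: "t \<in> {0..1}" "y = \<phi> t" by blast
      have "dist (\<phi> 0) (\<phi> t) \<le> 2 * \<nu> * dist 0 t"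
        using t by (intro lipschitz_onD[OF \<phi>(1)]) auto
      also have "\<dots> \<le> 2 * \<nu> * 1"
        using t \<nu>(1) by (intro mult_left_mono) (auto simp: dist_real_def)
      finally show "y \<in> cball x R" using t \<phi>(2) \<nu>(2) by simp
    qed
    have "\<phi>\<^sub>1 0 = \<phi>\<^sub>2 0" using \<phi>1(3) \<phi>2(3) by simp
    then obtain \<phi>\<^sub>0 :: "real \<Rightarrow> 'a" where \<phi>0: "(2 * (2 * \<nu>))-lipschitz_on {0..1} \<phi>\<^sub>0" "\<phi>\<^sub>0 0 = \<phi>\<^sub>1 1" "\<phi>\<^sub>0 1 = \<phi>\<^sub>2 1"
      "\<phi>\<^sub>0 ` {0..1} \<subseteq> \<phi>\<^sub>1 ` {0..1} \<union> \<phi>\<^sub>2 ` {0..1}"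
      using lipschitz_join_at_start[OF \<phi>1(1) \<phi>2(1)] by blast
    have \<phi>0_E: "\<phi>\<^sub>0 ` {0..1} \<subseteq> E"
      using order_trans[OF \<phi>0(4) Un_least[OF \<phi>1(2) \<phi>2(2)]] .
    obtain \<gamma>\<^sub>0 where "\<gamma>\<^sub>0 \<in> curves_between D E (\<phi>\<^sub>0 0) (\<phi>\<^sub>0 1)" "(1, \<phi>\<^sub>0) \<in> \<gamma>\<^sub>0"
      by (rule lipschitz_curve[OF \<phi>0(1) \<phi>0_E \<open>E \<subseteq> D\<close>])
    then have \<gamma>0: "\<gamma>\<^sub>0 \<in> curves_between D E x\<^sub>1 x\<^sub>2" "(1, \<phi>\<^sub>0) \<in> \<gamma>\<^sub>0"
      by (simp_all only: \<phi>0(2,3) \<phi>1(4) \<phi>2(4))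
    have "S \<gamma>\<^sub>0 < ennreal \<sigma>"
    proof -
      obtain s where s: "0 \<le> s" "S \<gamma>\<^sub>0 = ennreal s" "action_sum l \<phi>\<^sub>0 \<longlonglongrightarrow> s"
        using action_of_lipschitz_curve[OF S \<gamma>0 \<open>E \<subseteq> D\<close> \<phi>0(1)] .
      have "\<phi>\<^sub>0 ` {0..1} \<subseteq> cball x R"
        using order_trans[OF \<phi>0(4) Un_least[OF in_ball[OF \<phi>1(1,3)] in_ball[OF \<phi>2(1,3)]]] .
      then have "action_sum l \<phi>\<^sub>0 N \<le> C * (2 * (2 * \<nu>))" for N
        using C by (intro action_sum_le[OF \<phi>0(1)]) auto
      then have "s \<le> C * (2 * (2 * \<nu>))"
        by (intro LIMSEQ_le_const2[OF s(3)]) auto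
      then have "s < \<sigma>" using \<nu>(3) by simp
      then show ?thesis using s \<sigma>(1) by (simp add: ennreal_lessI)
    qed
    moreover have "\<exists>\<phi>. (1, \<phi>) \<in> \<gamma> \<and> \<eta>-lipschitz_on {0..1} \<phi> \<and> \<phi> ` {0..1} \<subseteq> K"
      if \<gamma>: "\<gamma> \<in> curves_between D E x\<^sub>1 x\<^sub>2" "S \<gamma> < ennreal \<sigma>" for \<gamma>
    proof -
      obtain T \<theta> \<beta> L where \<theta>: "time_change T \<beta>" "L-lipschitz_on {0..1} (\<theta> \<circ> \<beta>)"
        "\<And>\<alpha>. time_change T \<alpha> \<Longrightarrow> (1, \<theta> \<circ> \<alpha>) \<in> \<gamma>"
        using lipschitz_reparameterized_in_curve[OF \<gamma>(1)] by metis
      define \<phi> where "\<phi> = \<theta> \<circ> \<beta>"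
      have \<phi>: "(1, \<phi>) \<in> \<gamma>" "L-lipschitz_on {0..1} \<phi>"
        using \<theta> by (auto simp: \<phi>_def)
      have \<phi>_E: "\<phi> ` {0..1} \<subseteq> E" and ends: "\<phi> 0 = x\<^sub>1" "\<phi> 1 = x\<^sub>2"
        using curves_between_parameterization[OF \<gamma>(1) \<phi>(1)] by auto
      then have \<phi>_D: "\<phi> ` {0..1} \<subseteq> D" using \<open>E \<subseteq> D\<close> by blast
      obtain s where s: "0 \<le> s" "S \<gamma> = ennreal s" "action_sum l \<phi> \<longlonglongrightarrow> s"
        using action_of_lipschitz_curve[OF S \<gamma>(1) \<phi>(1) \<open>E \<subseteq> D\<close> \<phi>(2)] .
      have "s < \<sigma>" using \<gamma>(2) s by (simp add: ennreal_less_iff)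
      then have As: "A * s < B * \<tau> / 4" using AB(1) \<sigma>(2) by (metis mult_less_cancel_left_pos)
      interpret controlled_curve D U V l g g' A B L s \<phi>
        using l g(3,5) \<open>compact V\<close> \<open>V \<subseteq> U\<close> g'(1,2) AB \<phi>(2) \<phi>_D s(3) by unfold_locales auto
      have cont_\<kappa>: "continuous_on {0..1} (\<lambda>t. k (\<phi> t))"
        by (rule continuous_on_compose2[OF cont_k lipschitz_on_continuous_on[OF \<phi>(2)] \<phi>_D])
      have no_drop: False
        if ab: "0 \<le> a" "a \<le> b'" "b' \<le> 1" "q + \<tau> / 2 \<le> k (\<phi> a)" "k (\<phi> b') \<le> q" "- \<tau> < q" "q + \<tau> / 2 < \<tau>"
        for a b' q
      proof -
        have cont: "continuous_on {a..b'} (\<lambda>t. k (\<phi> t))"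
          using cont_\<kappa> ab by (auto elim: continuous_on_subset)
        have q: "q < q + \<tau> / 2"
          using \<tau>(1) by simp
        obtain t1 t2 where t: "a \<le> t1" "t1 < t2" "t2 \<le> b'" "k (\<phi> t1) = q + \<tau> / 2" "k (\<phi> t2) = q"
            "\<And>u. u \<in> {t1..t2} \<Longrightarrow> q \<le> k (\<phi> u) \<and> k (\<phi> u) \<le> q + \<tau> / 2"
          using continuous_drop_interval[OF cont ab(2) q ab(4,5)] by blast
        have inner: "\<phi> u \<in> V \<and> k (\<phi> u) = g (\<phi> u)" if "u \<in> {t1..t2}" for u
          using t(6)[OF that] \<open>- \<tau> < q\<close> \<open>q + \<tau> / 2 < \<tau>\<close> t(1,3) \<open>0 \<le> a\<close> \<open>b' \<le> 1\<close> that \<phi>_D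
          by (intro k_inner) auto
        have "B * (g (\<phi> t1) - g (\<phi> t2)) \<le> A * s"
          using t ab inner by (intro decrease_costs_action) auto
        moreover have "g (\<phi> t1) - g (\<phi> t2) = \<tau> / 2"
          using inner[of t1] inner[of t2] t by simp
        ultimately have "B * \<tau> / 2 \<le> A * s" by simp
        moreover have "0 < B * \<tau>" using AB(2) \<tau>(1) by simp
        ultimately show False using As by linarith
      qed
      have \<phi>_V: "\<phi> t \<in> V" if t: "t \<in> {0..1}" for t
      proof (rule ccontr)
        assume "\<phi> t \<notin> V"
        then consider "k (\<phi> t) = \<tau>" | "k (\<phi> t) = - \<tau>"
          using k_outer \<phi>_D t by blast
        then show False
        proof cases
          \<comment> \<open>\<open>k\<close> must come down from \<open>\<tau>\<close> to its value at the endpoint.\<close>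
          case 1
          have "k (\<phi> 1) \<le> \<tau> / 4" using near[of x\<^sub>2] x12 ends by auto
          then show False using no_drop[of t 1 "\<tau> / 4"] 1 t \<tau>(1) by simp
        next
          \<comment> \<open>\<open>k\<close> must come down to \<open>-\<tau>\<close> from its value at the starting point.\<close>
          case 2
          have "- \<tau> / 4 \<le> k (\<phi> 0)" using near[of x\<^sub>1] x12 ends by auto
          then show False using no_drop[of 0 t "- 3 * \<tau> / 4"] 2 t \<tau>(1) by simp
        qed
      qed
      have "path_length 1 \<phi> \<le> ennreal (B * \<tau>)"
      proof (rule path_length_le_of_grid[OF \<phi>(2)])
        fix N :: nat assume "0 < N"
        have "(\<Sum>i<N. norm (\<phi> (real (Suc i) / real N) - \<phi> (real i / real N))) \<le> A * s + B * (g (\<phi> 1) - g (\<phi> 0))"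
          using \<phi>_V \<open>0 < N\<close> by (intro grid_length_bound) auto
        also have "B * (g (\<phi> 1) - g (\<phi> 0)) \<le> B * (\<tau> / 2)"
          using near(2)[of x\<^sub>1] near(2)[of x\<^sub>2] x12 ends AB(2) by (intro mult_left_mono) auto
        finally show "(\<Sum>i<N. norm (\<phi> (real (Suc i) / real N) - \<phi> (real i / real N))) \<le> B * \<tau>"
          using As mult_pos_pos[OF AB(2) \<tau>(1)] by linarith
      qed
      \<comment> \<open>The Lipschitz constant \<open>L\<close> depends on \<open>\<gamma>\<close>; now that the length is bounded, reparameterize.\<close>
      then obtain \<alpha> where \<alpha>: "time_change 1 \<alpha>" "\<eta>-lipschitz_on {0..1} (\<phi> \<circ> \<alpha>)"
        unfolding \<eta>_def using AB(2) \<tau>(1) lipschitz_on_continuous_on[OF \<phi>(2)]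
        by (rule_tac lipschitz_reparameterization[of 1 \<phi> "B * \<tau>" 1]) auto
      have "(1, \<phi> \<circ> \<alpha>) \<in> \<gamma>"
        unfolding \<phi>_def comp_assoc by (intro \<theta>(3) time_change_comp \<theta>(1) \<alpha>(1))
      moreover have "(\<phi> \<circ> \<alpha>) ` {0..1} \<subseteq> K"
      proof -
        have "(\<phi> \<circ> \<alpha>) ` {0..1} = \<phi> ` {0..1}"
          using \<alpha>(1) unfolding time_change_def by (metis image_comp)
        then show ?thesis
          using \<phi>_V \<phi>_E unfolding K_def by auto
      qed
      ultimately show ?thesis using \<alpha>(2) by blast
    qed
    ultimately show ?thesis
      using strong_minimizer_exists[OF \<open>E \<subseteq> D\<close> S \<open>compact K\<close> \<open>K \<subseteq> E\<close> \<gamma>0(1)] by blast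
  qed
  then show ?thesis
    unfolding has_strong_local_minimizers_def using r \<open>\<eta> > 0\<close> \<open>compact K\<close> \<open>K \<subseteq> E\<close> by metis
qed

theorem proposition3:
  fixes D E :: "(real ^ 'n) set"
    and S :: "(real ^ 'n) curve \<Rightarrow> ennreal"
    and b :: "real ^ 'n \<Rightarrow> real ^ 'n"
    and \<psi> :: "(real ^ 'n) \<times> real \<Rightarrow> real ^ 'n"
    and M :: "(real ^ 'n) set"
    and x :: "real ^ 'n"
  assumes "open D" and "connected D"
    and "E \<subseteq> D" and "connected E" and "closedin (top_of_set D) E"
    and "locally_short_connected D E"
    and "S \<in> geometric_actions D"
    and "is_drift D S b"
    and "is_flow D b \<psi>"
    and "admissible_manifold D b M"
    and "x \<in> \<psi> ` (M \<times> UNIV) \<inter> E"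
  shows "has_strong_local_minimizers D E S x"
proof -
  have "C1_on D b"
    using \<open>is_drift D S b\<close> by (simp add: is_drift_def)
  obtain l where l: "has_local_action D l S"
    and "\<forall>K. compact K \<and> K \<subseteq> D \<longrightarrow>
      (\<exists>c>0. \<forall>x\<in>K. \<forall>y. c * (norm (b x) * norm y - b x \<bullet> y) \<le> l x y)"
    using \<open>is_drift D S b\<close> unfolding is_drift_def by (elim conjE exE) (rule that)
  then have drift: "\<exists>c>0. \<forall>x\<in>K. \<forall>y. c * (norm (b x) * norm y - b x \<bullet> y) \<le> l x y"
    if "compact K" "K \<subseteq> D" for K
    using that by simp
  have x: "x \<in> E" "x \<in> \<psi> ` (M \<times> UNIV)"
    using IntD2[OF assms(11)] IntD1[OF assms(11)] .
  show ?thesis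
  proof (rule admissible_manifold_through[OF \<open>open D\<close> \<open>C1_on D b\<close> \<open>is_flow D b \<psi>\<close>
        \<open>admissible_manifold D b M\<close> x(2)])
    fix g g' U
    assume g: "continuous_on D (g :: real ^ 'n \<Rightarrow> real)" "compact {y \<in> D. g y = 0}" "open U"
      "{y \<in> D. g y = 0} \<subseteq> U" "U \<subseteq> D"
      "\<And>y. y \<in> U \<Longrightarrow> (g has_derivative blinfun_apply (g' y)) (at y)" "continuous_on U g'"
      "\<And>y. y \<in> D \<Longrightarrow> g y = 0 \<Longrightarrow> 0 < g' y (b y)" "g x = 0"
    show ?thesis
      by (rule strong_local_minimizers_on_manifold[where l = l and b = b and g = g and g' = g' and U = U])
         (fact assms l drift x g C1_on_continuous_on[OF \<open>C1_on D b\<close>])+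
  qed
qed

end
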